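(* Let $\omega(s)=\sum_{j,k=1}^\infty \big(jk(j+k)\big)^{-s}$ for complex $s$. (1) This series converges precisely for $s\in\mathbb{C}$ with $\mathrm{Re}(s)>2/3$, and defines a holomorphic function in that region. (2) $\omega(s)$ can be analytically continued to a meromorphic function on $\mathbb{C}$. (3) $\omega(s)$ has a simple pole at $s=\tfrac23$ with residue $\frac{1}{2\pi\sqrt3}\Gamma\!\left(\tfrac13\right)^3$, and for each $k=0,1,2,\ldots$ a simple pole at $s=\tfrac12-k$ with residue $(-1)^k2^{-4k}\binom{2k}{k}\zeta\!\left(\frac{1-6k}{2}\right)$. It has no other singularities. (4) For any closed interval $I=[a,b]\subset\mathbb{R}$ there exist constants $C,M>0$ such that $|\omega(\sigma+it)|\le C|t|^M$ for all $\sigma\in I$ and all real $t$ with $|t|\ge1$.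
   Context: $\Gamma$ is the Euler gamma function and $\zeta$ the Riemann zeta function; $i=\sqrt{-1}$. *)

theory Defs
  imports "HOL-Complex_Analysis.Complex_Analysis"
begin

text \<open>
  The Riemann zeta function, as the analytic continuation to the complement of 1 of its
  Dirichlet series. The value at the pole 1 is fixed to be 0, so that the continuation is
  unique as a total function.
\<close>
definition riemann_zeta :: "complex \<Rightarrow> complex" where
  "riemann_zeta = (THE f. f holomorphic_on - {1} \<and> f 1 = 0 \<and>
     (\<forall>s. Re s > 1 \<longrightarrow> (\<lambda>n. of_nat (Suc n) powr (- s)) sums f s))"

definition omega_term :: "complex \<Rightarrow> nat \<times> nat \<Rightarrow> complex" where
  "omega_term s = (\<lambda>(j, k). of_nat (j * k * (j + k)) powr (- s))"

definition omega :: "complex \<Rightarrow> complex" where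
  "omega s = infsum (omega_term s) ({1..} \<times> {1..})"

end

theory Submission
  imports Defs
begin

text \<open>
  Collecting the terms with \<open>j + k = n\<close> gives \<open>\<omega>(s) = (\<Sum>n. n powr (- s) * S n s)\<close> with
  \<open>S n s = (\<Sum>j=1..<n. (j * (n - j)) powr (- s))\<close>. Since the summand has the algebraic singularities
  \<open>x powr (- s)\<close> at both ends, Euler--Maclaurin summation yields, for \<open>Re s < 1\<close>,
  \<open>S n s = n powr (1 - 2 * s) * B(1 - s, 1 - s) + 2 * (\<Sum>m<M. (s)\<^sub>m / m! * \<zeta>(s - m) * n powr (- s - m)) + R\<close>
  with a remainder \<open>R\<close> that decays like a power of \<open>n\<close> growing with \<open>M\<close> and depends polynomially on \<open>\<bar>s\<bar>\<close>. Summing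
  over \<open>n\<close> continues \<open>\<omega>\<close> as
  \<open>B(1 - s, 1 - s) * \<zeta>(3 * s - 1) + 2 * (\<Sum>m<M. (s)\<^sub>m / m! * \<zeta>(s - m) * \<zeta>(2 * s + m))\<close> plus a holomorphic function
  of polynomial growth. The factor \<open>\<zeta>(3 * s - 1)\<close> produces the pole at \<open>2/3\<close>, and \<open>\<zeta>(2 * s + m)\<close> the possible pole at
  \<open>(1 - m) / 2\<close>, which is cancelled by \<open>(s)\<^sub>m\<close> for odd \<open>m\<close>. For even \<open>m = 2 * k\<close> it is a genuine pole since
  \<open>\<zeta>(1/2 - 3 * k) \<noteq> 0\<close>, by the functional equation for \<open>k > 0\<close> and by a direct estimate for \<open>k = 0\<close>.
\<close>

subsection \<open>A discrete Euler--Maclaurin step\<close>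

text \<open>The obstacle is that \<open>(j * (n - j)) powr (- s)\<close> is singular at both ends,
  so Euler--Maclaurin cannot be applied to it directly with derivative bounds up to the endpoints.
  The cut-off that isolates one end is a polynomial: every function then stays holomorphic, all
  derivatives are explicit combinations of \<open>(1 - y) powr (r - s - i)\<close> with Pochhammer
  coefficients, and error constants grow only polynomially in \<open>norm s\<close>. A plain Taylor
  expansion at 0 would not do either, since the boundary terms at the far end must be small; the
  cut-off vanishes there to high order. The abscissa 3/4 is a fixed number between 2/3 and 1. Above
  2/3 the continued function overlaps the half-plane of convergence; below 1 all integrals converge
  at 0 and \<open>s - m\<close> never meets the pole of zeta. For fixed \<open>M\<close> the
  expansion is valid only on a strip of bounded depth \<open>L\<close>, with \<open>M\<close> at
  least \<open>2 * L + 3\<close>; strips of different depth fit together because an extra term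
  merely moves between the finite sum and the remainder series.\<close>

text \<open>The coefficients of \<open>1 / (1 - exp (- D)) = 1 / D + (\<Sum>r. em_coeff r * D ^ r)\<close> with \<open>D = d/dx\<close>, so that
  \<open>em_prim R F\<close> is a truncated solution of the difference equation \<open>H x - H (x - 1) = F 1 x\<close> when
  each \<open>F (Suc i)\<close> is the derivative of \<open>F i\<close>.\<close>

fun em_coeff :: "nat \<Rightarrow> complex" where
  "em_coeff t = (-1) ^ t / fact (t + 2) + (\<Sum>r<t. em_coeff r * ((-1) ^ (t - r + 1) / fact (t - r + 1)))"

declare em_coeff.simps [simp del]

definition em_prim :: "nat \<Rightarrow> (nat \<Rightarrow> complex \<Rightarrow> complex) \<Rightarrow> complex \<Rightarrow> complex" where
  "em_prim R F x = F 0 x + (\<Sum>r<R. em_coeff r * F (Suc r) x)"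

text \<open>Bookkeeping of a Cauchy product: the inner index is replaced by the total order
  \<open>t = r + i\<close>.\<close>

lemma sum_triangle_shift:
  fixes g :: "nat \<Rightarrow> nat \<Rightarrow> 'a :: comm_monoid_add"
  shows "(\<Sum>r<Suc n. \<Sum>i<n - r. g r (r + i)) = (\<Sum>t<n. \<Sum>r\<le>t. g r t)"
proof (induction n)
  case (Suc n)
  have "(\<Sum>r<Suc (Suc n). \<Sum>i<Suc n - r. g r (r + i)) = (\<Sum>r<Suc n. \<Sum>i<Suc n - r. g r (r + i))"
    by simp
  also have "\<dots> = (\<Sum>r<Suc n. (\<Sum>i<n - r. g r (r + i)) + g r n)"
    by (intro sum.cong refl) (auto simp: Suc_diff_le)
  also have "\<dots> = (\<Sum>t<n. \<Sum>r\<le>t. g r t) + (\<Sum>r\<le>n. g r n)"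
    unfolding sum.distrib Suc.IH by (simp only: lessThan_Suc_atMost)
  finally show ?case by simp
qed simp

text \<open>Up to sign this is the coefficient of \<open>D ^ (t + 1)\<close> in \<open>(1 - exp (-
  D)) * (1 / D + (\<Sum>r. em_coeff r * D ^ r)) = 1\<close>. Hence \<open>em_coeff r\<close> is the
  Bernoulli number of index \<open>r + 1\<close> divided by \<open>fact (r + 1)\<close>, in the
  convention where the first one is \<open>1 / 2\<close>.\<close>

lemma em_coeff_conv:
  "(-1) ^ (t + 2) / fact (t + 2) + (\<Sum>r\<le>t. em_coeff r * ((-1) ^ (t - r + 1) / fact (t - r + 1))) = 0"
proof -
  have "(\<Sum>r\<le>t. em_coeff r * ((-1) ^ (t - r + 1) / fact (t - r + 1)))
      = (\<Sum>r<t. em_coeff r * ((-1) ^ (t - r + 1) / fact (t - r + 1))) - em_coeff t"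
    by (simp flip: lessThan_Suc_atMost)
  then show ?thesis by (subst (asm) (2) em_coeff.simps) simp
qed

text \<open>Read \<open>f i\<close> as \<open>F i w\<close>, with each value at \<open>w - 1\<close>
  replaced by its Taylor polynomial stopped at derivative \<open>R\<close>. The entries
  \<open>f 0\<close> and \<open>f 1\<close> cancel directly, and the coefficient of
  \<open>f (t + 2)\<close> vanishes by \<open>em_coeff_conv\<close>.\<close>

lemma em_identity:
  assumes "R > 0"
  shows "(f :: nat \<Rightarrow> complex) 1 - f 0 + (\<Sum>i\<le>R. f i * ((-1) ^ i / fact i))
     + (\<Sum>r<R. em_coeff r * (- f (Suc r) + (\<Sum>i\<le>R - Suc r. f (Suc r + i) * ((-1) ^ i / fact i)))) = 0"
proof -
  obtain n where R: "R = Suc n" using assms not0_implies_Suc by auto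
  have 1: "(\<Sum>i\<le>R. f i * ((-1) ^ i / fact i)) = f 0 - f 1 + (\<Sum>t<n. f (t + 2) * ((-1) ^ (t + 2) / fact (t + 2)))"
    unfolding R lessThan_Suc_atMost[symmetric] sum.lessThan_Suc_shift
    by (simp del: sum.lessThan_Suc)
  have 2: "em_coeff r * (- f (Suc r) + (\<Sum>i\<le>R - Suc r. f (Suc r + i) * ((-1) ^ i / fact i)))
      = (\<Sum>i<n - r. f (r + i + 2) * (em_coeff r * ((-1) ^ ((r + i) - r + 1) / fact ((r + i) - r + 1))))"
    if "r < R" for r
  proof -
    have "(\<Sum>i\<le>R - Suc r. f (Suc r + i) * ((-1) ^ i / fact i))
      = (\<Sum>i<Suc (n - r). f (Suc r + i) * ((-1) ^ i / fact i))"
      by (simp add: R lessThan_Suc_atMost)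
    also have "\<dots> = f (Suc r) + (\<Sum>i<n - r. f (Suc (Suc (r + i))) * ((-1) ^ Suc i / fact (Suc i)))"
      by (subst sum.lessThan_Suc_shift) simp
    finally show ?thesis by (simp add: sum_distrib_left mult_ac)
  qed
  have "(\<Sum>r<R. em_coeff r * (- f (Suc r) + (\<Sum>i\<le>R - Suc r. f (Suc r + i) * ((-1) ^ i / fact i))))
      = (\<Sum>r<Suc n. \<Sum>i<n - r. f (r + i + 2) * (em_coeff r * ((-1) ^ ((r + i) - r + 1) / fact ((r + i) - r + 1))))"
    using 2 by (intro sum.cong) (auto simp: R)
  also have "\<dots> = (\<Sum>t<n. \<Sum>r\<le>t. f (t + 2) * (em_coeff r * ((-1) ^ (t - r + 1) / fact (t - r + 1))))"
    by (rule sum_triangle_shift[where g = "\<lambda>r t. f (t + 2) * (em_coeff r * ((-1) ^ (t - r + 1) / fact (t - r + 1)))"])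
  also have "\<dots> = (\<Sum>t<n. f (t + 2) * (\<Sum>r\<le>t. em_coeff r * ((-1) ^ (t - r + 1) / fact (t - r + 1))))"
    by (simp add: sum_distrib_left)
  finally have 3: "(\<Sum>r<R. em_coeff r * (- f (Suc r) + (\<Sum>i\<le>R - Suc r. f (Suc r + i) * ((-1) ^ i / fact i))))
      = (\<Sum>t<n. f (t + 2) * (\<Sum>r\<le>t. em_coeff r * ((-1) ^ (t - r + 1) / fact (t - r + 1))))" .
  have "(\<Sum>t<n. f (t + 2) * ((-1) ^ (t + 2) / fact (t + 2)))
       + (\<Sum>t<n. f (t + 2) * (\<Sum>r\<le>t. em_coeff r * ((-1) ^ (t - r + 1) / fact (t - r + 1)))) = 0"
    unfolding sum.distrib[symmetric] distrib_left[symmetric] em_coeff_conv by simp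
  then show ?thesis unfolding 1 3 by simp
qed

definition em_const :: "nat \<Rightarrow> real" where
  "em_const R = 1 + (\<Sum>r<R. norm (em_coeff r))"

lemma em_const_ge: "em_const R \<ge> 1"
  by (simp add: em_const_def sum_nonneg)

text \<open>The Taylor polynomials cancel by \<open>em_identity\<close>, so only the Taylor
  remainders \<open>T k\<close> survive. All of them stop at derivative \<open>R\<close>, whence a
  single bound on \<open>F (Suc R)\<close> controls each; the step length 1 makes the powers
  disappear.\<close>

lemma em_step:
  fixes F :: "nat \<Rightarrow> complex \<Rightarrow> complex"
  assumes "R > 0" and S: "convex S" "w \<in> S" "w - 1 \<in> S"
    and der: "\<And>i x. x \<in> S \<Longrightarrow> i \<le> R \<Longrightarrow> (F i has_field_derivative F (Suc i) x) (at x within S)"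
    and B: "\<And>x. x \<in> S \<Longrightarrow> norm (F (Suc R) x) \<le> B"
  shows "norm (F 1 w - (em_prim R F w - em_prim R F (w - 1))) \<le> em_const R * B"
proof -
  define T where "T k = F k (w - 1) - (\<Sum>i\<le>R - k. F (k + i) w * ((-1) ^ i / fact i))" for k
  have B0: "B \<ge> 0" using B[OF S(2)] norm_ge_zero order_trans by blast
  have T: "norm (T k) \<le> B" if "k \<le> R" for k
  proof -
    have "norm (F (k + 0) (w - 1) - (\<Sum>i\<le>R - k. F (k + i) w * (w - 1 - w) ^ i / fact i))
        \<le> B * norm (w - 1 - w) ^ Suc (R - k) / fact (R - k)"
      by (rule complex_Taylor[OF S(1), where f = "\<lambda>i. F (k + i)"]) (use that S der B in auto)
    also have "\<dots> \<le> B * 1"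
      using B0 by (simp add: divide_le_eq mult_le_cancel_left1)
    finally show ?thesis by (simp add: T_def)
  qed
  have "F 1 w - (em_prim R F w - em_prim R F (w - 1)) =
      (F 1 w - F 0 w + (\<Sum>i\<le>R. F i w * ((-1) ^ i / fact i))
       + (\<Sum>r<R. em_coeff r * (- F (Suc r) w + (\<Sum>i\<le>R - Suc r. F (Suc r + i) w * ((-1) ^ i / fact i)))))
      + (T 0 + (\<Sum>r<R. em_coeff r * T (Suc r)))"
    by (simp add: em_prim_def T_def ring_distribs sum.distrib sum_subtractf sum_negf)
  also have "\<dots> = T 0 + (\<Sum>r<R. em_coeff r * T (Suc r))"
    by (subst em_identity) (use assms in auto)
  finally have "norm (F 1 w - (em_prim R F w - em_prim R F (w - 1)))
      \<le> norm (T 0) + norm (\<Sum>r<R. em_coeff r * T (Suc r))"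
    by (simp only: norm_triangle_ineq)
  also have "\<dots> \<le> B + (\<Sum>r<R. norm (em_coeff r) * B)"
    by (intro add_mono T sum_norm_le) (auto simp: norm_mult intro!: mult_left_mono T)
  finally show ?thesis by (simp add: em_const_def ring_distribs sum_distrib_right)
qed

lemma em_step_real:
  fixes F :: "nat \<Rightarrow> complex \<Rightarrow> complex" and c :: real
  assumes "R > 0"
    and der: "\<And>i x. c - 1 \<le> x \<Longrightarrow> x \<le> c \<Longrightarrow> i \<le> R \<Longrightarrow>
       (F i has_field_derivative F (Suc i) (of_real x)) (at (of_real x))"
    and B: "\<And>x. c - 1 \<le> x \<Longrightarrow> x \<le> c \<Longrightarrow> norm (F (Suc R) (of_real x)) \<le> B"
  shows "norm (F 1 (of_real c) - (em_prim R F (of_real c) - em_prim R F (of_real c - 1))) \<le> em_const R * B"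
proof -
  let ?S = "closed_segment (of_real (c - 1)) (of_real c) :: complex set"
  have S: "?S = of_real ` {c - 1..c}"
    by (subst closed_segment_of_real) (simp add: closed_segment_eq_real_ivl)
  have mem: "of_real c \<in> ?S" "of_real c - 1 \<in> ?S"
    by simp_all
  have ex: "\<exists>x. y = of_real x \<and> c - 1 \<le> x \<and> x \<le> c" if "y \<in> ?S" for y
    using that unfolding S by auto
  show ?thesis
  proof (rule em_step[where S = ?S, OF assms(1) convex_closed_segment mem])
    fix i y assume "y \<in> ?S" "i \<le> R"
    then show "(F i has_field_derivative F (Suc i) y) (at y within ?S)"
      using ex[of y] der[of _ i] has_field_derivative_at_within by metis
  next
    fix y assume "y \<in> ?S"
    then show "norm (F (Suc R) y) \<le> B"
      using ex[of y] B by metis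
  qed
qed

subsection \<open>The Riemann zeta function\<close>

lemma holomorphic_series:
  fixes f :: "nat \<Rightarrow> complex \<Rightarrow> complex"
  assumes S: "open S" and f: "\<And>n. f n holomorphic_on S"
    and dom: "\<And>x. x \<in> S \<Longrightarrow> \<exists>d>0. \<exists>M. cball x d \<subseteq> S \<and> summable M \<and> (\<forall>n. \<forall>z\<in>cball x d. norm (f n z) \<le> M n)"
  shows "(\<lambda>z. \<Sum>n. f n z) holomorphic_on S"
proof (rule holomorphic_uniform_sequence[OF S, where f = "\<lambda>n z. \<Sum>i<n. f i z"])
  fix n show "(\<lambda>z. \<Sum>i<n. f i z) holomorphic_on S"
    by (intro holomorphic_intros f)
next
  fix x assume "x \<in> S"
  then obtain d M where "d > 0" and *: "cball x d \<subseteq> S" "summable M" "\<And>n z. z \<in> cball x d \<Longrightarrow> norm (f n z) \<le> M n"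
    using dom by metis
  have "uniform_limit (cball x d) (\<lambda>n z. \<Sum>i<n. f i z) (\<lambda>z. \<Sum>i. f i z) sequentially"
    by (rule Weierstrass_m_test) (use * in auto)
  then show "\<exists>d>0. cball x d \<subseteq> S \<and> uniform_limit (cball x d) (\<lambda>n z. \<Sum>i<n. f i z) (\<lambda>z. \<Sum>i. f i z) sequentially"
    using \<open>d > 0\<close> * by blast
qed

lemma norm_pochhammer_le: "norm (pochhammer (w :: complex) k) \<le> (norm w + real k) ^ k"
proof -
  have "norm (pochhammer w k) = (\<Prod>i<k. norm (w + of_nat i))"
    by (simp add: pochhammer_prod prod_norm atLeast0LessThan)
  also have "\<dots> \<le> (\<Prod>i<k. norm w + real k)"
    by (intro prod_mono) (auto intro!: norm_triangle_le)
  finally show ?thesis by simp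
qed

lemma norm_pochhammer_le':
  assumes "k \<le> R" "R > 0"
  shows "norm (pochhammer (w :: complex) k) \<le> (norm w + real R) ^ R"
proof -
  have "norm (pochhammer w k) \<le> (norm w + real k) ^ k" by (rule norm_pochhammer_le)
  also have "\<dots> \<le> (norm w + real R) ^ k"
    using assms by (intro power_mono) auto
  also have "\<dots> \<le> (norm w + real R) ^ R"
    using assms by (intro power_increasing) (auto intro: add_increasing)
  finally show ?thesis .
qed

lemma norm_of_real_powr: "x \<ge> 0 \<Longrightarrow> norm (complex_of_real x powr z) = x powr Re z"
  by (simp add: norm_powr_real_powr)

text \<open>Slot 0 holds an antiderivative of \<open>x powr (- w)\<close> and slot
  \<open>Suc k\<close> its \<open>k\<close>-th derivative, the layout that \<open>em_prim\<close>
  expects.\<close>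

definition powF :: "complex \<Rightarrow> nat \<Rightarrow> complex \<Rightarrow> complex" where
  "powF w i x = (case i of 0 \<Rightarrow> x powr (1 - w) / (1 - w)
     | Suc k \<Rightarrow> (-1) ^ k * pochhammer w k * x powr (- w - of_nat k))"

lemma powF_0: "powF w 0 x = x powr (1 - w) / (1 - w)"
  and powF_Suc: "powF w (Suc k) x = (-1) ^ k * pochhammer w k * x powr (- w - of_nat k)"
  and powF_1: "powF w 1 x = x powr (- w)"
  by (simp_all add: powF_def)

lemma has_field_derivative_powF:
  assumes "Re x > 0" "w \<noteq> 1"
  shows "(powF w i has_field_derivative powF w (Suc i) x) (at x)"
proof -
  have x: "x \<notin> \<real>\<^sub>\<le>\<^sub>0" using assms by (auto simp: complex_nonpos_Reals_iff)
  show ?thesis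
  proof (cases i)
    case 0
    have "((\<lambda>x. x powr (1 - w) / (1 - w)) has_field_derivative x powr (- w)) (at x)"
      using x assms by (auto intro!: derivative_eq_intros)
    moreover have "powF w 0 = (\<lambda>x. x powr (1 - w) / (1 - w))" by (simp add: fun_eq_iff powF_0)
    ultimately show ?thesis by (simp add: 0 powF_Suc)
  next
    case (Suc k)
    have "((\<lambda>x. (-1) ^ k * pochhammer w k * x powr (- w - of_nat k)) has_field_derivative
        (-1) ^ k * pochhammer w k * ((- w - of_nat k) * x powr (- w - of_nat k - 1))) (at x)"
      using x by (intro DERIV_cmult has_field_derivative_powr)
    also have "(-1) ^ k * pochhammer w k * ((- w - of_nat k) * x powr (- w - of_nat k - 1)) = powF w (Suc i) x"
      by (simp add: Suc powF_Suc pochhammer_Suc algebra_simps)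
    finally show ?thesis unfolding Suc powF_Suc[abs_def, symmetric] by (simp add: powF_Suc[abs_def])
  qed
qed

lemma norm_powF_Suc:
  "x \<ge> 0 \<Longrightarrow> norm (powF w (Suc k) (of_real x)) = norm (pochhammer w k) * x powr (- Re w - k)"
  by (simp add: powF_Suc norm_mult norm_power norm_of_real_powr)

definition zerr :: "nat \<Rightarrow> complex \<Rightarrow> nat \<Rightarrow> complex" where
  "zerr R w j = of_nat j powr (- w) - (em_prim R (powF w) (of_nat j) - em_prim R (powF w) (of_nat j - 1))"

text \<open>The step runs over \<open>[j - 1, j]\<close>, so \<open>j = 1\<close> is excluded: it
  would reach the singularity at 0. The \<open>R\<close>-th derivative is largest at the left end
  because its exponent is non-positive.\<close>

lemma norm_zerr_le:
  assumes "R > 0" "w \<noteq> 1" "Re w + real R \<ge> 0" "j \<ge> 2"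
  shows "norm (zerr R w j) \<le> em_const R * (norm w + real R) ^ R * (real j - 1) powr (- Re w - R)"
proof -
  have "norm (powF w 1 (of_real (real j)) - (em_prim R (powF w) (of_real (real j)) - em_prim R (powF w) (of_real (real j) - 1)))
     \<le> em_const R * ((norm w + real R) ^ R * (real j - 1) powr (- Re w - R))"
  proof (rule em_step_real[OF assms(1)])
    fix x i assume "real j - 1 \<le> x"
    then show "(powF w i has_field_derivative powF w (Suc i) (of_real x)) (at (of_real x))"
      using assms by (intro has_field_derivative_powF) auto
  next
    fix x assume x: "real j - 1 \<le> x"
    then have "norm (powF w (Suc R) (of_real x)) = norm (pochhammer w R) * x powr (- Re w - R)"
      using assms by (subst norm_powF_Suc) auto
    also have "\<dots> \<le> (norm w + real R) ^ R * (real j - 1) powr (- Re w - R)"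
      using assms x by (intro mult_mono norm_pochhammer_le powr_mono2') auto
    finally show "norm (powF w (Suc R) (of_real x)) \<le> (norm w + real R) ^ R * (real j - 1) powr (- Re w - R)" .
  qed
  then show ?thesis by (simp add: zerr_def powF_1 powF_def mult.assoc)
qed

lemma norm_zerr_le':
  assumes "R > 0" "w \<noteq> 1" "Re w + real R \<ge> 2"
  shows "norm (zerr R w (n + 2)) \<le> em_const R * (norm w + real R) ^ R * (1 / real (Suc n) ^ 2)"
proof -
  have "norm (zerr R w (n + 2)) \<le> em_const R * (norm w + real R) ^ R * (real (n + 2) - 1) powr (- Re w - R)"
    using assms by (intro norm_zerr_le) auto
  also have "\<dots> \<le> em_const R * (norm w + real R) ^ R * (real (Suc n) powr (-2))"
    using assms em_const_ge[of R] by (intro mult_left_mono) (auto intro!: powr_mono)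
  also have "real (Suc n) powr (-2) = 1 / real (Suc n) ^ 2"
    by (simp add: powr_minus powr_numeral divide_inverse)
  finally show ?thesis .
qed

definition inverse_squares_sum :: real where "inverse_squares_sum = (\<Sum>n. 1 / real (Suc n) ^ 2)"

lemma summable_inverse_squares_sum: "summable (\<lambda>n. 1 / real (Suc n) ^ 2)"
  using inverse_power_summable[of 2, where 'a = real] summable_Suc_iff[of "\<lambda>n. 1 / real n ^ 2"]
  by (simp add: divide_inverse)

lemma summable_zerr:
  assumes "R > 0" "w \<noteq> 1" "Re w + real R \<ge> 2"
  shows "summable (\<lambda>n. zerr R w (n + 2))"
  by (rule summable_comparison_test'[where N = 0, OF summable_mult[OF summable_inverse_squares_sum]])
     (rule norm_zerr_le'[OF assms])

text \<open>The truncation order \<open>R\<close> only limits the half-plane of convergence: \<open>zlim R w\<close> is the value of the zeta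
  function for every \<open>R\<close> with \<open>Re w + R \<ge> 2\<close>.\<close>

definition zlim :: "nat \<Rightarrow> complex \<Rightarrow> complex" where
  "zlim R w = 1 - em_prim R (powF w) 1 + (\<Sum>n. zerr R w (n + 2))"

lemma sum_powr_eq_zerr:
  "(\<Sum>j=1..Suc N. of_nat j powr (- w)) - em_prim R (powF w) (of_nat (Suc N))
     = 1 - em_prim R (powF w) 1 + (\<Sum>n<N. zerr R w (n + 2))"
proof (induction N)
  case (Suc N)
  have z: "zerr R w (N + 2) = of_nat (N + 2) powr (- w) - (em_prim R (powF w) (of_nat (N + 2)) - em_prim R (powF w) (of_nat (Suc N)))"
    by (simp add: zerr_def algebra_simps)
  have "(\<Sum>j=1..Suc (Suc N). of_nat j powr (- w)) - em_prim R (powF w) (of_nat (Suc (Suc N)))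
     = ((\<Sum>j=1..Suc N. of_nat j powr (- w)) - em_prim R (powF w) (of_nat (Suc N))) + zerr R w (N + 2)"
    unfolding z by simp
  then show ?case unfolding Suc.IH by simp
qed simp

lemma zlim_tendsto:
  assumes "R > 0" "w \<noteq> 1" "Re w + real R \<ge> 2"
  shows "(\<lambda>N. (\<Sum>j=1..Suc N. of_nat j powr (- w)) - em_prim R (powF w) (of_nat (Suc N))) \<longlonglongrightarrow> zlim R w"
  unfolding sum_powr_eq_zerr zlim_def
  by (intro tendsto_intros summable_LIMSEQ summable_zerr assms)

lemma tendsto_powr_neg_complex:
  assumes "Re w < 0"
  shows "(\<lambda>N. of_nat (Suc N) powr w) \<longlonglongrightarrow> (0 :: complex)"
proof (rule Lim_null_comparison)
  show "\<forall>\<^sub>F N in sequentially. norm (of_nat (Suc N) powr w) \<le> real (Suc N) powr Re w"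
    using norm_of_real_powr[of "real (Suc _)" w] by (intro always_eventually allI) simp
  show "(\<lambda>N. real (Suc N) powr Re w) \<longlonglongrightarrow> 0"
    by (rule LIMSEQ_Suc[OF tendsto_neg_powr[OF assms filterlim_real_sequentially]])
qed

text \<open>The additional term of \<open>em_prim\<close> is a multiple of
  \<open>of_nat (Suc N) powr (- w - of_nat R)\<close>, whose exponent has real part at most -2, so
  it disappears in the limit.\<close>

lemma zlim_Suc:
  assumes "R > 0" "w \<noteq> 1" "Re w + real R \<ge> 2"
  shows "zlim (Suc R) w = zlim R w"
proof -
  have "(\<lambda>N. ((\<Sum>j=1..Suc N. of_nat j powr (- w)) - em_prim R (powF w) (of_nat (Suc N)))
      - em_coeff R * ((-1) ^ R * pochhammer w R * of_nat (Suc N) powr (- w - of_nat R)))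
      \<longlonglongrightarrow> zlim R w - em_coeff R * ((-1) ^ R * pochhammer w R * 0)"
    using assms by (intro tendsto_intros zlim_tendsto tendsto_powr_neg_complex) auto
  moreover have "(\<lambda>N. (\<Sum>j=1..Suc N. of_nat j powr (- w)) - em_prim (Suc R) (powF w) (of_nat (Suc N))) \<longlonglongrightarrow> zlim (Suc R) w"
    using assms by (intro zlim_tendsto) auto
  ultimately show ?thesis
    using LIMSEQ_unique by (force simp: em_prim_def powF_Suc algebra_simps)
qed

lemma zlim_le:
  assumes "R > 0" "w \<noteq> 1" "Re w + real R \<ge> 2" "R \<le> R'"
  shows "zlim R' w = zlim R w"
  using assms(4) by (induction rule: dec_induct) (use assms zlim_Suc in \<open>auto simp del: of_nat_Suc\<close>)

text \<open>The order is chosen pointwise, large enough that \<open>Re w + R \<ge> 2\<close>. The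
  value at 1 copies the convention of \<open>riemann_zeta\<close>.\<close>

definition zeta0 :: "complex \<Rightarrow> complex" where
  "zeta0 w = (if w = 1 then 0 else zlim (Suc (nat \<lceil>2 - Re w\<rceil>)) w)"

lemma zeta0_eq_zlim:
  assumes "R > 0" "w \<noteq> 1" "Re w + real R \<ge> 2"
  shows "zeta0 w = zlim R w"
proof -
  let ?R = "Suc (nat \<lceil>2 - Re w\<rceil>)"
  have *: "Re w + real ?R \<ge> 2" by linarith
  show ?thesis
  proof (cases "?R \<le> R")
    case True
    then show ?thesis using zlim_le[of ?R w R] * assms by (simp add: zeta0_def)
  next
    case False
    then show ?thesis using zlim_le[of R w ?R] * assms by (simp add: zeta0_def)
  qed
qed

lemma holomorphic_em_prim_powF:
  assumes "1 \<notin> S" "x \<noteq> 0"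
  shows "(\<lambda>w. em_prim R (powF w) x) holomorphic_on S"
  unfolding em_prim_def powF_Suc powF_0 pochhammer_prod
  by (intro holomorphic_intros) (use assms in auto)

lemma holomorphic_zerr:
  assumes "1 \<notin> S" "j \<ge> 2"
  shows "(\<lambda>w. zerr R w j) holomorphic_on S"
proof -
  have [simp]: "of_nat j - 1 \<noteq> (0 :: complex)" "of_nat j \<noteq> (0 :: complex)" using assms by (auto simp: of_nat_eq_1_iff)
  show ?thesis unfolding zerr_def
    by (intro holomorphic_intros holomorphic_em_prim_powF) (use assms in auto)
qed

lemma holomorphic_zlim: 
  assumes "R > 0"
  shows "zlim R holomorphic_on {w. Re w > 2 - real R} - {1}"
proof -
  let ?S = "{w. Re w > 2 - real R} - {1 :: complex}"
  have S: "open ?S" by (intro open_Diff open_halfspace_Re_gt) auto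
  have "(\<lambda>w. \<Sum>n. zerr R w (n + 2)) holomorphic_on ?S"
  proof (rule holomorphic_series[OF S])
    fix n show "(\<lambda>w. zerr R w (n + 2)) holomorphic_on ?S"
      by (intro holomorphic_zerr) auto
  next
    fix x assume "x \<in> ?S"
    then obtain d where d: "d > 0" "cball x d \<subseteq> ?S" using open_contains_cball S by blast
    have "norm (zerr R z (n + 2)) \<le> em_const R * (norm x + d + real R) ^ R * (1 / real (Suc n) ^ 2)"
      if "z \<in> cball x d" for z n
    proof -
      have z: "norm z \<le> norm x + d" using that norm_triangle_ineq2[of z x] by (simp add: dist_norm norm_minus_commute)
      have "z \<in> ?S" using d that by auto
      then have "norm (zerr R z (n + 2)) \<le> em_const R * (norm z + real R) ^ R * (1 / real (Suc n) ^ 2)"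
        using assms by (intro norm_zerr_le') auto
      also have "\<dots> \<le> em_const R * (norm x + d + real R) ^ R * (1 / real (Suc n) ^ 2)"
        using z em_const_ge[of R] by (intro mult_right_mono mult_left_mono power_mono) auto
      finally show ?thesis .
    qed
    then show "\<exists>d>0. \<exists>M. cball x d \<subseteq> ?S \<and> summable M \<and> (\<forall>n. \<forall>z\<in>cball x d. norm (zerr R z (n + 2)) \<le> M n)"
      using d summable_mult[OF summable_inverse_squares_sum] by blast
  qed
  then show ?thesis unfolding zlim_def
    by (intro holomorphic_intros holomorphic_em_prim_powF) auto
qed

lemma holomorphic_zeta0: "zeta0 holomorphic_on - {1}"
proof -
  have "zeta0 field_differentiable at w" if "w \<noteq> 1" for w
  proof -
    define R where "R = Suc (nat \<lceil>3 - Re w\<rceil>)"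
    have R: "Re w > 2 - real R" "R > 0" unfolding R_def by linarith+
    let ?S = "{w. Re w > 2 - real R} - {1 :: complex}"
    have S: "open ?S" by (intro open_Diff open_halfspace_Re_gt) auto
    have "zeta0 holomorphic_on ?S"
      using holomorphic_zlim[OF R(2)] by (rule holomorphic_transform) (use R in \<open>auto intro!: zeta0_eq_zlim[symmetric]\<close>)
    then show ?thesis using S R that
      by (auto intro: holomorphic_on_imp_differentiable_at)
  qed
  then show ?thesis by (auto simp: holomorphic_on_def intro: field_differentiable_at_within)
qed

lemma em_prim_powF_tendsto_0:
  assumes "Re w > 1"
  shows "(\<lambda>N. em_prim R (powF w) (of_nat (Suc N))) \<longlonglongrightarrow> 0"
proof -
  have "(\<lambda>N. em_prim R (powF w) (of_nat (Suc N))) \<longlonglongrightarrow> 0 / (1 - w) + (\<Sum>r<R. em_coeff r * ((-1) ^ r * pochhammer w r * 0))"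
    unfolding em_prim_def powF_Suc powF_0
    by (intro tendsto_intros tendsto_powr_neg_complex) (use assms in auto)
  then show ?thesis by simp
qed

lemma zeta0_sums:
  assumes "Re w > 1"
  shows "(\<lambda>n. of_nat (Suc n) powr (- w)) sums zeta0 w"
proof -
  have w: "w \<noteq> 1" using assms by auto
  have "(\<lambda>N. (\<Sum>j=1..Suc N. of_nat j powr (- w)) - em_prim 1 (powF w) (of_nat (Suc N)) + em_prim 1 (powF w) (of_nat (Suc N)))
     \<longlonglongrightarrow> zlim 1 w + 0"
    using assms w by (intro tendsto_add zlim_tendsto em_prim_powF_tendsto_0) auto
  then have "(\<lambda>N. \<Sum>j=1..Suc N. of_nat j powr (- w)) \<longlonglongrightarrow> zeta0 w"
    using assms w by (simp add: zeta0_eq_zlim[of 1])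
  moreover have "(\<Sum>j=1..Suc N. of_nat j powr (- w)) = (\<Sum>n<Suc N. of_nat (Suc n) powr (- w))" for N
    by (rule sum.reindex_bij_witness[of _ Suc "\<lambda>j. j - 1"]) auto
  ultimately have "(\<lambda>N. \<Sum>n<Suc N. of_nat (Suc n) powr (- w)) \<longlonglongrightarrow> zeta0 w" by simp
  then show ?thesis unfolding sums_def by (rule LIMSEQ_imp_Suc)
qed

text \<open>The definite description denotes because the punctured plane is connected: two
  candidates agree where the Dirichlet series converges, hence off 1 by the identity theorem, and at
  1 by prescription.\<close>

lemma riemann_zeta_eq: "riemann_zeta = zeta0"
  unfolding riemann_zeta_def
proof (rule the_equality)
  show "zeta0 holomorphic_on - {1} \<and> zeta0 1 = 0 \<and> (\<forall>s. 1 < Re s \<longrightarrow> (\<lambda>n. of_nat (Suc n) powr - s) sums zeta0 s)"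
    using holomorphic_zeta0 zeta0_sums by (auto simp: zeta0_def)
next
  fix f assume f: "f holomorphic_on - {1} \<and> f 1 = 0 \<and> (\<forall>s. 1 < Re s \<longrightarrow> (\<lambda>n. of_nat (Suc n) powr - s) sums f s)"
  have "f s = zeta0 s" if "s \<noteq> 1" for s
  proof (rule analytic_continuation_open[of "{s. Re s > 1}" "- {1}" f zeta0])
    show "open {s. Re s > 1}" by (rule open_halfspace_Re_gt)
    show "{s. Re s > 1} \<noteq> {}" by (auto intro!: exI[of _ 2])
    show "connected (- {1 :: complex})" by (rule connected_punctured_universe) auto
    show "f z = zeta0 z" if "z \<in> {s. Re s > 1}" for z
      using f zeta0_sums[of z] that sums_unique2 by auto
  qed (use f holomorphic_zeta0 that in auto)
  then show "f = zeta0" using f by (auto simp: fun_eq_iff zeta0_def)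
qed

lemma holomorphic_riemann_zeta: "riemann_zeta holomorphic_on - {1}"
  by (simp add: riemann_zeta_eq holomorphic_zeta0)

lemma holomorphic_on_riemann_zeta [holomorphic_intros]:
  assumes "f holomorphic_on S" "\<And>z. z \<in> S \<Longrightarrow> f z \<noteq> 1"
  shows "(\<lambda>z. riemann_zeta (f z)) holomorphic_on S"
  using holomorphic_on_compose_gen[OF assms(1) holomorphic_riemann_zeta] assms(2) by (force simp: o_def)

lemma riemann_zeta_sums: "Re w > 1 \<Longrightarrow> (\<lambda>n. of_nat (Suc n) powr (- w)) sums riemann_zeta w"
  unfolding riemann_zeta_eq by (rule zeta0_sums)

lemma riemann_zeta_em_tendsto:
  assumes "R > 0" "w \<noteq> 1" "Re w + real R \<ge> 2"
  shows "(\<lambda>N. (\<Sum>j=1..Suc N. of_nat j powr (- w)) - em_prim R (powF w) (of_nat (Suc N))) \<longlonglongrightarrow> riemann_zeta w"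
  using zlim_tendsto[OF assms] zeta0_eq_zlim[OF assms] by (simp add: riemann_zeta_eq)

text \<open>In the tail the exponent \<open>- Re w - R\<close> is split as
  \<open>(2 - Re w - R) + (- 2)\<close>: the first part is non-positive and yields the power of
  \<open>Suc N\<close>, the second makes the series converge.\<close>

lemma riemann_zeta_em_bound:
  assumes "R > 0" "w \<noteq> 1" "Re w + real R \<ge> 2"
  shows "norm ((\<Sum>j=1..Suc N. of_nat j powr (- w)) - em_prim R (powF w) (of_nat (Suc N)) - riemann_zeta w)
     \<le> em_const R * (norm w + real R) ^ R * real (Suc N) powr (2 - Re w - R) * inverse_squares_sum"
proof -
  define C where "C = em_const R * (norm w + real R) ^ R * real (Suc N) powr (2 - Re w - R)"
  have C: "C \<ge> 0" using em_const_ge[of R] by (simp add: C_def)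
  have "norm (zerr R w (n + N + 2)) \<le> C * (1 / real (Suc n) ^ 2)" for n
  proof -
    have "norm (zerr R w (n + N + 2)) \<le> em_const R * (norm w + real R) ^ R * (real (n + N + 2) - 1) powr (- Re w - R)"
      using assms by (intro norm_zerr_le) auto
    also have "real (n + N + 2) - 1 = real (Suc (n + N))" by simp
    also have "real (Suc (n + N)) powr (- Re w - R) = real (Suc (n + N)) powr (2 - Re w - R) * real (Suc (n + N)) powr (-2)"
      by (simp flip: powr_add)
    also have "\<dots> \<le> real (Suc N) powr (2 - Re w - R) * real (Suc n) powr (-2)"
      using assms by (intro mult_mono powr_mono2') auto
    also have "real (Suc n) powr (-2) = 1 / real (Suc n) ^ 2"
      by (simp add: powr_minus powr_numeral divide_inverse)
    finally show ?thesis using em_const_ge[of R] by (simp add: C_def mult.assoc mult_left_mono)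
  qed
  then have *: "norm (\<Sum>n. zerr R w (n + N + 2)) \<le> (\<Sum>n. C * (1 / real (Suc n) ^ 2))"
    by (intro norm_suminf_le summable_mult summable_inverse_squares_sum)
  have "(\<Sum>n. zerr R w (n + 2)) = (\<Sum>n. zerr R w (n + N + 2)) + (\<Sum>n<N. zerr R w (n + 2))"
    by (rule suminf_split_initial_segment) (rule summable_zerr[OF assms])
  then have "(\<Sum>j=1..Suc N. of_nat j powr (- w)) - em_prim R (powF w) (of_nat (Suc N)) - riemann_zeta w
      = - (\<Sum>n. zerr R w (n + N + 2))"
    unfolding sum_powr_eq_zerr riemann_zeta_eq zeta0_eq_zlim[OF assms] zlim_def by simp
  moreover have "(\<Sum>n. C * (1 / real (Suc n) ^ 2)) = C * inverse_squares_sum"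
    unfolding inverse_squares_sum_def by (rule suminf_mult[OF summable_inverse_squares_sum])
  ultimately show ?thesis using * by (simp add: C_def)
qed

lemma norm_em_prim_powF_1_le:
  assumes "R > 0"
  shows "norm (em_prim R (powF w) 1) \<le> 1 / norm (1 - w) + em_const R * (norm w + real R) ^ R"
proof -
  have "norm (\<Sum>r<R. em_coeff r * powF w (Suc r) 1) \<le> (\<Sum>r<R. norm (em_coeff r) * (norm w + real R) ^ R)"
    by (intro sum_norm_le) (use assms in \<open>auto simp: norm_mult powF_Suc norm_power intro!: mult_left_mono norm_pochhammer_le'\<close>)
  also have "\<dots> \<le> em_const R * (norm w + real R) ^ R"
    by (simp add: em_const_def ring_distribs flip: sum_distrib_right)
  finally show ?thesis
    unfolding em_prim_def powF_0
    by (intro order_trans[OF norm_triangle_ineq] add_mono) (auto simp: norm_divide)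
qed

lemma inverse_squares_sum_ge: "inverse_squares_sum \<ge> 0"
  unfolding inverse_squares_sum_def by (intro suminf_nonneg summable_inverse_squares_sum) auto

text \<open>This is \<open>riemann_zeta_em_bound\<close> at \<open>N = 0\<close>, where the partial
  sum is 1. For fixed \<open>R\<close> it gives polynomial growth away from the pole, on a
  half-plane that widens with \<open>R\<close>.\<close>

lemma norm_riemann_zeta_le:
  assumes "R > 0" "w \<noteq> 1" "Re w + real R \<ge> 2"
  shows "norm (riemann_zeta w) \<le> 1 + 1 / norm (1 - w) + em_const R * (1 + inverse_squares_sum) * (norm w + real R) ^ R"
proof -
  have "norm (riemann_zeta w) = norm (1 - em_prim R (powF w) 1 - (1 - em_prim R (powF w) 1 - riemann_zeta w))"
    by simp
  also have "\<dots> \<le> norm (1 :: complex) + norm (em_prim R (powF w) 1) + norm (1 - em_prim R (powF w) 1 - riemann_zeta w)"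
    by (intro order_trans[OF norm_triangle_ineq4] add_mono order_refl)
  also have "norm (1 - em_prim R (powF w) 1 - riemann_zeta w) \<le> em_const R * (norm w + real R) ^ R * inverse_squares_sum"
    using riemann_zeta_em_bound[OF assms, of 0] by simp
  also note norm_em_prim_powF_1_le[OF assms(1), of w]
  finally show ?thesis by (simp add: algebra_simps)
qed

text \<open>Clearing the pole of zeta makes the function entire, with its residue 1 as the value at
  1. It allows the principal parts of the continuation to be written explicitly.\<close>

definition zeta_ent :: "complex \<Rightarrow> complex" where
  "zeta_ent w = (if w = 1 then 1 else (w - 1) * riemann_zeta w)"

lemma zeta_ent_1 [simp]: "zeta_ent 1 = 1"
  by (simp add: zeta_ent_def)

lemma riemann_zeta_conv_zeta_ent: "w \<noteq> 1 \<Longrightarrow> riemann_zeta w = zeta_ent w / (w - 1)"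
  by (simp add: zeta_ent_def)

lemma holomorphic_zeta_ent: "zeta_ent holomorphic_on UNIV"
proof -
  have hol: "zeta_ent holomorphic_on - {1}"
  proof (rule holomorphic_transform)
    show "(\<lambda>w. (w - 1) * riemann_zeta w) holomorphic_on - {1}" by (intro holomorphic_intros) auto
  qed (auto simp: zeta_ent_def)
  have lim: "(zeta_ent \<longlongrightarrow> 1) (at 1)"
  proof -
    \<comment> \<open>Order 1 isolates the polar term \<open>1 / (1 - w)\<close> and a constant. The
      error bound needs order 2, since order 1 is available only for \<open>Re w \<ge> 1\<close> and
      not on a neighbourhood of 1; the term \<open>em_coeff 1 * powF w 2 1\<close> by which the
      orders differ is bounded separately.\<close>
    define g where "g w = riemann_zeta w - (1 - em_prim 1 (powF w) 1)" for w
    have ev: "\<forall>\<^sub>F w in at 1. w \<in> ball 1 (1/2 :: real) - {1 :: complex}"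
      by (rule eventually_at_in_open) auto
    have bd: "\<forall>\<^sub>F w in at 1. norm ((w - 1) * g w) \<le> norm (w - 1) * (em_const 2 * 4 ^ 2 * inverse_squares_sum + norm (em_coeff 1) * 2)"
      using ev
    proof eventually_elim
      case (elim w)
      have w: "w \<noteq> 1" "norm (w - 1) < 1/2" using elim by (auto simp: dist_norm norm_minus_commute)
      have "\<bar>Re (w - 1)\<bar> < 1/2" using w(2) abs_Re_le_cmod[of "w - 1"] by linarith
      then have re: "Re w \<ge> 1/2" by (auto simp: abs_if split: if_splits)
      have nw: "norm w \<le> 2" using w(2) norm_triangle_ineq2[of w 1] by simp
      have "norm (1 - em_prim 2 (powF w) 1 - riemann_zeta w) \<le> em_const 2 * (norm w + real 2) ^ 2 * inverse_squares_sum"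
        using riemann_zeta_em_bound[of 2 w 0] w re by simp
      also have "\<dots> \<le> em_const 2 * 4 ^ 2 * inverse_squares_sum"
        using nw inverse_squares_sum_ge em_const_ge[of 2] by (intro mult_right_mono mult_left_mono power_mono) auto
      finally have "norm (1 - em_prim 2 (powF w) 1 - riemann_zeta w) \<le> em_const 2 * 4 ^ 2 * inverse_squares_sum" .
      moreover have "g w = - (1 - em_prim 2 (powF w) 1 - riemann_zeta w) - em_coeff 1 * powF w 2 1"
        by (simp add: g_def em_prim_def numeral_2_eq_2)
      moreover have "norm (em_coeff 1 * powF w 2 1) \<le> norm (em_coeff 1) * 2"
        using nw by (simp add: norm_mult numeral_2_eq_2 powF_Suc mult_left_mono)
      moreover have "norm (- X - Y) \<le> norm X + norm Y" for X Y :: complex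
        using norm_triangle_ineq4[of "- X" Y] by simp
      ultimately have "norm (g w) \<le> em_const 2 * 4 ^ 2 * inverse_squares_sum + norm (em_coeff 1) * 2"
        by (smt (verit))
      then show ?case by (simp add: norm_mult mult_left_mono)
    qed
    have "((\<lambda>w. (w - 1) * g w) \<longlongrightarrow> 0) (at 1)"
    proof (rule Lim_null_comparison[OF bd])
      have "((\<lambda>w::complex. norm (w - 1) * (em_const 2 * 4 ^ 2 * inverse_squares_sum + norm (em_coeff 1) * 2)) \<longlongrightarrow>
          norm (1 - 1 :: complex) * (em_const 2 * 4 ^ 2 * inverse_squares_sum + norm (em_coeff 1) * 2)) (at 1)"
        by (intro tendsto_intros)
      then show "((\<lambda>w::complex. norm (w - 1) * (em_const 2 * 4 ^ 2 * inverse_squares_sum + norm (em_coeff 1) * 2)) \<longlongrightarrow> 0) (at 1)"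
        by simp
    qed
    moreover have "((\<lambda>w. (w - 1) * (1 - em_coeff 0) + 1) \<longlongrightarrow> (1 - 1) * (1 - em_coeff 0) + 1) (at 1)"
      by (intro tendsto_intros)
    ultimately have "((\<lambda>w. (w - 1) * g w + ((w - 1) * (1 - em_coeff 0) + 1)) \<longlongrightarrow> 0 + ((1 - 1) * (1 - em_coeff 0) + 1)) (at 1)"
      by (rule tendsto_add)
    moreover have "\<forall>\<^sub>F w in at 1. (w - 1) * g w + ((w - 1) * (1 - em_coeff 0) + 1) = zeta_ent w"
      using ev
    proof eventually_elim
      case (elim w)
      then have "w - 1 \<noteq> 0" "1 - w \<noteq> 0" by auto
      then have "(w - 1) * (1 / (1 - w)) = -1" by (simp add: field_simps)
      then show ?case using elim
        by (simp add: zeta_ent_def g_def em_prim_def powF_0 powF_Suc algebra_simps)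
    qed
    ultimately show ?thesis by (simp add: tendsto_cong)
  qed
  have "continuous_on UNIV zeta_ent"
    unfolding continuous_on_eq_continuous_at[OF open_UNIV]
  proof
    fix w :: complex
    show "isCont zeta_ent w"
    proof (cases "w = 1")
      case True then show ?thesis using lim by (simp add: isCont_def)
    next
      case False
      then have "zeta_ent field_differentiable at w"
        by (intro holomorphic_on_imp_differentiable_at[OF hol]) auto
      then show ?thesis by (rule field_differentiable_imp_continuous_at)
    qed
  qed
  then show ?thesis
    using no_isolated_singularity[of UNIV zeta_ent "{1}"] hol by (auto simp: Compl_eq_Diff_UNIV)
qed

lemma holomorphic_on_zeta_ent [holomorphic_intros]:
  assumes "f holomorphic_on S"
  shows "(\<lambda>z. zeta_ent (f z)) holomorphic_on S"
  using holomorphic_on_compose_gen[OF assms holomorphic_zeta_ent] by (auto simp: o_def)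

subsection \<open>Partial fractions\<close>

text \<open>Differentiating the reflection formula of Gamma gives
  \<open>Digamma z - Digamma (1 - z)\<close> as a cotangent. In the Digamma series at
  \<open>1 - z\<close> and \<open>z + 1\<close> the denominators pair up to
  \<open>of_nat (Suc k) ^ 2 - z ^ 2\<close>; passing from \<open>z\<close> to \<open>z + 1\<close>
  produces \<open>1 / z\<close>.\<close>

lemma cot_partial_fractions:
  fixes z :: complex
  assumes z: "z \<notin> \<int>"
  shows "(\<lambda>k. 2 * z / (of_nat (Suc k) ^ 2 - z ^ 2)) sums (1 / z - of_real pi * cot (of_real pi * z))"
proof -
  have int: "z + of_int n \<noteq> 0" "of_int n - z \<noteq> 0" for n
    using z by (metis Ints_of_int Ints_minus add_eq_0_iff2 minus_minus) (use z in auto)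
  have nz: "z \<notin> \<int>\<^sub>\<le>\<^sub>0" "1 - z \<notin> \<int>\<^sub>\<le>\<^sub>0" "z \<noteq> 0"
  proof -
    show "z \<notin> \<int>\<^sub>\<le>\<^sub>0" using z nonpos_Ints_subset_Ints by blast
    have "z = 1 - (1 - z)" by simp
    then show "1 - z \<notin> \<int>\<^sub>\<le>\<^sub>0" using z nonpos_Ints_subset_Ints by (metis Ints_1 Ints_diff subsetD)
    show "z \<noteq> 0" using z by auto
  qed
  have sin: "sin (of_real pi * z) \<noteq> 0"
    using z by (auto simp: sin_eq_0 mult.commute)
  have psi: "Digamma z - Digamma (1 - z) = - of_real pi * cot (of_real pi * z)"
  proof -
    have 1: "((\<lambda>z. Gamma z * Gamma (1 - z)) has_field_derivative
       Gamma z * Digamma z * Gamma (1 - z) + (- 1) * (Gamma (1 - z) * Digamma (1 - z)) * Gamma z) (at z)"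
      using nz by (auto intro!: derivative_eq_intros)
    have 2: "((\<lambda>z. of_real pi / sin (of_real pi * z)) has_field_derivative
       - (of_real pi * (cos (of_real pi * z) * of_real pi)) / (sin (of_real pi * z)) ^ 2) (at z)"
      using sin by (auto intro!: derivative_eq_intros simp: power2_eq_square)
    then have "((\<lambda>z. Gamma z * Gamma (1 - z)) has_field_derivative
       - (of_real pi * (cos (of_real pi * z) * of_real pi)) / (sin (of_real pi * z)) ^ 2) (at z)"
      by (simp only: Gamma_reflection_complex)
    from DERIV_unique[OF 1 this]
    have "Gamma z * Digamma z * Gamma (1 - z) + (- 1) * (Gamma (1 - z) * Digamma (1 - z)) * Gamma z
        = - (of_real pi * (cos (of_real pi * z) * of_real pi)) / (sin (of_real pi * z)) ^ 2" .
    then have "(Gamma z * Gamma (1 - z)) * (Digamma z - Digamma (1 - z)) = (of_real pi / sin (of_real pi * z)) * (- of_real pi * cot (of_real pi * z))"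
      using sin by (simp add: algebra_simps cot_def power2_eq_square)
    moreover have "complex_of_real pi / sin (of_real pi * z) \<noteq> 0" using sin by simp
    ultimately show ?thesis unfolding Gamma_reflection_complex by (rule mult_left_cancel[THEN iffD1, rotated])
  qed
  have D: "(\<lambda>k. inverse (of_nat (Suc k)) - inverse (w + of_nat k)) sums (Digamma w + euler_mascheroni)"
    if "w \<noteq> 0" for w :: complex
    unfolding Digamma_def using summable_sums[OF summable_Digamma[OF that]] by simp
  have "z + 1 \<noteq> 0" "1 - z \<noteq> 0" using int(1)[of 1] int(2)[of 1] by auto
  then have "(\<lambda>k. (inverse (of_nat (Suc k)) - inverse (1 - z + of_nat k)) - (inverse (of_nat (Suc k)) - inverse (z + 1 + of_nat k)))
      sums ((Digamma (1 - z) + euler_mascheroni) - (Digamma (z + 1) + euler_mascheroni))"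
    by (intro sums_diff D)
  also have "(\<lambda>k. (inverse (of_nat (Suc k)) - inverse (1 - z + of_nat k)) - (inverse (of_nat (Suc k)) - inverse (z + 1 + of_nat k)))
     = (\<lambda>k. - (2 * z / (of_nat (Suc k) ^ 2 - z ^ 2)))"
  proof
    fix k
    have a: "1 - z + of_nat k \<noteq> 0" "z + 1 + of_nat k \<noteq> 0"
      using int(2)[of "int (Suc k)"] int(1)[of "int (Suc k)"] by (simp_all add: algebra_simps)
    have "of_nat (Suc k) ^ 2 - z ^ 2 = (1 - z + of_nat k) * (z + 1 + of_nat k)"
      by (simp add: algebra_simps power2_eq_square)
    moreover have "(c - inverse X) - (c - inverse Y) = (X - Y) / (X * Y)" if "X \<noteq> 0" "Y \<noteq> 0" for c X Y :: complex
      using that by (simp add: field_simps)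
    note this[OF a, of "inverse (of_nat (Suc k))"]
    ultimately show "(inverse (of_nat (Suc k)) - inverse (1 - z + of_nat k)) - (inverse (of_nat (Suc k)) - inverse (z + 1 + of_nat k))
       = - (2 * z / (of_nat (Suc k) ^ 2 - z ^ 2))"
      by (simp only:) simp
  qed
  finally have "(\<lambda>k. - (2 * z / (of_nat (Suc k) ^ 2 - z ^ 2))) sums (Digamma (1 - z) - Digamma (z + 1))" by simp
  from sums_minus[OF this] have "(\<lambda>k. 2 * z / (of_nat (Suc k) ^ 2 - z ^ 2)) sums (Digamma (z + 1) - Digamma (1 - z))" by simp
  also have "Digamma (z + 1) - Digamma (1 - z) = 1 / z - of_real pi * cot (of_real pi * z)"
    unfolding Digamma_plus1[OF nz(3)] using psi by (simp add: algebra_simps)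
  finally show ?thesis .
qed

text \<open>The cotangent expansion on the imaginary axis, at
  \<open>z = \<i> * u / (2 * pi)\<close>: there the cotangent turns into the hyperbolic cotangent of
  \<open>u / 2\<close>, which equals \<open>2 / (exp u - 1) + 1\<close>.\<close>

lemma exp_partial_fractions:
  fixes u :: real
  assumes u: "u > 0"
  shows "(\<lambda>k. 2 * u / (u ^ 2 + (2 * pi * real (Suc k)) ^ 2)) sums (1 / (exp u - 1) - 1 / u + 1 / 2)"
proof -
  define z where "z = \<i> * of_real (u / (2 * pi))"
  have "Im z = u / (2 * pi)" by (simp add: z_def)
  then have "Im z \<noteq> 0" using u by simp
  then have "z \<notin> \<int>" by (auto elim!: Ints_cases)
  from sums_mult[OF cot_partial_fractions[OF this], of "- \<i> / (2 * of_real pi)"]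
  have "(\<lambda>k. - \<i> / (2 * of_real pi) * (2 * z / (of_nat (Suc k) ^ 2 - z ^ 2))) sums
     (- \<i> / (2 * of_real pi) * (1 / z - of_real pi * cot (of_real pi * z)))" .
  also have "(\<lambda>k. - \<i> / (2 * of_real pi) * (2 * z / (of_nat (Suc k) ^ 2 - z ^ 2)))
     = (\<lambda>k. of_real (2 * u / (u ^ 2 + (2 * pi * real (Suc k)) ^ 2)))"
  proof
    fix k
    have "z ^ 2 = of_real (- ((u / (2 * pi)) ^ 2))" by (simp add: z_def power_mult_distrib power_divide)
    then have "- \<i> / (2 * of_real pi) * (2 * z / (of_nat (Suc k) ^ 2 - z ^ 2))
       = of_real (1 / (2 * pi) * (2 * (u / (2 * pi)) / (real (Suc k) ^ 2 + (u / (2 * pi)) ^ 2)))"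
      by (simp add: z_def)
    also have "1 / (2 * pi) * (2 * (u / (2 * pi)) / (real (Suc k) ^ 2 + (u / (2 * pi)) ^ 2))
      = 2 * u / (u ^ 2 + (2 * pi * real (Suc k)) ^ 2)"
    proof -
      have "(2 * pi) ^ 2 * (real (Suc k) ^ 2 + (u / (2 * pi)) ^ 2) = u ^ 2 + (2 * pi * real (Suc k)) ^ 2"
        by (simp add: power_mult_distrib power_divide distrib_left del: of_nat_Suc)
      moreover have "1 / (2 * pi) * (2 * (u / (2 * pi)) / X) = 2 * u / ((2 * pi) ^ 2 * X)" for X
        by (simp add: power2_eq_square)
      ultimately show ?thesis by (simp only:)
    qed
    finally show "- \<i> / (2 * of_real pi) * (2 * z / (of_nat (Suc k) ^ 2 - z ^ 2)) = of_real (2 * u / (u ^ 2 + (2 * pi * real (Suc k)) ^ 2))" .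
  qed
  also have "- \<i> / (2 * of_real pi) * (1 / z - of_real pi * cot (of_real pi * z)) = of_real (1 / (exp u - 1) - 1 / u + 1 / 2)"
  proof -
    have pz: "of_real pi * z = \<i> * of_real (u / 2)" by (simp add: z_def)
    have c: "cos (of_real pi * z) = of_real (cosh (u / 2))"
      unfolding pz cos_i_times by (simp add: cosh_def exp_minus flip: exp_of_real)
    have s: "sin (of_real pi * z) = \<i> * of_real (sinh (u / 2))"
      unfolding pz sin_i_times by (simp add: sinh_def exp_minus flip: exp_of_real)
    have "cosh (u / 2) / sinh (u / 2) / 2 = 1 / (exp u - 1) + 1 / 2"
    proof -
      define e where "e = exp (u / 2)"
      have e: "e > 1" "exp u = e * e" using u by (auto simp: e_def simp flip: exp_add)
      have ee: "e * e > 1" using e(1) by (simp add: less_1_mult)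
      have "cosh (u / 2) = (e + 1 / e) / 2" "sinh (u / 2) = (e - 1 / e) / 2"
        by (simp_all add: cosh_field_def sinh_field_def e_def exp_minus inverse_eq_divide)
      moreover have "e + 1 / e = (e * e + 1) / e" "e - 1 / e = (e * e - 1) / e" using e by (simp_all add: field_simps)
      ultimately have "cosh (u / 2) / sinh (u / 2) = (e * e + 1) / (e * e - 1)" using e by simp
      also have "\<dots> = ((e * e - 1) + 2) / (e * e - 1)" by simp
      finally have "cosh (u / 2) / sinh (u / 2) / 2 = ((e * e - 1) + 2) / (e * e - 1) / 2" by (simp only:)
      moreover have "(X + 2) / X / 2 = 1 / X + 1 / 2" if "X \<noteq> 0" for X :: real
        using that by (simp add: add_divide_distrib)
      moreover have "e * e - 1 \<noteq> 0" using ee by simp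
      ultimately show ?thesis unfolding e(2) by (simp only:)
    qed
    moreover have "- \<i> / (2 * of_real pi) * (1 / z) = of_real (- 1 / u)" using u by (simp add: z_def field_simps)
    moreover have "- \<i> / (2 * of_real pi) * (of_real pi * cot (of_real pi * z)) = - of_real (cosh (u / 2) / sinh (u / 2) / 2)"
      unfolding cot_def c s by (simp add: field_simps)
    ultimately show ?thesis by (simp add: right_diff_distrib del: of_real_divide)
  qed
  finally show ?thesis by (simp only: sums_of_real_iff)
qed

subsection \<open>Some integrals over the positive half-line\<close>

text \<open>The substitution \<open>t = u ^ 2\<close> is made on \<open>{0..n}\<close>, and monotone
  convergence in \<open>n\<close> reaches the half-line.\<close>

lemma nn_integral_square_substitution:
  fixes f :: "real \<Rightarrow> ennreal"
  assumes [measurable]: "f \<in> borel_measurable borel"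
  shows "(\<integral>\<^sup>+t\<in>{0<..}. f t \<partial>lborel) = (\<integral>\<^sup>+u\<in>{0<..}. f (u ^ 2) * ennreal (2 * u) \<partial>lborel)"
proof -
  define h where "h t = f t * indicator {0<..} t" for t
  have [measurable]: "h \<in> borel_measurable borel" unfolding h_def by measurable
  have eq: "(\<integral>\<^sup>+t. h t * indicator {0..real n ^ 2} t \<partial>lborel)
      = (\<integral>\<^sup>+u. h (u ^ 2) * ennreal (2 * u) * indicator {0..real n} u \<partial>lborel)" if "n > 0" for n
  proof -
    have "((\<lambda>u. u ^ 2) has_real_derivative 2 * u) (at u)" for u :: real
      by (auto intro!: derivative_eq_intros)
    then show ?thesis
      using nn_integral_substitution_aux[of h 0 "real n" "\<lambda>u. u ^ 2" "\<lambda>u. 2 * u"] that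
      by (simp add: continuous_intros)
  qed
  have inc1: "(\<lambda>n. \<integral>\<^sup>+t. h t * indicator {0..real (Suc n) ^ 2} t \<partial>lborel) \<longlonglongrightarrow> (\<integral>\<^sup>+t. h t \<partial>lborel)"
  proof (rule nn_integral_LIMSEQ)
    show "incseq (\<lambda>n t. h t * indicator {0..real (Suc n) ^ 2} t)"
    proof (intro incseq_SucI le_funI mult_left_mono)
      fix n t
      have "real (Suc n) ^ 2 \<le> real (Suc (Suc n)) ^ 2" by (intro power_mono) auto
      then show "indicator {0..real (Suc n) ^ 2} t \<le> (indicator {0..real (Suc (Suc n)) ^ 2} t :: ennreal)"
        by (auto simp: indicator_def intro: order_trans simp del: of_nat_Suc)
    qed auto
    fix t
    show "(\<lambda>n. h t * indicator {0..real (Suc n) ^ 2} t) \<longlonglongrightarrow> h t"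
    proof (rule tendsto_eventually)
      obtain N where N: "t \<le> real N" using real_arch_simple by blast
      show "\<forall>\<^sub>F n in sequentially. h t * indicator {0..real (Suc n) ^ 2} t = h t"
        using eventually_ge_at_top[of N]
      proof eventually_elim
        case (elim n)
        have "t \<le> real (Suc n) * 1" using N elim by simp
        also have "\<dots> \<le> real (Suc n) * real (Suc n)" by (intro mult_left_mono) auto
        finally show ?case by (auto simp: h_def indicator_def power2_eq_square)
      qed
    qed
  qed measurable
  have inc2: "(\<lambda>n. \<integral>\<^sup>+u. h (u ^ 2) * ennreal (2 * u) * indicator {0..real (Suc n)} u \<partial>lborel) \<longlonglongrightarrow> (\<integral>\<^sup>+u\<in>{0<..}. f (u ^ 2) * ennreal (2 * u) \<partial>lborel)"
  proof (rule nn_integral_LIMSEQ)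
    show "incseq (\<lambda>n u. h (u ^ 2) * ennreal (2 * u) * indicator {0..real (Suc n)} u)"
      by (intro incseq_SucI le_funI mult_left_mono) (auto simp: indicator_def)
    fix u :: real
    show "(\<lambda>n. h (u ^ 2) * ennreal (2 * u) * indicator {0..real (Suc n)} u) \<longlonglongrightarrow> f (u ^ 2) * ennreal (2 * u) * indicator {0<..} u"
    proof (rule tendsto_eventually)
      obtain N where N: "u \<le> real N" using real_arch_simple by blast
      show "\<forall>\<^sub>F n in sequentially. h (u ^ 2) * ennreal (2 * u) * indicator {0..real (Suc n)} u = f (u ^ 2) * ennreal (2 * u) * indicator {0<..} u"
        using eventually_ge_at_top[of N]
        by eventually_elim (use N in \<open>auto simp: h_def indicator_def\<close>)
    qed
  qed measurable
  have "(\<lambda>n. \<integral>\<^sup>+t. h t * indicator {0..real (Suc n) ^ 2} t \<partial>lborel) \<longlonglongrightarrow> (\<integral>\<^sup>+u\<in>{0<..}. f (u ^ 2) * ennreal (2 * u) \<partial>lborel)"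
    using inc2 by (simp only: eq[OF zero_less_Suc])
  from LIMSEQ_unique[OF inc1 this] show ?thesis by (simp only: h_def)
qed

lemma nn_integral_Gamma_scaled:
  assumes "x > 0" "y > (0 :: real)"
  shows "(\<integral>\<^sup>+u\<in>{0<..}. ennreal (u powr (x - 1) * exp (- (y * u))) \<partial>lborel) = ennreal (Gamma x * y powr (- x))"
proof -
  let ?I = "\<integral>\<^sup>+u\<in>{0<..}. ennreal (u powr (x - 1) * exp (- (y * u))) \<partial>lborel"
  have "ennreal (Gamma x) = (\<integral>\<^sup>+t. ennreal (indicator {0..} t * t powr (x - 1) / exp t) \<partial>lborel)"
    using Gamma_conv_nn_integral_real[OF assms(1)] .
  also have "\<dots> = ennreal \<bar>y\<bar> * (\<integral>\<^sup>+u. ennreal (indicator {0..} (0 + y * u) * (0 + y * u) powr (x - 1) / exp (0 + y * u)) \<partial>lborel)"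
    by (rule nn_integral_real_affine) (use assms in auto)
  also have "(\<integral>\<^sup>+u. ennreal (indicator {0..} (0 + y * u) * (0 + y * u) powr (x - 1) / exp (0 + y * u)) \<partial>lborel)
     = (\<integral>\<^sup>+u. ennreal (y powr (x - 1)) * (ennreal (u powr (x - 1) * exp (- (y * u))) * indicator {0<..} u) \<partial>lborel)"
  proof (rule nn_integral_cong)
    fix u :: real
    consider "u < 0" | "u = 0" | "u > 0" by linarith
    then show "ennreal (indicator {0..} (0 + y * u) * (0 + y * u) powr (x - 1) / exp (0 + y * u))
       = ennreal (y powr (x - 1)) * (ennreal (u powr (x - 1) * exp (- (y * u))) * indicator {0<..} u)"
    proof cases
      case 1
      then have "y * u < 0" using assms by (simp add: mult_pos_neg)
      then show ?thesis using 1 by simp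
    next
      case 3
      then show ?thesis using assms
        by (simp add: powr_mult exp_minus divide_inverse mult.assoc flip: ennreal_mult')
    qed simp
  qed
  also have "\<dots> = ennreal (y powr (x - 1)) * ?I"
    by (rule nn_integral_cmult) measurable
  finally have G: "ennreal (Gamma x) = ennreal \<bar>y\<bar> * (ennreal (y powr (x - 1)) * ?I)" .
  have "ennreal \<bar>y\<bar> * ennreal (y powr (x - 1)) = ennreal (y powr x)"
    using assms by (simp add: powr_mult_base flip: ennreal_mult')
  then have "ennreal (Gamma x) = ennreal (y powr x) * ?I"
    using G by (simp only: mult.assoc[symmetric])
  then have "ennreal (y powr (- x)) * ennreal (Gamma x) = ennreal (y powr (- x)) * ennreal (y powr x) * ?I"
    by (simp only: mult.assoc)
  also have "ennreal (y powr (- x)) * ennreal (y powr x) = 1"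
    using assms by (simp add: powr_minus flip: ennreal_mult')
  finally show ?thesis using assms by (simp add: mult.commute flip: ennreal_mult')
qed

text \<open>With non-negative integrands the order of integration may be exchanged without any
  integrability proof. The point \<open>y = 0\<close> is exempted, being a null set where the inner
  integral may diverge.\<close>

lemma nn_integral_Tonelli_half_line:
  fixes f :: "real \<Rightarrow> real \<Rightarrow> real"
  assumes meas [measurable]: "case_prod f \<in> borel_measurable (borel \<Otimes>\<^sub>M borel)" and S [measurable]: "S \<in> sets borel"
    and inner_u: "\<And>y. y \<in> S \<Longrightarrow> y \<noteq> 0 \<Longrightarrow> (\<integral>\<^sup>+u\<in>{0<..}. ennreal (f u y) \<partial>lborel) = ennreal (\<phi> y)"
    and inner_y: "\<And>u. u > 0 \<Longrightarrow> (\<integral>\<^sup>+y\<in>S. ennreal (f u y) \<partial>lborel) = ennreal (F u)"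
    and outer: "(\<integral>\<^sup>+y\<in>S. ennreal (\<phi> y) \<partial>lborel) = I"
  shows "(\<integral>\<^sup>+u\<in>{0<..}. ennreal (F u) \<partial>lborel) = I"
proof -
  have [measurable]: "(\<lambda>(u, y). ennreal (f u y) * indicator S y * indicator {0<..} u) \<in> borel_measurable (lborel \<Otimes>\<^sub>M lborel)"
    by (simp add: case_prod_beta) measurable
  have "(\<integral>\<^sup>+u\<in>{0<..}. ennreal (F u) \<partial>lborel) = (\<integral>\<^sup>+u. (\<integral>\<^sup>+y. ennreal (f u y) * indicator S y * indicator {0<..} u \<partial>lborel) \<partial>lborel)"
    by (intro nn_integral_cong) (auto simp: inner_y split: split_indicator)
  also have "\<dots> = (\<integral>\<^sup>+y. (\<integral>\<^sup>+u. ennreal (f u y) * indicator S y * indicator {0<..} u \<partial>lborel) \<partial>lborel)"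
    by (rule lborel_pair.Fubini'[symmetric]) measurable
  also have "\<dots> = (\<integral>\<^sup>+y\<in>S. ennreal (\<phi> y) \<partial>lborel)"
  proof (rule nn_integral_cong_AE)
    have "AE y in lborel. y \<noteq> (0 :: real)" by (rule AE_lborel_singleton)
    then show "AE y in lborel. (\<integral>\<^sup>+u. ennreal (f u y) * indicator S y * indicator {0<..} u \<partial>lborel) = ennreal (\<phi> y) * indicator S y"
      by eventually_elim (auto simp: inner_u split: split_indicator)
  qed
  finally show ?thesis using outer by simp
qed

text \<open>Writes \<open>1 / (u ^ 2 + c ^ 2)\<close> as the integral of
  \<open>exp (- (w * (u ^ 2 + c ^ 2)))\<close> over \<open>w > 0\<close>. After the exchange both
  integrals are Gamma integrals, the one in \<open>u\<close> through
  \<open>t = u ^ 2\<close>.\<close>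

lemma nn_integral_rational_power:
  assumes a: "0 < a" "a < 1" and c: "c > (0 :: real)"
  shows "(\<integral>\<^sup>+u\<in>{0<..}. ennreal (2 * u powr (- a) / (u ^ 2 + c ^ 2)) \<partial>lborel)
     = ennreal (Gamma ((1 - a) / 2) * Gamma ((1 + a) / 2) * c powr (- 1 - a))"
proof (rule nn_integral_Tonelli_half_line[where S = "{0<..}" and f = "\<lambda>u w. 2 * u powr (- a) * exp (- (w * (u ^ 2 + c ^ 2)))"
      and \<phi> = "\<lambda>w. Gamma ((1 - a) / 2) * (w powr ((1 + a) / 2 - 1) * exp (- (c ^ 2 * w)))"])
  fix w :: real assume w: "w \<in> {0<..}"
  have "(\<integral>\<^sup>+u\<in>{0<..}. ennreal (2 * u powr (- a) * exp (- (w * (u ^ 2 + c ^ 2)))) \<partial>lborel)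
     = (\<integral>\<^sup>+u. ennreal (exp (- (w * c ^ 2))) * (ennreal ((u ^ 2) powr ((1 - a) / 2 - 1) * exp (- (w * u ^ 2))) * ennreal (2 * u) * indicator {0<..} u) \<partial>lborel)"
  proof (intro nn_integral_cong)
    fix u :: real
    have "2 * u powr (- a) * exp (- (w * (u ^ 2 + c ^ 2))) = exp (- (w * c ^ 2)) * ((u ^ 2) powr ((1 - a) / 2 - 1) * exp (- (w * u ^ 2)) * (2 * u))" if "u > 0"
    proof -
      have "(u ^ 2) powr ((1 - a) / 2 - 1) = u powr (- a - 1)"
      proof -
        have "(u ^ 2) powr z = u powr (2 * z)" for z
          using that by (simp add: powr_powr flip: powr_numeral)
        moreover have "2 * ((1 - a) / 2 - 1) = - a - 1" by (simp add: field_simps)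
        ultimately show ?thesis by (simp only:)
      qed
      moreover have "u powr (- a - 1) * u = u powr (- a)"
        using that powr_add[of u "- a - 1" 1] by simp
      moreover have "exp (- (w * (u ^ 2 + c ^ 2))) = exp (- (w * c ^ 2)) * exp (- (w * u ^ 2))"
        by (simp add: distrib_left flip: exp_add)
      moreover have "exp (- (w * c ^ 2)) * (u powr (- a - 1) * exp (- (w * u ^ 2)) * (2 * u))
          = 2 * (u powr (- a - 1) * u) * (exp (- (w * c ^ 2)) * exp (- (w * u ^ 2)))"
        by (simp only: mult_ac)
      ultimately show ?thesis by (simp only:)
    qed
    then show "ennreal (2 * u powr (- a) * exp (- (w * (u ^ 2 + c ^ 2)))) * indicator {0<..} u
       = ennreal (exp (- (w * c ^ 2))) * (ennreal ((u ^ 2) powr ((1 - a) / 2 - 1) * exp (- (w * u ^ 2))) * ennreal (2 * u) * indicator {0<..} u)"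
    proof (cases "u > 0")
      case True
      have "ennreal (exp (- (w * c ^ 2))) * (ennreal X * ennreal (2 * u)) = ennreal (exp (- (w * c ^ 2)) * (X * (2 * u)))" if "X \<ge> 0" for X
        using that True by (subst ennreal_mult[symmetric], simp, simp, subst ennreal_mult[symmetric]) auto
      then show ?thesis using True \<open>u > 0 \<Longrightarrow> _\<close> by simp
    qed simp
  qed
  also have "\<dots> = ennreal (exp (- (w * c ^ 2))) * (\<integral>\<^sup>+u\<in>{0<..}. ennreal ((u ^ 2) powr ((1 - a) / 2 - 1) * exp (- (w * u ^ 2))) * ennreal (2 * u) \<partial>lborel)"
    by (rule nn_integral_cmult) measurable
  also have "(\<integral>\<^sup>+u\<in>{0<..}. ennreal ((u ^ 2) powr ((1 - a) / 2 - 1) * exp (- (w * u ^ 2))) * ennreal (2 * u) \<partial>lborel)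
     = (\<integral>\<^sup>+t\<in>{0<..}. ennreal (t powr ((1 - a) / 2 - 1) * exp (- (w * t))) \<partial>lborel)"
    by (rule nn_integral_square_substitution[symmetric]) measurable
  also have "\<dots> = ennreal (Gamma ((1 - a) / 2) * w powr (- ((1 - a) / 2)))"
    using a w by (intro nn_integral_Gamma_scaled) auto
  also have "ennreal (exp (- (w * c ^ 2))) * ennreal (Gamma ((1 - a) / 2) * w powr (- ((1 - a) / 2)))
     = ennreal (Gamma ((1 - a) / 2) * (w powr ((1 + a) / 2 - 1) * exp (- (c ^ 2 * w))))"
  proof -
    have e: "- ((1 - a) / 2) = (1 + a) / 2 - 1" by (simp add: field_simps)
    show ?thesis unfolding e by (simp add: ennreal_mult'[symmetric] mult_ac)
  qed
  finally show "(\<integral>\<^sup>+u\<in>{0<..}. ennreal (2 * u powr (- a) * exp (- (w * (u ^ 2 + c ^ 2)))) \<partial>lborel)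
     = ennreal (Gamma ((1 - a) / 2) * (w powr ((1 + a) / 2 - 1) * exp (- (c ^ 2 * w))))" .
next
  fix u :: real assume u: "u > 0"
  have k: "u ^ 2 + c ^ 2 > 0" using c by (simp add: add_nonneg_pos)
  have "(\<integral>\<^sup>+w\<in>{0<..}. ennreal (2 * u powr (- a) * exp (- (w * (u ^ 2 + c ^ 2)))) \<partial>lborel)
     = (\<integral>\<^sup>+w. ennreal (2 * u powr (- a)) * (ennreal (w powr (1 - 1) * exp (- ((u ^ 2 + c ^ 2) * w))) * indicator {0<..} w) \<partial>lborel)"
    by (intro nn_integral_cong) (auto simp: ennreal_mult' mult.commute split: split_indicator)
  also have "\<dots> = ennreal (2 * u powr (- a)) * (\<integral>\<^sup>+w\<in>{0<..}. ennreal (w powr (1 - 1) * exp (- ((u ^ 2 + c ^ 2) * w))) \<partial>lborel)"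
    by (rule nn_integral_cmult) measurable
  also have "(\<integral>\<^sup>+w\<in>{0<..}. ennreal (w powr (1 - 1) * exp (- ((u ^ 2 + c ^ 2) * w))) \<partial>lborel) = ennreal (Gamma 1 * (u ^ 2 + c ^ 2) powr (- 1))"
    using k by (intro nn_integral_Gamma_scaled) auto
  also have "ennreal (2 * u powr (- a)) * ennreal (Gamma 1 * (u ^ 2 + c ^ 2) powr (- 1)) = ennreal (2 * u powr (- a) / (u ^ 2 + c ^ 2))"
    using k by (simp add: powr_minus divide_inverse flip: ennreal_mult')
  finally show "(\<integral>\<^sup>+w\<in>{0<..}. ennreal (2 * u powr (- a) * exp (- (w * (u ^ 2 + c ^ 2)))) \<partial>lborel) = ennreal (2 * u powr (- a) / (u ^ 2 + c ^ 2))" .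
next
  have G: "Gamma ((1 - a) / 2) > 0" using a by (intro Gamma_real_pos) auto
  have "(\<integral>\<^sup>+w\<in>{0<..}. ennreal (Gamma ((1 - a) / 2) * (w powr ((1 + a) / 2 - 1) * exp (- (c ^ 2 * w)))) \<partial>lborel)
     = (\<integral>\<^sup>+w. ennreal (Gamma ((1 - a) / 2)) * (ennreal (w powr ((1 + a) / 2 - 1) * exp (- (c ^ 2 * w))) * indicator {0<..} w) \<partial>lborel)"
    using G by (intro nn_integral_cong) (auto simp: ennreal_mult' split: split_indicator)
  also have "\<dots> = ennreal (Gamma ((1 - a) / 2)) * (\<integral>\<^sup>+w\<in>{0<..}. ennreal (w powr ((1 + a) / 2 - 1) * exp (- (c ^ 2 * w))) \<partial>lborel)"
    by (rule nn_integral_cmult) measurable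
  also have "(\<integral>\<^sup>+w\<in>{0<..}. ennreal (w powr ((1 + a) / 2 - 1) * exp (- (c ^ 2 * w))) \<partial>lborel) = ennreal (Gamma ((1 + a) / 2) * (c ^ 2) powr (- ((1 + a) / 2)))"
    using a c by (intro nn_integral_Gamma_scaled) auto
  also have "(c ^ 2) powr (- ((1 + a) / 2)) = c powr (- 1 - a)"
  proof -
    have "(c ^ 2) powr z = c powr (2 * z)" for z using c by (simp add: powr_powr flip: powr_numeral)
    moreover have "2 * (- ((1 + a) / 2)) = - 1 - a" by (simp add: field_simps)
    ultimately show ?thesis by (simp only:)
  qed
  finally show "(\<integral>\<^sup>+w\<in>{0<..}. ennreal (Gamma ((1 - a) / 2) * (w powr ((1 + a) / 2 - 1) * exp (- (c ^ 2 * w)))) \<partial>lborel)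
     = ennreal (Gamma ((1 - a) / 2) * Gamma ((1 + a) / 2) * c powr (- 1 - a))"
    using G by (simp add: ennreal_mult'[symmetric] mult.assoc)
qed measurable

text \<open>\<open>(1 - exp (- (x * u))) / u\<close> is the integral of
  \<open>exp (- (y * u))\<close> over \<open>y\<close> in \<open>{0..x}\<close>; the inner integral
  in \<open>u\<close> is then a Gamma integral.\<close>

lemma nn_integral_one_minus_exp:
  assumes a: "0 < a" "a < 1" and x: "x \<ge> (0 :: real)"
  shows "(\<integral>\<^sup>+u\<in>{0<..}. ennreal (u powr (- a - 1) * (1 - exp (- (x * u)))) \<partial>lborel) = ennreal (Gamma (1 - a) / a * x powr a)"
proof (rule nn_integral_Tonelli_half_line[where S = "{0..x}" and f = "\<lambda>u y. u powr (- a) * exp (- (y * u))"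
      and \<phi> = "\<lambda>y. Gamma (1 - a) * y powr (a - 1)"])
  fix y assume "y \<in> {0..x}" "y \<noteq> 0"
  then show "(\<integral>\<^sup>+u\<in>{0<..}. ennreal (u powr (- a) * exp (- (y * u))) \<partial>lborel) = ennreal (Gamma (1 - a) * y powr (a - 1))"
    using nn_integral_Gamma_scaled[of "1 - a" y] a by simp
next
  fix u :: real assume u: "u > 0"
  have "((\<lambda>y. u powr (- a) * exp (- (y * u))) has_integral
      (- (u powr (- a - 1) * exp (- (x * u))) - - (u powr (- a - 1) * exp (- (0 * u))))) {0..x}"
  proof (rule fundamental_theorem_of_calculus[OF x])
    fix y
    have "u powr (- a - 1) * u = u powr (- a)" using u powr_add[of u "- a - 1" 1] by simp
    then have "((\<lambda>y. - (u powr (- a - 1) * exp (- (y * u)))) has_real_derivative u powr (- a) * exp (- (y * u))) (at y within {0..x})"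
      by (auto intro!: derivative_eq_intros simp: mult_ac)
    then show "((\<lambda>y. - (u powr (- a - 1) * exp (- (y * u)))) has_vector_derivative u powr (- a) * exp (- (y * u))) (at y within {0..x})"
      by (simp add: has_real_derivative_iff_has_vector_derivative)
  qed
  then have "((\<lambda>y. u powr (- a) * exp (- (y * u))) has_integral u powr (- a - 1) * (1 - exp (- (x * u)))) {0..x}"
    by (simp add: algebra_simps)
  then show "(\<integral>\<^sup>+y\<in>{0..x}. ennreal (u powr (- a) * exp (- (y * u))) \<partial>lborel) = ennreal (u powr (- a - 1) * (1 - exp (- (x * u))))"
    by (intro nn_integral_has_integral_lebesgue') auto
next
  have G: "Gamma (1 - a) > 0" using a by (intro Gamma_real_pos) auto
  have "((\<lambda>y. Gamma (1 - a) * y powr (a - 1)) has_integral Gamma (1 - a) * (x powr (a - 1 + 1) / (a - 1 + 1))) {0..x}"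
    using a x by (intro has_integral_mult_right has_integral_powr_from_0) auto
  then have "((\<lambda>y. Gamma (1 - a) * y powr (a - 1)) has_integral Gamma (1 - a) / a * x powr a) {0..x}" by simp
  then show "(\<integral>\<^sup>+y\<in>{0..x}. ennreal (Gamma (1 - a) * y powr (a - 1)) \<partial>lborel) = ennreal (Gamma (1 - a) / a * x powr a)"
    using G by (intro nn_integral_has_integral_lebesgue') auto
qed measurable

text \<open>Integrate \<open>nn_integral_one_minus_exp\<close> over \<open>x\<close> in
  \<open>{0..X}\<close>.\<close>

lemma nn_integral_linear_minus_exp:
  assumes a: "0 < a" "a < 1" and X: "X \<ge> (0 :: real)"
  shows "(\<integral>\<^sup>+u\<in>{0<..}. ennreal (u powr (- a - 1) * (X - (1 - exp (- (X * u))) / u)) \<partial>lborel)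
     = ennreal (Gamma (1 - a) / a * (X powr (1 + a) / (1 + a)))"
proof (rule nn_integral_Tonelli_half_line[where S = "{0..X}" and f = "\<lambda>u x. u powr (- a - 1) * (1 - exp (- (x * u)))"
      and \<phi> = "\<lambda>x. Gamma (1 - a) / a * x powr a"])
  fix x assume "x \<in> {0..X}" "x \<noteq> 0"
  then show "(\<integral>\<^sup>+u\<in>{0<..}. ennreal (u powr (- a - 1) * (1 - exp (- (x * u)))) \<partial>lborel) = ennreal (Gamma (1 - a) / a * x powr a)"
    using a by (intro nn_integral_one_minus_exp) auto
next
  fix u :: real assume u: "u > 0"
  have "((\<lambda>x. u powr (- a - 1) * (1 - exp (- (x * u)))) has_integral
      (u powr (- a - 1) * (X + exp (- (X * u)) / u) - u powr (- a - 1) * (0 + exp (- (0 * u)) / u))) {0..X}"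
  proof (rule fundamental_theorem_of_calculus[OF X])
    fix x
    have "((\<lambda>x. u powr (- a - 1) * (x + exp (- (x * u)) / u)) has_real_derivative u powr (- a - 1) * (1 - exp (- (x * u)))) (at x within {0..X})"
      using u by (auto intro!: derivative_eq_intros)
    then show "((\<lambda>x. u powr (- a - 1) * (x + exp (- (x * u)) / u)) has_vector_derivative u powr (- a - 1) * (1 - exp (- (x * u)))) (at x within {0..X})"
      by (simp add: has_real_derivative_iff_has_vector_derivative)
  qed
  also have "u powr (- a - 1) * (X + exp (- (X * u)) / u) - u powr (- a - 1) * (0 + exp (- (0 * u)) / u)
     = u powr (- a - 1) * (X - (1 - exp (- (X * u))) / u)"
    by (simp add: algebra_simps diff_divide_distrib)
  finally have "((\<lambda>x. u powr (- a - 1) * (1 - exp (- (x * u)))) has_integral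
      u powr (- a - 1) * (X - (1 - exp (- (X * u))) / u)) {0..X}" .
  then show "(\<integral>\<^sup>+x\<in>{0..X}. ennreal (u powr (- a - 1) * (1 - exp (- (x * u)))) \<partial>lborel) = ennreal (u powr (- a - 1) * (X - (1 - exp (- (X * u))) / u))"
    using u by (intro nn_integral_has_integral_lebesgue') auto
next
  have G: "Gamma (1 - a) > 0" using a by (intro Gamma_real_pos) auto
  have "((\<lambda>x. Gamma (1 - a) / a * x powr a) has_integral Gamma (1 - a) / a * (X powr (a + 1) / (a + 1))) {0..X}"
    using a X by (intro has_integral_mult_right has_integral_powr_from_0) auto
  then show "(\<integral>\<^sup>+x\<in>{0..X}. ennreal (Gamma (1 - a) / a * x powr a) \<partial>lborel) = ennreal (Gamma (1 - a) / a * (X powr (1 + a) / (1 + a)))"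
    using G a by (intro nn_integral_has_integral_lebesgue') (auto simp: add.commute)
qed measurable

text \<open>The integral of \<open>t powr a\<close> over \<open>[0, N]\<close> minus its trapezoidal
  sum with step 1, the endpoint 0 contributing nothing. For \<open>0 < a < 1\<close> it tends to
  minus the zeta value at \<open>- a\<close>.\<close>

definition trapezoid_error :: "real \<Rightarrow> nat \<Rightarrow> real" where
  "trapezoid_error a N = real N powr (1 + a) / (1 + a) + real N powr a / 2 - (\<Sum>j=1..N. real j powr a)"

lemma sum_exp_geometric:
  assumes "u > (0 :: real)"
  shows "(\<Sum>j=1..N. exp (- (real j * u))) = (1 - exp (- (real N * u))) / (exp u - 1)"
proof (induction N)
  case (Suc N)
  have "exp u - 1 \<noteq> 0" using assms by simp
  moreover have "exp (- (real (Suc N) * u)) * exp u = exp (- (real N * u))"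
    by (simp add: algebra_simps flip: exp_add)
  ultimately have "exp (- (real (Suc N) * u)) = (exp (- (real N * u)) - exp (- (real (Suc N) * u))) / (exp u - 1)"
    by (simp add: eq_divide_eq right_diff_distrib del: of_nat_Suc)
  then have "(\<Sum>j=1..Suc N. exp (- (real j * u))) = (1 - exp (- (real N * u))) / (exp u - 1)
      + (exp (- (real N * u)) - exp (- (real (Suc N) * u))) / (exp u - 1)"
    using Suc.IH by (simp del: of_nat_Suc)
  then show ?case by (simp add: add_divide_distrib[symmetric] del: of_nat_Suc)
qed simp

definition bose :: "real \<Rightarrow> real" where "bose u = 1 / (exp u - 1) - 1 / u + 1 / 2"

text \<open>\<open>bose\<close> is the Bose kernel \<open>1 / (exp u - 1)\<close> without the first two terms of its Laurent expansion at \<open>0\<close>. Its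
  Mellin transform at \<open>- a\<close> is a multiple of \<open>\<zeta>(- a)\<close>, and its partial fractions turn it into a multiple of \<open>\<zeta>(1 + a)\<close>.\<close>

lemma bose_nonneg: "u > 0 \<Longrightarrow> bose u \<ge> 0"
  using exp_partial_fractions[of u] unfolding bose_def sums_iff
  by (metis (no_types, lifting) suminf_nonneg divide_nonneg_nonneg add_nonneg_nonneg zero_le_power2 mult_nonneg_nonneg zero_le_numeral less_imp_le)

text \<open>Each of the three parts of \<open>trapezoid_error\<close> is one of the two preceding
  integrals. In the combined kernel the terms \<open>real N\<close> cancel, because the geometric
  sum leaves \<open>real N - E / (exp u - 1)\<close> with \<open>E = 1 - exp (- (N * u))\<close>;
  what remains is \<open>E\<close> times \<open>bose u\<close>.\<close>

lemma nn_integral_trapezoid_error: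
  assumes a: "0 < a" "a < 1"
  shows "(\<integral>\<^sup>+u\<in>{0<..}. ennreal (u powr (- a - 1) * (1 - exp (- (real N * u))) * bose u) \<partial>lborel) = ennreal (Gamma (1 - a) / a * trapezoid_error a N)"
proof -
  define G where "G = Gamma (1 - a) / a"
  have G: "G > 0" unfolding G_def using a by (intro divide_pos_pos Gamma_real_pos) auto
  have A: "has_bochner_integral lborel (\<lambda>u. indicator {0<..} u * (u powr (- a - 1) * (1 - exp (- (x * u))))) (G * x powr a)"
    if "x \<ge> 0" for x
  proof (rule has_bochner_integral_nn_integral)
    show "(\<integral>\<^sup>+u. ennreal (indicator {0<..} u * (u powr (- a - 1) * (1 - exp (- (x * u))))) \<partial>lborel) = ennreal (G * x powr a)"
      unfolding G_def nn_integral_one_minus_exp[OF a that, symmetric]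
      by (intro nn_integral_cong) (auto split: split_indicator)
  qed (use G that in \<open>auto intro!: AE_I2 split: split_indicator\<close>)
  have B: "has_bochner_integral lborel (\<lambda>u. indicator {0<..} u * (u powr (- a - 1) * (X - (1 - exp (- (X * u))) / u))) (G * (X powr (1 + a) / (1 + a)))"
    if "X \<ge> 0" for X
  proof (rule has_bochner_integral_nn_integral)
    show "(\<integral>\<^sup>+u. ennreal (indicator {0<..} u * (u powr (- a - 1) * (X - (1 - exp (- (X * u))) / u))) \<partial>lborel) = ennreal (G * (X powr (1 + a) / (1 + a)))"
      unfolding G_def nn_integral_linear_minus_exp[OF a that, symmetric]
      by (intro nn_integral_cong) (auto split: split_indicator)
    have "(1 - exp (- (X * u))) / u \<le> X" if "u > 0" for u
      using that exp_ge_add_one_self[of "- (X * u)"] by (simp add: divide_le_eq)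
    then show "AE u in lborel. 0 \<le> indicator {0<..} u * (u powr (- a - 1) * (X - (1 - exp (- (X * u))) / u))"
      by (auto intro!: AE_I2 mult_nonneg_nonneg split: split_indicator)
  qed (use G a that in auto)
  have "has_bochner_integral lborel (\<lambda>u. indicator {0<..} u * (u powr (- a - 1) * (real N - (1 - exp (- (real N * u))) / u))
        + indicator {0<..} u * (u powr (- a - 1) * (1 - exp (- (real N * u)))) / 2
        - (\<Sum>j=1..N. indicator {0<..} u * (u powr (- a - 1) * (1 - exp (- (real j * u))))))
     (G * (real N powr (1 + a) / (1 + a)) + G * real N powr a / 2 - (\<Sum>j=1..N. G * real j powr a))"
    by (intro has_bochner_integral_add has_bochner_integral_diff has_bochner_integral_sum has_bochner_integral_divide_zero A B) auto
  also have "(\<lambda>u. indicator {0<..} u * (u powr (- a - 1) * (real N - (1 - exp (- (real N * u))) / u))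
        + indicator {0<..} u * (u powr (- a - 1) * (1 - exp (- (real N * u)))) / 2
        - (\<Sum>j=1..N. indicator {0<..} u * (u powr (- a - 1) * (1 - exp (- (real j * u))))))
      = (\<lambda>u. indicator {0<..} u * (u powr (- a - 1) * (1 - exp (- (real N * u))) * bose u))"
  proof
    fix u :: real
    show "indicator {0<..} u * (u powr (- a - 1) * (real N - (1 - exp (- (real N * u))) / u))
        + indicator {0<..} u * (u powr (- a - 1) * (1 - exp (- (real N * u)))) / 2
        - (\<Sum>j=1..N. indicator {0<..} u * (u powr (- a - 1) * (1 - exp (- (real j * u)))))
      = indicator {0<..} u * (u powr (- a - 1) * (1 - exp (- (real N * u))) * bose u)"
    proof (cases "u > 0")
      case True
      define E where "E = 1 - exp (- (real N * u))"
      have "(\<Sum>j=1..N. u powr (- a - 1) * (1 - exp (- (real j * u)))) = u powr (- a - 1) * (real N - E / (exp u - 1))"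
        unfolding E_def sum_exp_geometric[OF True, symmetric] by (simp add: sum_distrib_left[symmetric] sum_subtractf)
      then show ?thesis using True
        unfolding E_def[symmetric] by (simp add: bose_def algebra_simps)
    qed simp
  qed
  also have "G * (real N powr (1 + a) / (1 + a)) + G * real N powr a / 2 - (\<Sum>j=1..N. G * real j powr a) = G * trapezoid_error a N"
    by (simp add: trapezoid_error_def right_diff_distrib distrib_left sum_distrib_left)
  finally have C: "has_bochner_integral lborel (\<lambda>u. indicator {0<..} u * (u powr (- a - 1) * (1 - exp (- (real N * u))) * bose u)) (G * trapezoid_error a N)" .
  have nonneg: "0 \<le> indicator {0<..} u * (u powr (- a - 1) * (1 - exp (- (real N * u))) * bose u)" for u
    by (auto intro!: mult_nonneg_nonneg bose_nonneg split: split_indicator)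
  have "(\<integral>\<^sup>+u. ennreal (indicator {0<..} u * (u powr (- a - 1) * (1 - exp (- (real N * u))) * bose u)) \<partial>lborel) = ennreal (G * trapezoid_error a N)"
    using C nonneg nn_integral_eq_integral[OF _ AE_I2[of lborel], of "\<lambda>u. indicator {0<..} u * (u powr (- a - 1) * (1 - exp (- (real N * u))) * bose u)"]
    by (simp add: has_bochner_integral_iff)
  moreover have "(\<integral>\<^sup>+u. ennreal (indicator {0<..} u * (u powr (- a - 1) * (1 - exp (- (real N * u))) * bose u)) \<partial>lborel)
     = (\<integral>\<^sup>+u\<in>{0<..}. ennreal (u powr (- a - 1) * (1 - exp (- (real N * u))) * bose u) \<partial>lborel)"
    by (intro nn_integral_cong) (auto split: split_indicator)
  ultimately show ?thesis by (simp add: G_def)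
qed

subsection \<open>The functional equation and non-vanishing\<close>

lemma em_coeff_0: "em_coeff 0 = 1 / 2"
  by (subst em_coeff.simps) (simp add: fact_numeral)

lemma of_nat_powr_of_real: "complex_of_nat n powr of_real x = of_real (real n powr x)"
  using powr_of_real[of "real n" x] by simp

text \<open>Order 3 is enough for every exponent with real part above -1. The term
  \<open>em_coeff 0 = 1 / 2\<close> supplies the trapezoidal correction, while the terms with
  \<open>em_coeff 1\<close> and \<open>em_coeff 2\<close> are added back and tend to 0.\<close>

lemma trapezoid_error_tendsto:
  assumes a: "0 < a" "a < 1"
  shows "(\<lambda>N. complex_of_real (- trapezoid_error a (Suc N))) \<longlonglongrightarrow> riemann_zeta (of_real (- a))"
proof -
  let ?w = "complex_of_real (- a)"
  have ne: "?w \<noteq> 1" using a by (metis Re_complex_of_real one_complex.sel(1) less_minus_iff less_trans not_less_iff_gr_or_eq zero_less_one neg_less_0_iff_less)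
  have "(\<lambda>N. ((\<Sum>j=1..Suc N. of_nat j powr (- ?w)) - em_prim 3 (powF ?w) (of_nat (Suc N)))
      + (em_coeff 1 * ((-1) ^ 1 * pochhammer ?w 1 * of_nat (Suc N) powr (- ?w - of_nat 1))
       + em_coeff 2 * ((-1) ^ 2 * pochhammer ?w 2 * of_nat (Suc N) powr (- ?w - of_nat 2))))
     \<longlonglongrightarrow> riemann_zeta ?w + (em_coeff 1 * ((-1) ^ 1 * pochhammer ?w 1 * 0) + em_coeff 2 * ((-1) ^ 2 * pochhammer ?w 2 * 0))"
    by (intro tendsto_add tendsto_mult tendsto_const riemann_zeta_em_tendsto tendsto_powr_neg_complex) (use a ne in auto)
  also have "(\<lambda>N. ((\<Sum>j=1..Suc N. of_nat j powr (- ?w)) - em_prim 3 (powF ?w) (of_nat (Suc N)))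
      + (em_coeff 1 * ((-1) ^ 1 * pochhammer ?w 1 * of_nat (Suc N) powr (- ?w - of_nat 1))
       + em_coeff 2 * ((-1) ^ 2 * pochhammer ?w 2 * of_nat (Suc N) powr (- ?w - of_nat 2))))
     = (\<lambda>N. complex_of_real (- trapezoid_error a (Suc N)))"
  proof
    fix N
    have p: "of_nat n powr (- ?w) = of_real (real n powr a)" "of_nat n powr (1 - ?w) = of_real (real n powr (1 + a))" for n
      using of_nat_powr_of_real[of n a] of_nat_powr_of_real[of n "1 + a"] by simp_all
    have "em_prim 3 (powF ?w) (of_nat (Suc N)) = of_nat (Suc N) powr (1 - ?w) / (1 - ?w) + 1 / 2 * of_nat (Suc N) powr (- ?w)
        + (em_coeff 1 * ((-1) ^ 1 * pochhammer ?w 1 * of_nat (Suc N) powr (- ?w - of_nat 1))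
       + em_coeff 2 * ((-1) ^ 2 * pochhammer ?w 2 * of_nat (Suc N) powr (- ?w - of_nat 2)))"
      by (simp add: em_prim_def numeral_3_eq_3 powF_0 powF_Suc em_coeff_0 numeral_2_eq_2 del: of_nat_Suc)
    then show "((\<Sum>j=1..Suc N. of_nat j powr (- ?w)) - em_prim 3 (powF ?w) (of_nat (Suc N)))
      + (em_coeff 1 * ((-1) ^ 1 * pochhammer ?w 1 * of_nat (Suc N) powr (- ?w - of_nat 1))
       + em_coeff 2 * ((-1) ^ 2 * pochhammer ?w 2 * of_nat (Suc N) powr (- ?w - of_nat 2)))
      = of_real (- trapezoid_error a (Suc N))"
      unfolding p by (simp add: trapezoid_error_def del: of_nat_Suc)
  qed
  finally show ?thesis by simp
qed

lemma bose_sums_powr: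
  assumes "u > (0 :: real)"
  shows "(\<lambda>k. 2 * u powr (- a) / (u ^ 2 + (2 * pi * real (Suc k)) ^ 2)) sums (u powr (- a - 1) * bose u)"
proof -
  have "u powr (- a - 1) * u = u powr (- a)" using assms powr_add[of u "- a - 1" 1] by simp
  then have L: "u powr (- a - 1) * (2 * u / X) = 2 * u powr (- a) / X" for X
    by (metis mult.assoc mult.commute times_divide_eq_right)
  show ?thesis
    using sums_mult[OF exp_partial_fractions[OF assms], of "u powr (- a - 1)"] unfolding L bose_def .
qed

lemma zeta_real_sums:
  assumes "x > 1"
  shows "(\<lambda>n. real (Suc n) powr (- x)) sums Re (riemann_zeta (of_real x))" "Im (riemann_zeta (of_real x)) = 0"
    "Re (riemann_zeta (of_real x)) > 0"
proof -
  have "(\<lambda>n. of_nat (Suc n) powr (- of_real x)) sums riemann_zeta (of_real x)"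
    using assms by (intro riemann_zeta_sums) simp
  then have *: "(\<lambda>n. complex_of_real (real (Suc n) powr (- x))) sums riemann_zeta (of_real x)"
    using of_nat_powr_of_real[of "Suc _" "- x"] by (simp del: of_nat_Suc)
  show 1: "(\<lambda>n. real (Suc n) powr (- x)) sums Re (riemann_zeta (of_real x))"
    using sums_Re[OF *] by simp
  show "Im (riemann_zeta (of_real x)) = 0"
    using sums_Im[OF *] sums_unique2[OF _ sums_zero] by simp
  have "summable (\<lambda>n. real (Suc n) powr (- x))" using 1 by (simp add: sums_iff)
  then have "0 < (\<Sum>n. real (Suc n) powr (- x))" by (intro suminf_pos) auto
  then show "Re (riemann_zeta (of_real x)) > 0" using 1 by (simp add: sums_iff)
qed

text \<open>The integral \<open>I\<close> of \<open>u powr (- a - 1) * bose u\<close> is evaluated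
  twice: as the monotone limit of the trapezoid integrals, giving zeta at \<open>- a\<close>, and
  term by term through the partial fractions of \<open>bose\<close>, giving zeta at
  \<open>1 + a\<close>.\<close>

lemma functional_equation_real:
  assumes a: "0 < a" "a < 1"
  shows "Gamma (1 - a) / a * (- Re (riemann_zeta (of_real (- a))))
     = Gamma ((1 - a) / 2) * Gamma ((1 + a) / 2) * (2 * pi) powr (- 1 - a) * Re (riemann_zeta (of_real (1 + a)))"
    and "Im (riemann_zeta (of_real (- a))) = 0"
proof -
  let ?Z = "riemann_zeta (of_real (- a))"
  note lim = trapezoid_error_tendsto[OF a]
  have re: "(\<lambda>N. trapezoid_error a (Suc N)) \<longlonglongrightarrow> - Re ?Z"
    using tendsto_minus[OF tendsto_Re[OF lim]] by simp
  have "(\<lambda>N. 0 :: real) \<longlonglongrightarrow> Im ?Z" using tendsto_Im[OF lim] by simp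
  then show "Im ?Z = 0" by (simp add: LIMSEQ_const_iff)
  define G where "G = Gamma (1 - a) / a"
  define H where "H = Gamma ((1 - a) / 2) * Gamma ((1 + a) / 2)"
  have G: "G > 0" unfolding G_def using a by (intro divide_pos_pos Gamma_real_pos) auto
  have H: "H > 0" unfolding H_def using a by (intro mult_pos_pos Gamma_real_pos) auto
  define I where "I = (\<integral>\<^sup>+u\<in>{0<..}. ennreal (u powr (- a - 1) * bose u) \<partial>lborel)"
  have lim1: "(\<lambda>N. ennreal (G * trapezoid_error a (Suc N))) \<longlonglongrightarrow> I"
    unfolding G_def nn_integral_trapezoid_error[OF a, symmetric] I_def
  proof (rule nn_integral_LIMSEQ)
    show "incseq (\<lambda>N u. ennreal (u powr (- a - 1) * (1 - exp (- (real (Suc N) * u))) * bose u) * indicator {0<..} u)"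
      by (intro incseq_SucI le_funI)
        (auto intro!: ennreal_leI mult_right_mono mult_left_mono bose_nonneg split: split_indicator)
    fix u :: real
    show "(\<lambda>N. ennreal (u powr (- a - 1) * (1 - exp (- (real (Suc N) * u))) * bose u) * indicator {0<..} u)
        \<longlonglongrightarrow> ennreal (u powr (- a - 1) * bose u) * indicator {0<..} u"
    proof (cases "u > 0")
      case True
      have "(\<lambda>N. exp (- u) ^ Suc N) \<longlonglongrightarrow> 0"
        using True by (intro LIMSEQ_Suc LIMSEQ_realpow_zero) auto
      also have "(\<lambda>N. exp (- u) ^ Suc N) = (\<lambda>N. exp (- (real (Suc N) * u)))"
        by (simp add: exp_of_nat_mult[symmetric] del: of_nat_Suc power_Suc)
      finally have "(\<lambda>N. ennreal (u powr (- a - 1) * (1 - exp (- (real (Suc N) * u))) * bose u)) \<longlonglongrightarrow> ennreal (u powr (- a - 1) * (1 - 0) * bose u)"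
        by (intro tendsto_intros)
      then show ?thesis using True by simp
    qed simp
  qed (simp_all add: bose_def)
  have lim2: "(\<lambda>N. ennreal (G * trapezoid_error a (Suc N))) \<longlonglongrightarrow> ennreal (G * (- Re ?Z))"
    by (intro tendsto_ennrealI tendsto_mult tendsto_const re)
  define S where "S = H * (2 * pi) powr (- 1 - a) * Re (riemann_zeta (of_real (1 + a)))"
  have "I = (\<integral>\<^sup>+u. (\<Sum>k. ennreal (2 * u powr (- a) / (u ^ 2 + (2 * pi * real (Suc k)) ^ 2)) * indicator {0<..} u) \<partial>lborel)"
    unfolding I_def
  proof (rule nn_integral_cong)
    fix u :: real
    show "ennreal (u powr (- a - 1) * bose u) * indicator {0<..} u = (\<Sum>k. ennreal (2 * u powr (- a) / (u ^ 2 + (2 * pi * real (Suc k)) ^ 2)) * indicator {0<..} u)"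
    proof (cases "u > 0")
      case True
      have "(\<Sum>k. ennreal (2 * u powr (- a) / (u ^ 2 + (2 * pi * real (Suc k)) ^ 2))) = ennreal (u powr (- a - 1) * bose u)"
        by (rule suminf_ennreal_eq[OF _ bose_sums_powr[OF True]]) simp
      then show ?thesis using True by simp
    qed simp
  qed
  also have "\<dots> = (\<Sum>k. \<integral>\<^sup>+u. ennreal (2 * u powr (- a) / (u ^ 2 + (2 * pi * real (Suc k)) ^ 2)) * indicator {0<..} u \<partial>lborel)"
    by (rule nn_integral_suminf) measurable
  also have "\<dots> = (\<Sum>k. ennreal (H * (2 * pi * real (Suc k)) powr (- 1 - a)))"
    unfolding H_def by (subst nn_integral_rational_power[OF a]) auto
  also have "\<dots> = ennreal S"
  proof (rule suminf_ennreal_eq)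
    have "(\<lambda>k. H * (2 * pi) powr (- 1 - a) * real (Suc k) powr (- (1 + a))) sums S"
      unfolding S_def using a by (intro sums_mult zeta_real_sums) auto
    also have "(\<lambda>k. H * (2 * pi) powr (- 1 - a) * real (Suc k) powr (- (1 + a))) = (\<lambda>k. H * (2 * pi * real (Suc k)) powr (- 1 - a))"
    proof
      fix k
      have "- (1 + a) = - 1 - a" by simp
      moreover have "(2 * pi * real (Suc k)) powr (- 1 - a) = (2 * pi) powr (- 1 - a) * real (Suc k) powr (- 1 - a)"
        by (rule powr_mult)
      ultimately show "H * (2 * pi) powr (- 1 - a) * real (Suc k) powr (- (1 + a)) = H * (2 * pi * real (Suc k)) powr (- 1 - a)"
        by (simp only: mult.assoc)
    qed
    finally show "(\<lambda>k. H * (2 * pi * real (Suc k)) powr (- 1 - a)) sums S" .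
  qed (use H in auto)
  finally have I: "I = ennreal S" .
  have S: "S > 0" unfolding S_def using H a by (intro mult_pos_pos zeta_real_sums) auto
  have eq: "ennreal (G * (- Re ?Z)) = ennreal S" using LIMSEQ_unique[OF lim2 lim1] I by simp
  \<comment> \<open>\<open>ennreal\<close> sends negative reals to 0, so the equation descends to
    the reals only because \<open>S > 0\<close>.\<close>
  have "G * (- Re ?Z) = S"
  proof (cases "G * (- Re ?Z) \<ge> 0")
    case True
    then show ?thesis using eq S by (simp only: ennreal_inj less_imp_le)
  next
    case False
    then have "ennreal S = 0" using eq by (simp add: ennreal_neg)
    then show ?thesis using S by simp
  qed
  then show "Gamma (1 - a) / a * (- Re ?Z)
     = Gamma ((1 - a) / 2) * Gamma ((1 + a) / 2) * (2 * pi) powr (- 1 - a) * Re (riemann_zeta (of_real (1 + a)))"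
    by (simp only: G_def S_def H_def)
qed

text \<open>The real formula on \<open>(-1, 0)\<close> spreads by the identity theorem. It is stated
  with \<open>rGamma\<close>, which is entire, so that the poles of Gamma do not obstruct holomorphy
  on the left half-plane.\<close>

lemma functional_equation:
  assumes "Re s < 0"
  shows "rGamma ((1 + s) / 2) * riemann_zeta s
     = of_real (2 * pi) powr (s - 1) * rGamma s * Gamma ((1 - s) / 2) * riemann_zeta (1 - s)"
proof -
  define f where "f s = rGamma ((1 + s) / 2) * riemann_zeta s
     - of_real (2 * pi) powr (s - 1) * rGamma s * Gamma ((1 - s) / 2) * riemann_zeta (1 - s)" for s
  have "f s = 0"
  proof (rule analytic_continuation[of f "{s. Re s < 0}" "of_real ` {-1<..<0}" "of_real (- 1 / 2)"])
    show "f holomorphic_on {s. Re s < 0}"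
      unfolding f_def
    proof (intro holomorphic_intros)
      fix z :: complex assume z: "z \<in> {s. Re s < 0}"
      show "(1 - z) / 2 \<notin> \<int>\<^sub>\<le>\<^sub>0"
      proof
        assume "(1 - z) / 2 \<in> \<int>\<^sub>\<le>\<^sub>0"
        then have "Re ((1 - z) / 2) \<le> 0" by (elim nonpos_Ints_cases) simp
        then show False using z by simp
      qed
    qed auto
    show "open {s. Re s < 0}" by (rule open_halfspace_Re_lt)
    show "connected {s. Re s < 0}" by (intro convex_connected convex_halfspace_Re_lt)
    show "complex_of_real (- 1 / 2) islimpt of_real ` {-1<..<0}"
      unfolding islimpt_approachable
    proof (intro allI impI)
      fix e :: real assume e: "e > 0"
      define x where "x = - 1 / 2 + min (e / 2) (1 / 4)"
      have "x \<in> {-1<..<0}" "x \<noteq> - 1 / 2" "\<bar>x - (- 1 / 2)\<bar> < e" using e by (auto simp: x_def min_def)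
      moreover have "dist (complex_of_real x) (of_real (- 1 / 2)) = \<bar>x - (- 1 / 2)\<bar>"
        unfolding dist_norm by (simp only: of_real_diff[symmetric] norm_of_real)
      ultimately show "\<exists>x'\<in>complex_of_real ` {-1<..<0}. x' \<noteq> of_real (- 1 / 2) \<and> dist x' (of_real (- 1 / 2)) < e"
        by (intro bexI[of _ "of_real x"]) (simp_all only: of_real_eq_iff imageI, simp)
    qed
  next
    fix z assume "z \<in> complex_of_real ` {-1<..<0}"
    then obtain a where a: "0 < a" "a < 1" and z: "z = of_real (- a)"
      by (auto intro!: that[of "- _"])
    define Zr Yr where "Zr = Re (riemann_zeta (of_real (- a)))" and "Yr = Re (riemann_zeta (of_real (1 + a)))"
    have ZY: "riemann_zeta (of_real (- a)) = of_real Zr" "riemann_zeta (of_real (1 + a)) = of_real Yr"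
      using functional_equation_real(2)[OF a] zeta_real_sums(2)[of "1 + a"] a
      by (simp_all add: complex_eq_iff Zr_def Yr_def)
    have G: "Gamma (1 - a) > 0" "Gamma ((1 - a) / 2) > 0" using a by (auto intro: Gamma_real_pos)
    have rG: "rGamma (- a) = - a / Gamma (1 - a)"
      using rGamma_plus1[of "- a"] by (simp add: rGamma_inverse_Gamma divide_inverse)
    have id: "Y = - (a / X) * (X / a * (- Y))" if "X > 0" for X Y :: real using that a by simp
    have "Zr = - (a / Gamma (1 - a)) * (Gamma (1 - a) / a * (- Zr))" by (rule id[OF G(1)])
    also have "\<dots> = rGamma (- a) * (Gamma ((1 - a) / 2) * Gamma ((1 + a) / 2) * (2 * pi) powr (- 1 - a) * Yr)"
      unfolding functional_equation_real(1)[OF a, folded Zr_def Yr_def] rG by simp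
    finally have "rGamma ((1 - a) / 2) * Zr = rGamma ((1 - a) / 2) * (rGamma (- a) * (Gamma ((1 - a) / 2) * Gamma ((1 + a) / 2) * (2 * pi) powr (- 1 - a) * Yr))"
      by (rule arg_cong)
    also have "\<dots> = (rGamma ((1 - a) / 2) * Gamma ((1 - a) / 2)) * ((2 * pi) powr (- 1 - a) * rGamma (- a) * Gamma ((1 + a) / 2) * Yr)"
      by (simp only: mult_ac)
    also have "rGamma ((1 - a) / 2) * Gamma ((1 - a) / 2) = 1" using G by (simp add: rGamma_inverse_Gamma)
    finally have r: "rGamma ((1 - a) / 2) * Zr = (2 * pi) powr (- 1 - a) * rGamma (- a) * Gamma ((1 + a) / 2) * Yr" by simp
    have e: "(1 + z) / 2 = of_real ((1 - a) / 2)" "(1 - z) / 2 = of_real ((1 + a) / 2)" "1 - z = of_real (1 + a)" "z - 1 = of_real (- 1 - a)"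
      by (simp_all add: z)
    have p: "complex_of_real (2 * pi) powr of_real (- 1 - a) = of_real ((2 * pi) powr (- 1 - a))"
      by (rule powr_of_real) auto
    have "rGamma ((1 + z) / 2) * riemann_zeta z = of_real (rGamma ((1 - a) / 2) * Zr)"
      unfolding e(1) unfolding z ZY rGamma_complex_of_real by (simp only: of_real_mult)
    also have "\<dots> = of_real (2 * pi) powr (z - 1) * rGamma z * Gamma ((1 - z) / 2) * riemann_zeta (1 - z)"
      unfolding r e(2) unfolding e(3,4) unfolding p unfolding z ZY rGamma_complex_of_real Gamma_complex_of_real by (simp only: of_real_mult)
    finally show "f z = 0" by (simp add: f_def)
  qed (use assms in auto)
  then show ?thesis by (simp add: f_def)
qed

text \<open>The induction step is \<open>(sqrt (x + 1) - sqrt x) ^ 2 \<ge> 0\<close>. The constant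
  -1, an equality at \<open>N = 0\<close>, is what remains in the limit.\<close>

lemma sum_inverse_sqrt_le: "(\<Sum>j=1..Suc N. real j powr (- (1 / 2))) \<le> 2 * real (Suc N) powr (1 / 2) - 1"
proof (induction N)
  case (Suc N)
  define x where "x = real (Suc N)"
  have x: "x > 0" "real (Suc (Suc N)) = x + 1" by (simp_all add: x_def)
  have p: "(x + 1) powr (- (1 / 2)) = 1 / sqrt (x + 1)" "(x + 1) powr (1 / 2) = sqrt (x + 1)" "x powr (1 / 2) = sqrt x"
    unfolding powr_minus_divide using x(1) by (simp_all only: powr_half_sqrt less_imp_le add_pos_pos zero_less_one)
  have "0 \<le> (sqrt (x + 1) - sqrt x) ^ 2" by simp
  also have "(sqrt (x + 1) - sqrt x) ^ 2 = (2 * sqrt (x + 1) - 2 * sqrt x) * sqrt (x + 1) - 1"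
    using x(1) by (simp add: power2_eq_square algebra_simps)
  finally have "1 \<le> (2 * sqrt (x + 1) - 2 * sqrt x) * sqrt (x + 1)" by simp
  moreover have "sqrt (x + 1) > 0" using x(1) by simp
  ultimately have "1 / sqrt (x + 1) \<le> 2 * sqrt (x + 1) - 2 * sqrt x"
    by (simp only: pos_divide_le_eq)
  then show ?case using Suc.IH unfolding sum.cl_ivl_Suc x(2) p x_def[symmetric] by simp
qed simp

text \<open>Zeta at 1/2 is the limit of the partial sums of \<open>j powr (- 1/2)\<close> minus
  \<open>2 * sqrt N\<close>, the other Euler--Maclaurin terms tending to 0. A direct bound is used
  because the functional equation relates 1/2 to itself.\<close>

lemma Re_zeta_half: "Re (riemann_zeta (1 / 2)) \<le> - 1"
proof -
  let ?w = "1 / 2 :: complex"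
  have "(\<lambda>N. ((\<Sum>j=1..Suc N. of_nat j powr (- ?w)) - em_prim 2 (powF ?w) (of_nat (Suc N)))
      + (em_coeff 0 * of_nat (Suc N) powr (- ?w)
       + em_coeff 1 * ((-1) ^ 1 * pochhammer ?w 1 * of_nat (Suc N) powr (- ?w - of_nat 1))))
     \<longlonglongrightarrow> riemann_zeta ?w + (em_coeff 0 * 0 + em_coeff 1 * ((-1) ^ 1 * pochhammer ?w 1 * 0))"
    by (intro tendsto_add tendsto_mult tendsto_const riemann_zeta_em_tendsto tendsto_powr_neg_complex) auto
  also have "(\<lambda>N. ((\<Sum>j=1..Suc N. of_nat j powr (- ?w)) - em_prim 2 (powF ?w) (of_nat (Suc N)))
      + (em_coeff 0 * of_nat (Suc N) powr (- ?w)
       + em_coeff 1 * ((-1) ^ 1 * pochhammer ?w 1 * of_nat (Suc N) powr (- ?w - of_nat 1))))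
     = (\<lambda>N. complex_of_real ((\<Sum>j=1..Suc N. real j powr (- (1 / 2))) - 2 * real (Suc N) powr (1 / 2)))"
  proof
    fix N
    have p: "of_nat n powr (- ?w) = of_real (real n powr (- (1 / 2)))" "of_nat n powr (1 - ?w) = of_real (real n powr (1 / 2))" for n
      using of_nat_powr_of_real[of n "- (1 / 2)"] of_nat_powr_of_real[of n "1 / 2"] by simp_all
    have "em_prim 2 (powF ?w) (of_nat (Suc N)) = of_nat (Suc N) powr (1 - ?w) / (1 - ?w)
        + (em_coeff 0 * of_nat (Suc N) powr (- ?w)
       + em_coeff 1 * ((-1) ^ 1 * pochhammer ?w 1 * of_nat (Suc N) powr (- ?w - of_nat 1)))"
      by (simp add: em_prim_def powF_0 powF_Suc numeral_2_eq_2 del: of_nat_Suc)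
    then show "((\<Sum>j=1..Suc N. of_nat j powr (- ?w)) - em_prim 2 (powF ?w) (of_nat (Suc N)))
      + (em_coeff 0 * of_nat (Suc N) powr (- ?w)
       + em_coeff 1 * ((-1) ^ 1 * pochhammer ?w 1 * of_nat (Suc N) powr (- ?w - of_nat 1)))
      = of_real ((\<Sum>j=1..Suc N. real j powr (- (1 / 2))) - 2 * real (Suc N) powr (1 / 2))"
      unfolding p by (simp del: of_nat_Suc)
  qed
  finally have "(\<lambda>N. complex_of_real ((\<Sum>j=1..Suc N. real j powr (- (1 / 2))) - 2 * real (Suc N) powr (1 / 2))) \<longlonglongrightarrow> riemann_zeta ?w"
    by simp
  from tendsto_Re[OF this]
  have "(\<lambda>N. (\<Sum>j=1..Suc N. real j powr (- (1 / 2))) - 2 * real (Suc N) powr (1 / 2)) \<longlonglongrightarrow> Re (riemann_zeta ?w)"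
    by (simp only: Re_complex_of_real)
  then show ?thesis
    by (rule tendsto_upperbound) (use sum_inverse_sqrt_le in \<open>auto intro!: always_eventually simp: algebra_simps simp del: sum.cl_ivl_Suc of_nat_Suc\<close>)
qed

text \<open>For \<open>k > 0\<close> the point \<open>s\<close> is half an odd integer, so
  \<open>rGamma s\<close> does not vanish, and \<open>1 - s\<close> is a real number above 1, where
  the Dirichlet series has positive terms.\<close>

lemma riemann_zeta_nonzero: "riemann_zeta ((1 - 6 * of_nat k) / 2) \<noteq> 0"
proof (cases "k = 0")
  case True
  then show ?thesis using Re_zeta_half by auto
next
  case False
  define s :: complex where "s = (1 - 6 * of_nat k) / 2"
  have s: "s = of_real ((1 - 6 * real k) / 2)" by (simp add: s_def)
  have neg: "Re s < 0" using False by (simp add: s)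
  have "s \<notin> \<int>\<^sub>\<le>\<^sub>0"
  proof
    assume "s \<in> \<int>\<^sub>\<le>\<^sub>0"
    then obtain n where "s = of_int n" by (elim nonpos_Ints_cases)
    then have "complex_of_int (1 - 6 * int k) = of_int (2 * n)" by (simp add: s_def field_simps)
    then have "1 - 6 * int k = 2 * n" by (simp only: of_int_eq_iff)
    then show False by presburger
  qed
  then have "rGamma s \<noteq> 0" by (simp add: rGamma_eq_zero_iff)
  moreover have "Gamma ((1 - s) / 2) \<noteq> 0"
  proof -
    have "(1 - s) / 2 \<notin> \<int>\<^sub>\<le>\<^sub>0"
    proof
      assume "(1 - s) / 2 \<in> \<int>\<^sub>\<le>\<^sub>0"
      then have "Re ((1 - s) / 2) \<le> 0" by (elim nonpos_Ints_cases) simp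
      then show False using neg by simp
    qed
    then show ?thesis by (simp add: Gamma_eq_zero_iff)
  qed
  moreover have "riemann_zeta (1 - s) \<noteq> 0"
  proof -
    define y where "y = 1 - (1 - 6 * real k) / 2"
    have "1 - s = of_real y" by (simp add: s y_def)
    moreover have "y > 1" using False by (simp add: y_def)
    ultimately show ?thesis using zeta_real_sums(3)[of y] by auto
  qed
  moreover have "complex_of_real (2 * pi) powr (s - 1) \<noteq> 0" by simp
  ultimately have "rGamma ((1 + s) / 2) * riemann_zeta s \<noteq> 0"
    unfolding functional_equation[OF neg] by simp
  then show ?thesis by (simp add: s_def)
qed

subsection \<open>A polynomial partition of unity\<close>

text \<open>The polynomial is the upper tail of a binomial distribution: the probability of at least
  \<open>K\<close> successes in \<open>2 * K - 1\<close> trials with success probability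
  \<open>y\<close>. Exchanging success and failure gives the complementary tail, and each term of
  the tail contains \<open>y ^ K\<close>.\<close>

lemma partition_polynomial:
  fixes K :: nat
  assumes "K > 0"
  obtains N :: nat and \<kappa> :: "nat \<Rightarrow> complex" where "K \<le> N"
    and "\<And>y. (\<Sum>r=K..N. \<kappa> r * y ^ r) + (\<Sum>r=K..N. \<kappa> r * (1 - y) ^ r) = 1"
proof -
  define n where "n = 2 * K - 1"
  define P :: "complex poly" where
    "P = (\<Sum>p=K..n. smult (of_nat (n choose p)) ([:0, 1:] ^ p * [:1, -1:] ^ (n - p)))"
  have n: "K \<le> n" "n = 2 * K - 1" using assms by (auto simp: n_def)
  have P: "poly P y = (\<Sum>p=K..n. of_nat (n choose p) * y ^ p * (1 - y) ^ (n - p))" for y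
    by (simp add: P_def poly_sum mult.assoc)
  have sum1: "poly P y + poly P (1 - y) = 1" for y
  proof -
    have "poly P (1 - y) = (\<Sum>p<K. of_nat (n choose p) * y ^ p * (1 - y) ^ (n - p))"
      unfolding P
    proof (rule sum.reindex_bij_witness[of _ "\<lambda>p. n - p" "\<lambda>p. n - p"])
      fix p assume p: "p \<in> {K..n}"
      then show "of_nat (n choose (n - p)) * y ^ (n - p) * (1 - y) ^ (n - (n - p)) =
          of_nat (n choose p) * (1 - y) ^ p * (1 - (1 - y)) ^ (n - p)"
        by (simp add: binomial_symmetric[symmetric] mult_ac)
    qed (use n assms in auto)
    moreover have "(\<Sum>p<K. of_nat (n choose p) * y ^ p * (1 - y) ^ (n - p)) + poly P y
        = (\<Sum>p\<le>n. of_nat (n choose p) * y ^ p * (1 - y) ^ (n - p))"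
      unfolding P by (subst sum.union_disjoint[symmetric]) (use n in \<open>auto intro!: sum.cong\<close>)
    moreover have "\<dots> = (y + (1 - y)) ^ n" by (simp only: binomial_ring)
    ultimately show ?thesis by (simp add: add.commute)
  qed
  have dvd: "[:0, 1:] ^ K dvd P"
    unfolding P_def by (intro dvd_sum dvd_smult dvd_mult2 le_imp_power_dvd) auto
  have coeff0: "coeff P r = 0" if "r < K" for r
  proof -
    obtain q where "P = [:0, 1:] ^ K * q" using dvd by (elim dvdE)
    then have "P = monom 1 K * q" by (simp add: monom_altdef)
    then show ?thesis using that by (simp add: coeff_monom_mult)
  qed
  define N where "N = K + degree P"
  have poly: "poly P y = (\<Sum>r=K..N. coeff P r * y ^ r)" for y
  proof -
    have "poly P y = (\<Sum>r\<le>degree P. coeff P r * y ^ r)" by (simp add: poly_altdef)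
    also have "\<dots> = (\<Sum>r\<le>N. coeff P r * y ^ r)"
      by (rule sum.mono_neutral_left) (auto simp: N_def coeff_eq_0)
    also have "\<dots> = (\<Sum>r=K..N. coeff P r * y ^ r)"
      by (rule sum.mono_neutral_right) (auto simp: coeff0)
    finally show ?thesis .
  qed
  show ?thesis
    by (rule that[of N "coeff P"]) (use sum1 poly in \<open>auto simp: N_def\<close>)
qed

text \<open>Put \<open>y = 1 + u\<close> in the identity: the second sum becomes one in powers
  \<open>(- u) ^ r\<close> with \<open>r \<ge> K\<close>, so comparing coefficients of
  \<open>u ^ l\<close> for \<open>l < K\<close> leaves only the constant 1.\<close>

lemma partition_polynomial_moments:
  fixes \<kappa> :: "nat \<Rightarrow> complex"
  assumes \<kappa>: "\<And>y. (\<Sum>r=K..N. \<kappa> r * y ^ r) + (\<Sum>r=K..N. \<kappa> r * (1 - y) ^ r) = 1" and "K > 0"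
  shows "l < K \<Longrightarrow> (\<Sum>r=K..N. \<kappa> r * of_nat (r choose l)) = (if l = 0 then 1 else 0)"
proof -
  assume l: "l < K"
  define a where "a l = (\<Sum>r=K..N. \<kappa> r * of_nat (r choose l))" for l
  define b where "b l = (if l = 0 then 1 else 0) - (if K \<le> l then \<kappa> l * (-1) ^ l else 0)" for l
  have "(\<Sum>l\<le>N. a l * u ^ l) = (\<Sum>l\<le>N. b l * u ^ l)" for u
  proof -
    have "(\<Sum>l\<le>N. a l * u ^ l) = (\<Sum>r=K..N. \<kappa> r * (\<Sum>l\<le>N. of_nat (r choose l) * u ^ l))"
      unfolding a_def sum_distrib_right sum_distrib_left
      by (subst sum.swap) (simp add: mult_ac)
    also have "\<dots> = (\<Sum>r=K..N. \<kappa> r * (1 + u) ^ r)"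
    proof (intro sum.cong refl arg_cong2[where f = "(*)"])
      fix r assume "r \<in> {K..N}"
      then have "(\<Sum>l\<le>N. of_nat (r choose l) * u ^ l) = (\<Sum>l\<le>r. of_nat (r choose l) * u ^ l)"
        by (intro sum.mono_neutral_right) auto
      then show "(\<Sum>l\<le>N. of_nat (r choose l) * u ^ l) = (1 + u) ^ r"
        using binomial_ring[of u 1 r] by (simp add: add.commute)
    qed
    also have "\<dots> = 1 - (\<Sum>r=K..N. \<kappa> r * (- u) ^ r)"
      using \<kappa>[of "1 + u"] by (simp add: eq_diff_eq)
    also have "(\<Sum>r=K..N. \<kappa> r * (- u) ^ r) = (\<Sum>r\<le>N. (if K \<le> r then \<kappa> r * (-1) ^ r else 0) * u ^ r)"
      by (rule sum.mono_neutral_cong_left) (auto simp: power_minus[of u])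
    also have "1 - (\<Sum>r\<le>N. (if K \<le> r then \<kappa> r * (-1) ^ r else 0) * u ^ r)
       = (\<Sum>r\<le>N. (if r = 0 then 1 else 0) * u ^ r) - (\<Sum>r\<le>N. (if K \<le> r then \<kappa> r * (-1) ^ r else 0) * u ^ r)"
      by (simp add: sum.If_cases if_distrib[where f = "\<lambda>x. x * _"] cong: if_cong)
    finally show ?thesis
      by (simp only: b_def left_diff_distrib sum_subtractf)
  qed
  then have "\<forall>l\<le>N. a l = b l" using polyfun_eq_coeffs by blast
  moreover have "a l = b l" if "l > N"
  proof -
    have "a l = 0" unfolding a_def using that by (intro sum.neutral) auto
    moreover have "N \<ge> K"
    proof (rule ccontr)
      assume "\<not> K \<le> N"
      then show False using \<kappa>[of 0] by simp
    qed
    ultimately show ?thesis using that l by auto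
  qed
  ultimately have "a l = b l" using not_le by blast
  then show ?thesis using l by (simp add: a_def b_def)
qed

text \<open>Vandermonde's convolution turns the sum into moments, of which only the zeroth survives.
  In effect the cut-off leaves the first \<open>K\<close> Taylor coefficients of
  \<open>(1 - y) powr (- s)\<close> at 0 unchanged.\<close>

lemma partition_polynomial_pochhammer:
  fixes \<kappa> :: "nat \<Rightarrow> complex"
  assumes \<kappa>: "\<And>y. (\<Sum>r=K..N. \<kappa> r * y ^ r) + (\<Sum>r=K..N. \<kappa> r * (1 - y) ^ r) = 1" and "m < K"
  shows "(\<Sum>r=K..N. \<kappa> r * pochhammer (s - of_nat r) m) = pochhammer s m"
proof -
  have K: "K > 0" using assms by auto
  have poch: "pochhammer (- of_nat r :: complex) i = (-1) ^ i * fact i * of_nat (r choose i)" for r i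
    by (simp add: binomial_gbinomial gbinomial_pochhammer flip: power_add)
  have "(\<Sum>r=K..N. \<kappa> r * pochhammer (s - of_nat r) m)
     = (\<Sum>r=K..N. \<kappa> r * (\<Sum>k\<le>m. of_nat (m choose k) * pochhammer s k * pochhammer (- of_nat r) (m - k)))"
    using pochhammer_binomial_sum[of s "- of_nat _" m] by simp
  also have "\<dots> = (\<Sum>k\<le>m. of_nat (m choose k) * pochhammer s k * ((-1) ^ (m - k) * fact (m - k)) * (\<Sum>r=K..N. \<kappa> r * of_nat (r choose (m - k))))"
    unfolding sum_distrib_left poch by (subst sum.swap) (simp add: mult_ac)
  also have "\<dots> = (\<Sum>k\<le>m. if k = m then pochhammer s k else 0)"
  proof (intro sum.cong refl)
    fix k assume "k \<in> {..m}"
    then show "of_nat (m choose k) * pochhammer s k * ((-1) ^ (m - k) * fact (m - k)) * (\<Sum>r=K..N. \<kappa> r * of_nat (r choose (m - k)))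
        = (if k = m then pochhammer s k else 0)"
      using partition_polynomial_moments[OF \<kappa> K, of "m - k"] assms by auto
  qed
  finally show ?thesis by simp
qed

subsection \<open>Iterated derivatives of products\<close>

definition leib :: "(nat \<Rightarrow> complex \<Rightarrow> complex) \<Rightarrow> (nat \<Rightarrow> complex \<Rightarrow> complex) \<Rightarrow> nat \<Rightarrow> complex \<Rightarrow> complex" where
  "leib f h i x = (\<Sum>l\<le>i. of_nat (i choose l) * f (i - l) x * h l x)"

lemma sum_binomial_Suc:
  fixes a :: "nat \<Rightarrow> 'a :: comm_semiring_1"
  shows "(\<Sum>l\<le>Suc k. of_nat (Suc k choose l) * a l)
       = (\<Sum>l\<le>k. of_nat (k choose l) * a l) + (\<Sum>l\<le>k. of_nat (k choose l) * a (Suc l))"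
proof -
  have "(\<Sum>l\<le>k. of_nat (k choose l) * a l) = (\<Sum>l\<le>Suc k. of_nat (k choose l) * a l)" by (simp add: binomial_eq_0)
  also have "\<dots> = a 0 + (\<Sum>l\<le>k. of_nat (k choose Suc l) * a (Suc l))"
    by (subst sum.atMost_Suc_shift) simp
  finally show ?thesis
    by (subst sum.atMost_Suc_shift) (simp add: distrib_right sum.distrib add_ac)
qed

lemma has_field_derivative_leib:
  assumes "\<And>i. i \<le> k \<Longrightarrow> (f i has_field_derivative f (Suc i) x) (at x)"
    and "\<And>i. i \<le> k \<Longrightarrow> (h i has_field_derivative h (Suc i) x) (at x)"
  shows "(leib f h k has_field_derivative leib f h (Suc k) x) (at x)"
proof -
  have "(leib f h k has_field_derivative
     (\<Sum>l\<le>k. of_nat (k choose l) * (f (Suc (k - l)) x * h l x + h (Suc l) x * f (k - l) x))) (at x)"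
    unfolding leib_def mult.assoc
    by (intro DERIV_sum DERIV_cmult DERIV_mult assms) auto
  also have "(\<Sum>l\<le>k. of_nat (k choose l) * (f (Suc (k - l)) x * h l x + h (Suc l) x * f (k - l) x))
     = (\<Sum>l\<le>k. of_nat (k choose l) * (f (Suc k - l) x * h l x))
     + (\<Sum>l\<le>k. of_nat (k choose l) * (f (Suc k - Suc l) x * h (Suc l) x))"
    by (simp add: distrib_left sum.distrib Suc_diff_le mult_ac)
  also have "\<dots> = leib f h (Suc k) x"
    using sum_binomial_Suc[of k "\<lambda>l. f (Suc k - l) x * h l x"] by (simp add: leib_def mult.assoc del: sum.atMost_Suc binomial_Suc_Suc)
  finally show ?thesis .
qed

text \<open>Two closed forms for all iterated derivatives can thus be matched by comparing order 0
  alone.\<close>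

lemma derivative_sequence_unique:
  fixes a b :: "nat \<Rightarrow> complex \<Rightarrow> complex"
  assumes "open S" "\<And>x. x \<in> S \<Longrightarrow> a 0 x = b 0 x"
    and "\<And>i x. x \<in> S \<Longrightarrow> (a i has_field_derivative a (Suc i) x) (at x)"
    and "\<And>i x. x \<in> S \<Longrightarrow> (b i has_field_derivative b (Suc i) x) (at x)"
    and "x \<in> S"
  shows "a i x = b i x"
  using assms(5)
proof (induction i arbitrary: x)
  case (Suc i)
  have "(b i has_field_derivative a (Suc i) x) (at x)"
    using assms(3)[OF Suc.prems] assms(1) Suc.prems Suc.IH by (rule has_field_derivative_transform_within_open)
  then show ?case using assms(4)[OF Suc.prems] DERIV_unique by blast
qed (use assms in auto)

lemma norm_leib_le:
  assumes "\<And>l. l \<le> i \<Longrightarrow> norm (f (i - l) x * h l x) \<le> B"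
  shows "norm (leib f h i x) \<le> 2 ^ i * B"
proof -
  have "norm (leib f h i x) \<le> (\<Sum>l\<le>i. real (i choose l) * B)"
    unfolding leib_def mult.assoc
    by (intro sum_norm_le) (auto simp: norm_mult[of "of_nat _"] intro!: mult_left_mono assms)
  also have "\<dots> = 2 ^ i * B"
    by (simp flip: sum_distrib_right of_nat_sum add: choose_row_sum)
  finally show ?thesis .
qed

text \<open>The polynomial \<open>\<chi> y = (\<Sum>r=K..N. \<kappa> r * (1 - y) ^ r)\<close> is a smooth cut-off: it is \<open>1 + O(y ^ K)\<close> at \<open>0\<close>,
  vanishes to order \<open>K\<close> at \<open>1\<close>, and \<open>\<chi> y + \<chi> (1 - y) = 1\<close>. By symmetry
  \<open>(\<Sum>j<n. (j * (n - j)) powr (- s))\<close> is twice the sum weighted by \<open>\<chi> (j / n)\<close>, which is singular only at \<open>j = 0\<close>.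
  Below, \<open>V i\<close>, \<open>T i\<close> and \<open>U i\<close> are the \<open>i\<close>-th derivatives of \<open>\<chi> y * (1 - y) powr (- s)\<close>, of its Taylor polynomial
  of degree \<open>M - 1\<close> at \<open>0\<close>, and of their difference; \<open>Q\<close> bounds all Pochhammer symbols that occur.\<close>

locale tornheim =
  fixes L M R K N :: nat and \<kappa> :: "nat \<Rightarrow> complex" and s :: complex
  assumes M: "M \<ge> 1" and R: "R = M + L + 2" and K: "K = R + L + M + 2" and KN: "K \<le> N"
    and \<kappa>: "\<And>y. (\<Sum>r=K..N. \<kappa> r * y ^ r) + (\<Sum>r=K..N. \<kappa> r * (1 - y) ^ r) = 1"
    and s: "- real L \<le> Re s" "Re s \<le> 3 / 4"
begin

definition A :: real where "A = (\<Sum>r=K..N. norm (\<kappa> r))"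
definition Q :: real where "Q = (norm s + real (N + R)) ^ R"

definition V :: "nat \<Rightarrow> complex \<Rightarrow> complex" where
  "V i y = (\<Sum>r=K..N. \<kappa> r * pochhammer (s - of_nat r) i * (1 - y) powr (of_nat r - s - of_nat i))"

definition T :: "nat \<Rightarrow> complex \<Rightarrow> complex" where
  "T i y = (\<Sum>l<M - i. pochhammer s (i + l) / fact l * y ^ l)"

definition U :: "nat \<Rightarrow> complex \<Rightarrow> complex" where
  "U i y = V i y - T i y"

lemma Q_ge_1: "Q \<ge> 1"
  unfolding Q_def using R by (intro one_le_power) (auto intro: add_increasing)

lemma A_ge_0: "A \<ge> 0"
  unfolding A_def by (intro sum_nonneg) auto

lemma Q_ge:
  fixes w :: complex
  assumes "norm w \<le> norm s + real N" "k \<le> R"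
  shows "norm (pochhammer w k) \<le> Q"
proof -
  have "norm (pochhammer w k) \<le> (norm w + real R) ^ R"
    by (rule norm_pochhammer_le') (use assms R in auto)
  also have "\<dots> \<le> Q" unfolding Q_def using assms by (intro power_mono) auto
  finally show ?thesis .
qed

lemma pochhammer_s_le: "k \<le> R \<Longrightarrow> norm (pochhammer s k) \<le> Q"
  by (rule Q_ge) auto

lemma V_deriv:
  assumes "Re y < 1"
  shows "(V i has_field_derivative V (Suc i) y) (at y)"
proof -
  have y: "1 - y \<notin> \<real>\<^sub>\<le>\<^sub>0" using assms by (auto simp: complex_nonpos_Reals_iff)
  have "((\<lambda>y. (1 - y) powr (of_nat r - s - of_nat i)) has_field_derivative
         (s - of_nat r + of_nat i) * (1 - y) powr (of_nat r - s - of_nat (Suc i))) (at y)" for r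
    using y by (auto intro!: derivative_eq_intros simp: algebra_simps)
  then have "(V i has_field_derivative
    (\<Sum>r=K..N. \<kappa> r * pochhammer (s - of_nat r) i * ((s - of_nat r + of_nat i) * (1 - y) powr (of_nat r - s - of_nat (Suc i))))) (at y)"
    unfolding V_def[abs_def] by (intro DERIV_sum DERIV_cmult)
  then show ?thesis by (simp add: V_def pochhammer_Suc mult.assoc)
qed

lemma T_deriv: "(T i has_field_derivative T (Suc i) y) (at y)"
proof (cases "M - i")
  case 0
  then show ?thesis by (simp add: T_def[abs_def])
next
  case (Suc n)
  then have n: "M - Suc i = n" by simp
  have 1: "pochhammer s (i + Suc l) / fact (Suc l) * (of_nat (Suc l) * y ^ (Suc l - 1)) = pochhammer s (Suc i + l) / fact l * y ^ l" for l
    by (simp add: divide_simps del: of_nat_Suc)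
  have "(T i has_field_derivative (\<Sum>l<Suc n. pochhammer s (i + l) / fact l * (of_nat l * y ^ (l - 1)))) (at y)"
    unfolding T_def[abs_def] Suc
    by (intro DERIV_sum DERIV_cmult) (auto intro!: derivative_eq_intros)
  also have "(\<Sum>l<Suc n. pochhammer s (i + l) / fact l * (of_nat l * y ^ (l - 1))) = T (Suc i) y"
    unfolding T_def n sum.lessThan_Suc_shift using 1 by simp
  finally show ?thesis .
qed

lemma U_deriv: "Re y < 1 \<Longrightarrow> (U i has_field_derivative U (Suc i) y) (at y)"
  unfolding U_def[abs_def] by (intro DERIV_diff V_deriv T_deriv)

lemma V_0: "m < K \<Longrightarrow> V m 0 = pochhammer s m"
  using partition_polynomial_pochhammer[OF \<kappa>] by (simp add: V_def)

text \<open>This fixes the choice of \<open>K\<close>: after at most \<open>R\<close> derivatives,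
  and with \<open>Re s \<le> 3 / 4\<close>, each power of \<open>1 - y\<close> still has real
  exponent at least \<open>K - R - 3 / 4\<close>, which exceeds \<open>L + M + 1\<close>.\<close>

lemma V_bound:
  assumes y: "0 \<le> y" "y \<le> 1" and i: "i \<le> R"
  shows "norm (V i (of_real y)) \<le> A * Q * (1 - y) ^ (L + M + 1)"
proof -
  have "norm (V i (of_real y)) \<le> (\<Sum>r=K..N. norm (\<kappa> r) * (Q * (1 - y) ^ (L + M + 1)))"
    unfolding V_def
  proof (intro sum_norm_le)
    fix r assume r: "r \<in> {K..N}"
    have "norm ((1 - of_real y :: complex) powr (of_nat r - s - of_nat i)) = (1 - y) powr (real r - Re s - real i)"
      using norm_of_real_powr[of "1 - y"] y by simp
    also have "\<dots> \<le> (1 - y) powr (real (L + M + 1))"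
      using y r i s K by (intro powr_mono') auto
    also have "\<dots> = (1 - y) ^ (L + M + 1)"
      by (rule powr_realpow') (use y in auto)
    finally have 1: "norm ((1 - of_real y :: complex) powr (of_nat r - s - of_nat i)) \<le> (1 - y) ^ (L + M + 1)" .
    have "norm (s - of_nat r) \<le> norm s + real N"
      using norm_triangle_ineq4[of s "of_nat r"] r by simp
    then have 2: "norm (pochhammer (s - of_nat r) i) \<le> Q" using i by (intro Q_ge)
    show "norm (\<kappa> r * pochhammer (s - of_nat r) i * (1 - of_real y) powr (of_nat r - s - of_nat i))
        \<le> norm (\<kappa> r) * (Q * (1 - y) ^ (L + M + 1))"
      unfolding norm_mult mult.assoc
      by (intro mult_left_mono mult_mono 1 2) (use Q_ge_1 in auto)
  qed
  then show ?thesis by (simp add: A_def sum_distrib_right mult.assoc)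
qed

lemma V_bound':
  assumes y: "0 \<le> y" "y \<le> 1" and i: "i \<le> R"
  shows "norm (V i (of_real y)) \<le> A * Q"
proof -
  have "A * Q * (1 - y) ^ (L + M + 1) \<le> A * Q * 1"
    using y A_ge_0 Q_ge_1 by (intro mult_left_mono power_le_one) auto
  then show ?thesis using V_bound[OF assms] by simp
qed

text \<open>The weight \<open>y ^ i\<close> lets one bound serve every order. For
  \<open>i < M\<close> it is Taylor's theorem, as \<open>V\<close> and \<open>T\<close> share their
  Taylor coefficients at 0; for \<open>i \<ge> M\<close> the polynomial part is gone and
  \<open>y ^ i \<le> y ^ M\<close>.\<close>

lemma U_bound:
  assumes y: "0 \<le> y" "y < 1" and i: "i \<le> R"
  shows "norm (U i (of_real y)) * y ^ i \<le> A * Q * y ^ M"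
proof (cases "i < M")
  case True
  let ?S = "closed_segment 0 (of_real y) :: complex set"
  have S: "?S = of_real ` {0..y}"
    using y by (subst of_real_0[symmetric], subst closed_segment_of_real) (simp add: closed_segment_eq_real_ivl)
  define n where "n = M - i - 1"
  have n: "i + Suc n = M" using True by (simp add: n_def)
  have "norm (V (i + 0) (of_real y) - (\<Sum>l\<le>n. V (i + l) 0 * (of_real y - 0) ^ l / fact l))
       \<le> (A * Q) * norm (of_real y - 0 :: complex) ^ Suc n / fact n"
  proof (rule complex_Taylor[where S = ?S and f = "\<lambda>l. V (i + l)"])
    fix l x assume "x \<in> ?S" "l \<le> n"
    then have "Re x < 1" using y unfolding S by auto
    then show "(V (i + l) has_field_derivative V (i + Suc l) x) (at x within ?S)"
      unfolding add_Suc_right by (rule has_field_derivative_at_within[OF V_deriv])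
  next
    fix x assume "x \<in> ?S"
    then obtain t where t: "x = of_real t" "0 \<le> t" "t \<le> y" unfolding S by auto
    have "i + Suc n \<le> R" using n R by simp
    then show "norm (V (i + Suc n) x) \<le> A * Q"
      unfolding t(1) using t y by (intro V_bound') simp_all
  qed auto
  also have "V (i + 0) (of_real y) - (\<Sum>l\<le>n. V (i + l) 0 * (of_real y - 0) ^ l / fact l) = U i (of_real y)"
  proof -
    have "(\<Sum>l\<le>n. V (i + l) 0 * (of_real y - 0) ^ l / fact l) = T i (of_real y)"
      unfolding T_def lessThan_Suc_atMost[symmetric]
    proof (intro sum.cong)
      show "{..<Suc n} = {..<M - i}" using n by auto
      fix l assume "l \<in> {..<M - i}"
      then have "i + l < K" using K by simp
      then show "V (i + l) 0 * (of_real y - 0) ^ l / fact l = pochhammer s (i + l) / fact l * of_real y ^ l"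
        by (simp add: V_0)
    qed
    then show ?thesis by (simp add: U_def)
  qed
  also have "(A * Q) * norm (of_real y - 0 :: complex) ^ Suc n / fact n \<le> (A * Q) * y ^ Suc n"
  proof -
    have "(A * Q) * y ^ Suc n / fact n \<le> (A * Q) * y ^ Suc n / 1"
      using y A_ge_0 Q_ge_1 by (intro divide_left_mono fact_ge_1 mult_nonneg_nonneg) auto
    then show ?thesis using y by simp
  qed
  finally have "norm (U i (of_real y)) * y ^ i \<le> (A * Q) * y ^ Suc n * y ^ i"
    using y by (intro mult_right_mono) auto
  also have "\<dots> = A * Q * y ^ M" by (simp add: power_add mult_ac flip: n)
  finally show ?thesis .
next
  case False
  then have "U i (of_real y) = V i (of_real y)" by (simp add: U_def T_def)
  then have "norm (U i (of_real y)) \<le> A * Q" using y i by (simp add: V_bound')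
  moreover have "y ^ i \<le> y ^ M" using y False by (intro power_decreasing) auto
  ultimately show ?thesis using y A_ge_0 Q_ge_1 by (intro mult_mono) auto
qed

section \<open>Derivatives of \<open>x powr (- s)\<close> times the rescaled cut-off factor\<close>

definition fs :: "nat \<Rightarrow> complex \<Rightarrow> complex" where "fs k = powF s (Suc k)"

text \<open>If \<open>h\<close> lists the derivatives of \<open>h 0\<close>, this lists those of
  \<open>x \<mapsto> h 0 (x / n)\<close>, the power of \<open>n\<close> being the chain-rule
  factor.\<close>

definition sc :: "real \<Rightarrow> (nat \<Rightarrow> complex \<Rightarrow> complex) \<Rightarrow> nat \<Rightarrow> complex \<Rightarrow> complex" where
  "sc n h l x = h l (x / of_real n) / of_real n ^ l"

lemma s_neq_1: "s \<noteq> 1" using s by auto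

lemma sc_deriv:
  assumes "n > 0" "(h l has_field_derivative h (Suc l) (x / of_real n)) (at (x / of_real n))"
  shows "(sc n h l has_field_derivative sc n h (Suc l) x) (at x)"
proof -
  have "((\<lambda>x. h l (x / of_real n)) has_field_derivative h (Suc l) (x / of_real n) * (1 / of_real n)) (at x)"
    by (rule DERIV_chain2[where g = "\<lambda>x. x / of_real n", OF assms(2)]) (use assms(1) in \<open>auto intro!: derivative_eq_intros\<close>)
  then have "((\<lambda>x. h l (x / of_real n) / of_real n ^ l) has_field_derivative
      h (Suc l) (x / of_real n) * (1 / of_real n) / of_real n ^ l) (at x)"
    by (rule DERIV_cdivide)
  then show ?thesis by (simp add: sc_def[abs_def])
qed

lemma fs_deriv: "Re x > 0 \<Longrightarrow> (fs k has_field_derivative fs (Suc k) x) (at x)"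
  unfolding fs_def by (intro has_field_derivative_powF s_neq_1)

lemma norm_fs:
  assumes "x > 0" "k \<le> R"
  shows "norm (fs k (of_real x)) \<le> Q * x powr (- Re s - k)"
  using assms pochhammer_s_le[of k] by (simp add: fs_def norm_powF_Suc mult_right_mono)

definition g :: "real \<Rightarrow> nat \<Rightarrow> complex \<Rightarrow> complex" where
  "g n = leib fs (sc n U)"

lemma g_deriv:
  assumes "n > 0" "0 < Re x" "Re x < n"
  shows "(g n i has_field_derivative g n (Suc i) x) (at x)"
  unfolding g_def
  by (intro has_field_derivative_leib fs_deriv sc_deriv U_deriv) (use assms in auto)

text \<open>In each Leibniz term the factor \<open>x ^ l\<close> missing from the derivatives taken
  off \<open>fs\<close> meets \<open>1 / n ^ l\<close> from \<open>sc\<close>. Together they are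
  \<open>(x / n) ^ l\<close>, exactly the weight in \<open>U_bound\<close>, so all terms obey the
  same estimate.\<close>

lemma g_bound:
  assumes "0 < x" "x < n" "i \<le> R"
  shows "norm (g n i (of_real x)) \<le> 2 ^ i * (A * Q ^ 2 * x powr (- Re s - i) * (x / n) ^ M)"
  unfolding g_def
proof (rule norm_leib_le)
  fix l assume l: "l \<le> i"
  have "norm (fs (i - l) (of_real x) * sc n U l (of_real x))
     = norm (fs (i - l) (of_real x)) * (norm (U l (of_real (x / n))) / n ^ l)"
    using assms by (simp add: norm_mult sc_def norm_divide norm_power)
  also have "\<dots> \<le> Q * x powr (- Re s - real (i - l)) * (norm (U l (of_real (x / n))) / n ^ l)"
    using assms l by (intro mult_right_mono norm_fs) auto
  also have "x powr (- Re s - real (i - l)) = x powr (- Re s - i) * x ^ l"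
    using assms l by (simp add: of_nat_diff powr_realpow[symmetric] powr_add[symmetric] algebra_simps)
  also have "Q * (x powr (- Re s - i) * x ^ l) * (norm (U l (of_real (x / n))) / n ^ l)
     = Q * x powr (- Re s - i) * (norm (U l (of_real (x / n))) * (x / n) ^ l)"
    by (simp add: power_divide)
  also have "\<dots> \<le> Q * x powr (- Re s - i) * (A * Q * (x / n) ^ M)"
    using assms l Q_ge_1 by (intro mult_left_mono U_bound) auto
  finally show "norm (fs (i - l) (of_real x) * sc n U l (of_real x)) \<le> A * Q ^ 2 * x powr (- Re s - i) * (x / n) ^ M"
    by (simp add: power2_eq_square mult_ac)
qed

text \<open>\<open>x powr (- s)\<close> times the Taylor polynomial in \<open>x / n\<close> is a
  finite sum of powers with exponent \<open>m - s\<close>, whose derivatives \<open>powF\<close>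
  lists. These are the terms that will sum to zeta values.\<close>

lemma leib_fs_T:
  assumes "n > 0" "Re x > 0"
  shows "leib fs (sc n T) i x = (\<Sum>m<M. pochhammer s m / fact m / of_real n ^ m * powF (s - of_nat m) (Suc i) x)"
proof (rule derivative_sequence_unique[where S = "{x. Re x > 0}" and a = "leib fs (sc n T)"
      and b = "\<lambda>i x. \<Sum>m<M. pochhammer s m / fact m / of_real n ^ m * powF (s - of_nat m) (Suc i) x"])
  show "open {x. Re x > 0}" by (rule open_halfspace_Re_gt)
  show "x \<in> {x. Re x > 0}" using assms by simp
next
  fix x :: complex assume x: "x \<in> {x. Re x > 0}"
  then have "x \<noteq> 0" by auto
  then have "fs 0 x * (x / of_real n) ^ m = x powr (- (s - of_nat m)) / of_real n ^ m" for m
  proof -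
    have "x powr (- (s - of_nat m)) = x powr (- s + of_nat m)" by simp
    also have "\<dots> = x powr (- s) * x ^ m"
      using \<open>x \<noteq> 0\<close> by (simp only: powr_add powr_nat if_False)
    finally show ?thesis by (simp add: fs_def powF_def power_divide)
  qed
  then have "pochhammer s m / fact m * (fs 0 x * (x / of_real n) ^ m) = pochhammer s m / fact m / of_real n ^ m * powF (s - of_nat m) (Suc 0) x" for m
    by (simp add: powF_def)
  then show "leib fs (sc n T) 0 x = (\<Sum>m<M. pochhammer s m / fact m / of_real n ^ m * powF (s - of_nat m) (Suc 0) x)"
    by (simp add: leib_def sc_def T_def sum_distrib_left mult_ac)
next
  fix i and x :: complex assume x: "x \<in> {x. Re x > 0}"
  show "(leib fs (sc n T) i has_field_derivative leib fs (sc n T) (Suc i) x) (at x)"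
    by (intro has_field_derivative_leib fs_deriv sc_deriv T_deriv) (use x assms in auto)
  have "s - of_nat m \<noteq> 1" for m
  proof
    assume "s - of_nat m = 1"
    then have "Re (s - of_nat m) = 1" by simp
    then show False using s by simp
  qed
  then show "((\<lambda>x. \<Sum>m<M. pochhammer s m / fact m / of_real n ^ m * powF (s - of_nat m) (Suc i) x) has_field_derivative
     (\<Sum>m<M. pochhammer s m / fact m / of_real n ^ m * powF (s - of_nat m) (Suc (Suc i)) x)) (at x)"
    by (intro DERIV_sum DERIV_cmult has_field_derivative_powF) (use x in auto)
qed

lemma leib_fs_V:
  assumes "n > 0" "Re x > 0"
  shows "leib fs (sc n V) i x = g n i x + (\<Sum>m<M. pochhammer s m / fact m / of_real n ^ m * powF (s - of_nat m) (Suc i) x)"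
  unfolding leib_fs_T[OF assms, symmetric] g_def
  by (simp add: leib_def sc_def U_def ring_distribs diff_divide_distrib sum_subtractf)

end

section \<open>Integrals of the cut-off Beta integrand and its Taylor remainder\<close>

lemma integrable_bounded_Ioo:
  fixes f :: "real \<Rightarrow> complex"
  assumes "continuous_on {a<..<b} f" "\<And>x. x \<in> {a<..<b} \<Longrightarrow> norm (f x) \<le> B"
  shows "f integrable_on {a..b}"
proof -
  have "f integrable_on {a<..<b}"
  proof (rule measurable_bounded_by_integrable_imp_integrable[where g = "\<lambda>_. B"])
    show "f \<in> borel_measurable (lebesgue_on {a<..<b})"
      using assms(1) by (rule continuous_imp_measurable_on_sets_lebesgue) auto
    have "(\<lambda>_. B) integrable_on box a b" by (subst integrable_on_open_interval) auto
    then show "(\<lambda>_. B) integrable_on {a<..<b}" by simp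
  qed (use assms in auto)
  then have "f integrable_on box a b" by simp
  then show ?thesis by (subst (asm) integrable_on_open_interval) simp
qed

lemma of_real_powr_mult:
  assumes "x \<ge> 0" "y \<ge> 0"
  shows "complex_of_real (x * y) powr z = of_real x powr z * of_real y powr z"
  using powr_times_real[of "of_real x" "of_real y" z] assms by simp

lemma has_integral_complex_powr:
  assumes "c > 0" "Re w > -1"
  shows "((\<lambda>y. complex_of_real y powr w) has_integral of_real c powr (w + 1) / (w + 1)) {0..c}"
proof -
  have w: "w + 1 \<noteq> 0" using assms by (auto simp: add_eq_0_iff2)
  have "((\<lambda>y. complex_of_real y powr w) has_integral
     (of_real c powr (w + 1) / (w + 1) - of_real 0 powr (w + 1) / (w + 1))) {0..c}"
  proof (rule fundamental_theorem_of_calculus_interior)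
    show "continuous_on {0..c} (\<lambda>y. complex_of_real y powr (w + 1) / (w + 1))"
      using assms w by (intro continuous_intros) auto
    fix y assume y: "y \<in> {0<..<c}"
    have "((\<lambda>y. y powr (w + 1) / (w + 1)) has_field_derivative (of_real y) powr w) (at (complex_of_real y))"
      using y w by (auto intro!: derivative_eq_intros simp: complex_nonpos_Reals_iff)
    then show "((\<lambda>y. complex_of_real y powr (w + 1) / (w + 1)) has_vector_derivative of_real y powr w) (at y)"
      by (rule has_vector_derivative_real_field)
  qed (use assms in auto)
  then show ?thesis by simp
qed

context tornheim
begin

definition psi_rem :: "real \<Rightarrow> complex" where "psi_rem y = of_real y powr (- s) * U 0 (of_real y)"
text \<open>The part of the Beta integrand \<open>(y * (1 - y)) powr (- s)\<close> that the cut-off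
  assigns to the endpoint 0. \<open>psi_rem\<close> is what is left after removing its first
  \<open>M\<close> terms there.\<close>

definition psi :: "real \<Rightarrow> complex" where "psi y = of_real y powr (- s) * V 0 (of_real y)"

lemma g_0: "g n 0 x = x powr (- s) * U 0 (x / of_real n)"
  by (simp add: g_def leib_def fs_def powF_def sc_def)

lemma norm_psi_rem_le:
  assumes "0 \<le> y" "y < 1"
  shows "norm (psi_rem y) \<le> A * Q * y powr (real M - Re s)"
proof (cases "y = 0")
  case False
  then have y: "y > 0" using assms by simp
  have "norm (psi_rem y) = y powr (- Re s) * norm (U 0 (of_real y))"
    using assms by (simp add: psi_rem_def norm_mult norm_of_real_powr)
  also have "\<dots> \<le> y powr (- Re s) * (A * Q * y ^ M)"
    using U_bound[of y 0] assms by (intro mult_left_mono) auto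
  also have "\<dots> = A * Q * y powr (real M - Re s)"
    using y by (simp add: powr_realpow[symmetric] powr_add[symmetric])
  finally show ?thesis .
qed (use A_ge_0 Q_ge_1 in \<open>simp add: psi_rem_def\<close>)

lemma norm_psi_rem_le':
  assumes "0 \<le> y" "y \<le> c" "c < 1"
  shows "norm (psi_rem y) \<le> A * Q * c powr (real M - Re s)"
proof -
  have "norm (psi_rem y) \<le> A * Q * y powr (real M - Re s)" using assms by (intro norm_psi_rem_le) auto
  also have "\<dots> \<le> A * Q * c powr (real M - Re s)"
    using assms M s A_ge_0 Q_ge_1 by (intro mult_left_mono powr_mono2) auto
  finally show ?thesis .
qed

lemma continuous_on_psi_rem: "continuous_on {0<..<1} psi_rem"
proof -
  have "isCont psi_rem y" if "0 < y" "y < 1" for y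
  proof -
    have "isCont (g 1 0) (of_real y)"
      by (rule DERIV_isCont[OF g_deriv]) (use that in auto)
    then have "isCont (\<lambda>x. g 1 0 (of_real x)) y" 
      by (rule isCont_o2[where f = complex_of_real, rotated]) (rule continuous_of_real, rule continuous_ident)
    then show ?thesis by (simp add: g_0 psi_rem_def[abs_def])
  qed
  then show ?thesis by (intro continuous_at_imp_continuous_on) auto
qed

lemma integrable_psi_rem: "psi_rem integrable_on {0..1}"
proof (rule integrable_bounded_Ioo[OF continuous_on_psi_rem])
  fix x :: real assume x: "x \<in> {0<..<1}"
  have "norm (psi_rem x) \<le> A * Q * x powr (real M - Re s)" using x by (intro norm_psi_rem_le) auto
  also have "x powr (real M - Re s) \<le> 1 powr (real M - Re s)"
    using x s M by (intro powr_mono2) auto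
  finally show "norm (psi_rem x) \<le> A * Q * 1 powr (real M - Re s)" using A_ge_0 Q_ge_1 by (simp add: mult_left_mono)
qed

lemma integral_psi_rem_le:
  assumes "0 < c" "c < 1"
  shows "norm (integral {0..c} psi_rem) \<le> A * Q * c powr (real M - Re s) * c"
proof -
  have "psi_rem integrable_on cbox 0 c"
    using integrable_psi_rem assms by (auto intro: integrable_on_subinterval)
  then have "norm (integral {0..c} psi_rem) \<le> A * Q * c powr (real M - Re s) * measure lborel (cbox 0 c)"
    using A_ge_0 Q_ge_1 assms norm_psi_rem_le' by (intro has_integral_bound[of _ psi_rem]) (auto dest: integrable_integral)
  then show ?thesis using assms by simp
qed

lemma power_integral:
  assumes "c > 0"
  shows "((\<lambda>y. of_real y powr (of_nat m - s)) has_integral powF (s - of_nat m) 0 (of_real c)) {0..c}"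
  using has_integral_complex_powr[of c "of_nat m - s"] assms s by (simp add: powF_def algebra_simps)

lemma psi_eq: "0 \<le> y \<Longrightarrow> psi y = psi_rem y + (\<Sum>m<M. pochhammer s m / fact m * of_real y powr (of_nat m - s))"
proof (cases "y = 0")
  assume "0 \<le> y" "y \<noteq> 0"
  then have y: "complex_of_real y \<noteq> 0" by simp
  have "of_real y powr (of_nat m - s) = of_real y ^ m * of_real y powr (- s)" for m
    using y by (metis (no_types) powr_add powr_nat diff_conv_add_uminus)
  then show ?thesis
    by (simp add: psi_def psi_rem_def U_def T_def ring_distribs sum_distrib_left mult_ac)
qed (simp add: psi_def psi_rem_def)

lemma psi_integral:
  assumes "0 < c" "c \<le> 1"
  shows "(psi has_integral integral {0..c} psi_rem + (\<Sum>m<M. pochhammer s m / fact m * powF (s - of_nat m) 0 (of_real c))) {0..c}"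
proof -
  have "psi_rem integrable_on {0..c}"
    using integrable_psi_rem assms by (auto intro: integrable_on_subinterval)
  then have "((\<lambda>y. psi_rem y + (\<Sum>m<M. pochhammer s m / fact m * of_real y powr (of_nat m - s))) has_integral 
     integral {0..c} psi_rem + (\<Sum>m<M. pochhammer s m / fact m * powF (s - of_nat m) 0 (of_real c))) {0..c}"
    using assms by (intro has_integral_add has_integral_sum has_integral_mult_right power_integral integrable_integral) auto
  then show ?thesis
    by (rule has_integral_eq[rotated]) (simp add: psi_eq)
qed

lemma norm_psi_le:
  assumes "1 / 2 \<le> y" "y \<le> 1"
  shows "norm (psi y) \<le> 2 * (A * Q) * (1 - y) ^ (L + M + 1)"
proof -
  have "norm (psi y) = y powr (- Re s) * norm (V 0 (of_real y))"
    using assms by (simp add: psi_def norm_mult norm_of_real_powr)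
  also have "\<dots> \<le> 2 * (A * Q * (1 - y) ^ (L + M + 1))"
  proof (rule mult_mono)
    have "y powr (- Re s) \<le> y powr (- 1)"
      using assms s by (intro powr_mono') auto
    also have "\<dots> \<le> 2" using assms by (simp add: powr_minus divide_simps)
    finally show "y powr (- Re s) \<le> 2" .
  qed (use assms V_bound[of y 0] in auto)
  finally show ?thesis by simp
qed

text \<open>Applied at \<open>c = 1 - 1 / n\<close>, the power \<open>L + M + 2\<close> absorbs the
  factor \<open>n powr (1 - Re s)\<close>, which may be as large as \<open>n ^ (L + 1)\<close>, and
  still leaves \<open>1 / n ^ M\<close>.\<close>

lemma integral_psi_tail:
  assumes "1 / 2 \<le> c" "c < 1"
  shows "norm (integral {0..1} psi - integral {0..c} psi) \<le> 2 * (A * Q) * (1 - c) ^ (L + M + 2)"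
proof -
  have int: "psi integrable_on {0..1}" using psi_integral[of 1] by auto
  then have int': "psi integrable_on cbox c 1"
    using assms by (auto intro: integrable_on_subinterval)
  have "integral {0..1} psi = integral {0..c} psi + integral {c..1} psi"
    using assms by (intro Henstock_Kurzweil_Integration.integral_combine[symmetric] int) auto
  moreover have "norm (integral {c..1} psi) \<le> 2 * (A * Q) * (1 - c) ^ (L + M + 1) * measure lborel (cbox c 1)"
  proof (rule has_integral_bound[of _ psi])
    fix y assume "y \<in> cbox c 1"
    then have y: "c \<le> y" "y \<le> 1" by auto
    have "norm (psi y) \<le> 2 * (A * Q) * (1 - y) ^ (L + M + 1)" using y assms by (intro norm_psi_le) auto
    also have "\<dots> \<le> 2 * (A * Q) * (1 - c) ^ (L + M + 1)"
      using y A_ge_0 Q_ge_1 by (intro mult_left_mono power_mono) auto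
    finally show "norm (psi y) \<le> 2 * (A * Q) * (1 - c) ^ (L + M + 1)" .
  qed (use int' A_ge_0 Q_ge_1 assms in \<open>auto dest: integrable_integral\<close>)
  ultimately show ?thesis using assms by (simp add: mult_ac)
qed

text \<open>Euler--Maclaurin needs a complex antiderivative in slot 0; one exists since the strip
  \<open>0 < Re y < 1\<close> is convex.\<close>

lemma primitive_psi_rem:
  obtains \<phi> where "\<And>y. 0 < Re y \<Longrightarrow> Re y < 1 \<Longrightarrow> (\<phi> has_field_derivative y powr (- s) * U 0 y) (at y)"
proof -
  let ?D = "{z :: complex. 0 < Re z} \<inter> {z. Re z < 1}"
  have D: "open ?D" "convex ?D"
    by (auto intro!: open_Int convex_Int open_halfspace_Re_gt open_halfspace_Re_lt convex_halfspace_Re_gt convex_halfspace_Re_lt)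
  have "g 1 0 holomorphic_on ?D"
    unfolding holomorphic_on_open[OF D(1)] using g_deriv[of 1 _ 0] by auto
  then obtain \<phi> where \<phi>: "\<And>x. x \<in> ?D \<Longrightarrow> (\<phi> has_field_derivative g 1 0 x) (at x within ?D)"
    using holomorphic_convex_primitive'[OF D(2,1)] by metis
  show ?thesis
  proof (rule that[of \<phi>])
    fix y :: complex assume "0 < Re y" "Re y < 1"
    then have "y \<in> ?D" by simp
    then show "(\<phi> has_field_derivative y powr (- s) * U 0 y) (at y)"
      using \<phi>[of y] D(1) by (simp add: at_within_open[OF _ D(1)] g_0)
  qed
qed

end

section \<open>Euler--Maclaurin summation of the cut-off summand\<close>

context tornheim
begin

definition D :: real where "D = em_const R"

lemma D_ge: "D \<ge> 1" by (simp add: D_def em_const_ge)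

lemma powr_exponent_le_power:
  assumes "1 \<le> x" "x \<le> n" "- real L \<le> z" 
  shows "x powr (- z - real k) \<le> n ^ L"
proof -
  have "x powr (- z - real k) \<le> x powr real L" using assms by (intro powr_mono) auto
  also have "\<dots> = x ^ L" using assms by (intro powr_realpow) auto
  also have "\<dots> \<le> n ^ L" using assms by (intro power_mono) auto
  finally show ?thesis .
qed

lemma g_at_1:
  assumes "n > 1" "r \<le> R"
  shows "norm (g n r 1) \<le> 2 ^ r * (A * Q ^ 2) / n ^ M"
  using g_bound[of 1 n r] assms by (simp add: power_divide)

text \<open>This fixes the choice of \<open>R\<close>: the exponent \<open>- Re s - R + M\<close> is
  at most -2, so the bound does not depend on \<open>x\<close>.\<close>

lemma g_R_bound:
  assumes "1 \<le> x" "x < n"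
  shows "norm (g n R (of_real x)) \<le> 2 ^ R * (A * Q ^ 2) / n ^ M"
proof -
  have "norm (g n R (of_real x)) \<le> 2 ^ R * (A * Q ^ 2 * x powr (- Re s - R) * (x / n) ^ M)"
    using assms by (intro g_bound) auto
  also have "x powr (- Re s - R) * (x / n) ^ M = x powr (- Re s - R + M) / n ^ M"
    using assms by (simp add: power_divide powr_add powr_realpow)
  then have "2 ^ R * (A * Q ^ 2 * x powr (- Re s - R) * (x / n) ^ M) = 2 ^ R * (A * Q ^ 2) * (x powr (- Re s - R + M) / n ^ M)"
    by (simp add: mult.assoc)
  also have "x powr (- Re s - R + M) \<le> x powr 0"
    using assms s R by (intro powr_mono) auto
  finally show ?thesis using assms A_ge_0 by (simp add: divide_right_mono mult_left_mono)
qed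

text \<open>At the last sample \<open>p = n - 1\<close> the derivatives of the remainder and of the
  power terms need not be small separately. Their sum is a derivative of
  \<open>x powr (- s) * V 0 (x / n)\<close> and inherits the zero of the cut-off:
  \<open>(1 / n) ^ (L + M + 1)\<close> outweighs the factor \<open>n ^ L\<close> from
  \<open>fs\<close>.\<close>

lemma leib_V_end:
  assumes "p \<ge> 1" "n = real (Suc p)" "r \<le> R"
  shows "norm (leib fs (sc n V) r (of_nat p)) \<le> 2 ^ r * (A * Q ^ 2) / n ^ M"
proof -
  have n: "n > 1" "real p \<le> n" "real p / n \<le> 1" using assms by auto
  have "norm (leib fs (sc n V) r (of_nat p)) \<le> 2 ^ r * (Q * n ^ L * (A * Q * (1 / n) ^ (L + M + 1)))"
  proof (rule norm_leib_le)
    fix l assume l: "l \<le> r"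
    have "norm (fs (r - l) (of_real (real p))) \<le> Q * real p powr (- Re s - real (r - l))"
      using assms by (intro norm_fs) auto
    also have "\<dots> \<le> Q * n ^ L"
      using n assms s Q_ge_1 by (intro mult_left_mono powr_exponent_le_power) auto
    finally have 1: "norm (fs (r - l) (of_nat p)) \<le> Q * n ^ L" by simp
    have "norm (sc n V l (of_nat p)) = norm (V l (of_real (real p / n))) / n ^ l"
      using n by (simp add: sc_def norm_divide norm_power)
    also have "\<dots> \<le> norm (V l (of_real (real p / n)))"
      using n by (simp add: divide_le_eq mult_le_cancel_left1)
    also have "\<dots> \<le> A * Q * (1 - real p / n) ^ (L + M + 1)"
      using n l assms by (intro V_bound) auto
    also have "1 - real p / n = 1 / n" using assms by (simp add: field_simps)
    finally have 2: "norm (sc n V l (of_nat p)) \<le> A * Q * (1 / n) ^ (L + M + 1)" .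
    show "norm (fs (r - l) (of_nat p) * sc n V l (of_nat p)) \<le> Q * n ^ L * (A * Q * (1 / n) ^ (L + M + 1))"
      unfolding norm_mult using n Q_ge_1 by (intro mult_mono 1 2) auto
  qed
  also have "\<dots> = 2 ^ r * (A * Q ^ 2) / n ^ M * (1 / n)"
    using n by (simp add: power_add power_divide power2_eq_square mult_ac)
  also have "\<dots> \<le> 2 ^ r * (A * Q ^ 2) / n ^ M * 1"
    using n A_ge_0 by (intro mult_left_mono) auto
  finally show ?thesis by simp
qed

lemma em_coeff_sum_le:
  assumes "\<And>r. r < R \<Longrightarrow> norm (a r) \<le> 2 ^ r * B" "B \<ge> 0"
  shows "norm (\<Sum>r<R. em_coeff r * a r) \<le> D * (2 ^ R * B)"
proof -
  have "norm (\<Sum>r<R. em_coeff r * a r) \<le> (\<Sum>r<R. norm (em_coeff r) * (2 ^ R * B))"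
  proof (intro sum_norm_le)
    fix r assume r: "r \<in> {..<R}"
    then have "norm (a r) \<le> 2 ^ r * B" using assms by simp
    also have "\<dots> \<le> 2 ^ R * B" using r assms by (intro mult_right_mono power_increasing) auto
    finally show "norm (em_coeff r * a r) \<le> norm (em_coeff r) * (2 ^ R * B)"
      by (simp add: norm_mult mult_left_mono)
  qed
  also have "\<dots> \<le> D * (2 ^ R * B)"
    using assms(2) by (simp add: D_def em_const_def ring_distribs flip: sum_distrib_right)
  finally show ?thesis .
qed

text \<open>One \<open>em_step_real\<close> per unit interval, the \<open>em_prim\<close> values
  telescoping. The sum starts from \<open>j = 1\<close> and keeps that term apart, since an interval
  reaching 0 is not admissible.\<close>

lemma telescoped_estimate:
  fixes F :: "nat \<Rightarrow> complex \<Rightarrow> complex"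
  assumes F: "\<And>x. 0 < x \<Longrightarrow> x < n \<Longrightarrow> (F 0 has_field_derivative g n 0 (of_real x)) (at (of_real x))"
    and FS: "\<And>i. F (Suc i) = g n i"
    and "1 \<le> p" "real p < n"
  shows "norm ((\<Sum>j=1..p. g n 0 (of_nat j)) - g n 0 1 - (em_prim R F (of_nat p) - em_prim R F 1))
     \<le> real (p - 1) * (D * (2 ^ R * (A * Q ^ 2) / n ^ M))"
  using assms(3,4)
proof (induction p rule: dec_induct)
  case (step k)
  have "norm (F 1 (of_real (real (Suc k))) - (em_prim R F (of_real (real (Suc k))) - em_prim R F (of_real (real (Suc k)) - 1)))
     \<le> em_const R * (2 ^ R * (A * Q ^ 2) / n ^ M)"
  proof (rule em_step_real)
    show "R > 0" using R by simp
  next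
    fix i x assume x: "real (Suc k) - 1 \<le> x" "x \<le> real (Suc k)"
    then show "(F i has_field_derivative F (Suc i) (of_real x)) (at (of_real x))"
      using F[of x] g_deriv[of n "of_real x" "i - 1"] step by (cases i) (auto simp: FS)
    show "norm (F (Suc R) (of_real x)) \<le> 2 ^ R * (A * Q ^ 2) / n ^ M"
      unfolding FS using x step by (intro g_R_bound) auto
  qed
  then have 1: "norm (g n 0 (of_nat (Suc k)) - (em_prim R F (of_nat (Suc k)) - em_prim R F (of_nat k)))
      \<le> D * (2 ^ R * (A * Q ^ 2) / n ^ M)"
    using FS[of 0] by (simp add: D_def)
  have "norm ((\<Sum>j=1..Suc k. g n 0 (of_nat j)) - g n 0 1 - (em_prim R F (of_nat (Suc k)) - em_prim R F 1))
    = norm (((\<Sum>j=1..k. g n 0 (of_nat j)) - g n 0 1 - (em_prim R F (of_nat k) - em_prim R F 1))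
      + (g n 0 (of_nat (Suc k)) - (em_prim R F (of_nat (Suc k)) - em_prim R F (of_nat k))))"
    by (rule arg_cong[where f = norm]) (simp add: algebra_simps)
  also have "\<dots> \<le> real (k - 1) * (D * (2 ^ R * (A * Q ^ 2) / n ^ M)) + D * (2 ^ R * (A * Q ^ 2) / n ^ M)"
    using step by (intro norm_triangle_le add_mono 1) auto
  also have "\<dots> = (real (k - 1) + 1) * (D * (2 ^ R * (A * Q ^ 2) / n ^ M))"
    by (simp only: distrib_right mult_1_left)
  also have "real (k - 1) + 1 = real (Suc k - 1)"
    using step(1) by simp
  finally show ?case .
qed simp

text \<open>The \<open>m\<close>-th zeta error is of size \<open>1 / p ^ (M - m)\<close> and the
  prefactor \<open>1 / n ^ m\<close> restores a uniform \<open>1 / n ^ M\<close>. The comparison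
  \<open>n \<le> 2 * p\<close> costs \<open>2 ^ M\<close>.\<close>

lemma zeta_error:
  assumes "p \<ge> 1" "n = real (Suc p)"
  shows "norm (\<Sum>m<M. pochhammer s m / fact m / of_real n ^ m *
     ((\<Sum>j=1..p. of_nat j powr (- (s - of_nat m))) - em_prim R (powF (s - of_nat m)) (of_nat p) - riemann_zeta (s - of_nat m)))
   \<le> real M * (D * 2 ^ M * inverse_squares_sum) * Q ^ 2 / n ^ M"
proof -
  have n: "n > 1" "0 < real p" "n \<le> 2 * real p" using assms by auto
  have "norm (pochhammer s m / fact m / of_real n ^ m *
     ((\<Sum>j=1..p. of_nat j powr (- (s - of_nat m))) - em_prim R (powF (s - of_nat m)) (of_nat p) - riemann_zeta (s - of_nat m)))
     \<le> D * 2 ^ M * inverse_squares_sum * Q ^ 2 / n ^ M" if m: "m < M" for m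
  proof -
    have ne: "s - of_nat m \<noteq> 1"
    proof
      assume "s - of_nat m = 1"
      then have "Re (s - of_nat m) = 1" by simp
      then show False using s by simp
    qed
    have re: "Re (s - of_nat m) + real R \<ge> 2" using s m R by simp
    have nm: "norm (s - of_nat m) + real R \<le> norm s + real (N + R)"
      using norm_triangle_ineq4[of s "of_nat m"] m KN K R by simp
    obtain q where q: "p = Suc q" using assms(1) not0_implies_Suc by fastforce
    have "norm ((\<Sum>j=1..p. of_nat j powr (- (s - of_nat m))) - em_prim R (powF (s - of_nat m)) (of_nat p) - riemann_zeta (s - of_nat m))
       \<le> em_const R * (norm (s - of_nat m) + real R) ^ R * real p powr (2 - Re (s - of_nat m) - R) * inverse_squares_sum"
      unfolding q by (rule riemann_zeta_em_bound) (use R ne re in auto)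
    also have "\<dots> \<le> D * Q * (2 ^ M * n ^ m / n ^ M) * inverse_squares_sum"
      unfolding D_def
    proof (intro mult_mono)
      show "(norm (s - of_nat m) + real R) ^ R \<le> Q" unfolding Q_def by (intro power_mono nm) auto
      have "real p powr (2 - Re (s - of_nat m) - R) \<le> real p powr (- real (M - m))"
        using assms(1) s m R by (intro powr_mono) (auto simp: of_nat_diff)
      also have "\<dots> = 1 / real p ^ (M - m)"
        using n by (simp add: powr_minus powr_realpow divide_inverse)
      also have "\<dots> = 2 ^ (M - m) / (2 * real p) ^ (M - m)"
        using n by (simp add: power_mult_distrib)
      also have "\<dots> \<le> 2 ^ M / n ^ (M - m)"
        using n by (intro frac_le power_mono power_increasing) auto
      also have "\<dots> = 2 ^ M * n ^ m / n ^ M"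
        using m n by (simp add: power_diff field_simps)
      finally show "real p powr (2 - Re (s - of_nat m) - R) \<le> 2 ^ M * n ^ m / n ^ M" .
    qed (use em_const_ge[of R] inverse_squares_sum_ge Q_ge_1 n in auto)
    finally have 1: "norm ((\<Sum>j=1..p. of_nat j powr (- (s - of_nat m))) - em_prim R (powF (s - of_nat m)) (of_nat p) - riemann_zeta (s - of_nat m))
        \<le> D * Q * (2 ^ M * n ^ m / n ^ M) * inverse_squares_sum" .
    have "norm (pochhammer s m / fact m / of_real n ^ m) = norm (pochhammer s m) / fact m / n ^ m"
      using n by (simp add: norm_divide norm_power norm_mult)
    also have "\<dots> \<le> Q / n ^ m"
    proof (intro divide_right_mono)
      have "norm (pochhammer s m) / fact m \<le> norm (pochhammer s m) / 1"
        by (intro divide_left_mono fact_ge_1) auto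
      also have "\<dots> \<le> Q" using pochhammer_s_le[of m] m R by simp
      finally show "norm (pochhammer s m) / fact m \<le> Q" .
    qed (use n in auto)
    finally have 2: "norm (pochhammer s m / fact m / of_real n ^ m) \<le> Q / n ^ m" .
    have "norm (pochhammer s m / fact m / of_real n ^ m *
     ((\<Sum>j=1..p. of_nat j powr (- (s - of_nat m))) - em_prim R (powF (s - of_nat m)) (of_nat p) - riemann_zeta (s - of_nat m)))
       \<le> Q / n ^ m * (D * Q * (2 ^ M * n ^ m / n ^ M) * inverse_squares_sum)"
      unfolding norm_mult using Q_ge_1 n by (intro mult_mono 1 2) auto
    also have "\<dots> = D * 2 ^ M * inverse_squares_sum * Q ^ 2 / n ^ M"
      using n by (simp add: power2_eq_square)
    finally show ?thesis .
  qed
  then have "norm (\<Sum>m<M. pochhammer s m / fact m / of_real n ^ m *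
     ((\<Sum>j=1..p. of_nat j powr (- (s - of_nat m))) - em_prim R (powF (s - of_nat m)) (of_nat p) - riemann_zeta (s - of_nat m)))
     \<le> (\<Sum>m<M. D * 2 ^ M * inverse_squares_sum * Q ^ 2 / n ^ M)"
    by (intro sum_norm_le) auto
  then show ?thesis by simp
qed

text \<open>Collects the constants of all error terms in \<open>key_estimate\<close>. It is
  independent of \<open>s\<close>, which enters the estimate only through \<open>Q\<close>; this is
  what makes the bound uniform on the strip.\<close>

definition rem_const :: real where
  "rem_const = 4 * A + 3 * (D * (2 ^ R * A)) + real M * (D * 2 ^ M * inverse_squares_sum)"

text \<open>Split the weight as \<open>U\<close> plus \<open>T\<close>. The \<open>T\<close> part
  consists of power sums, which give zeta values plus boundary terms at \<open>p\<close>; the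
  \<open>U\<close> part is treated by Euler--Maclaurin. The boundary terms at \<open>p\<close> then
  recombine: derivatives into those of the cut-off summand, antiderivatives into the integral of
  \<open>psi\<close> up to \<open>c\<close>.\<close>

lemma key_estimate:
  assumes "p \<ge> 1" "n = real (Suc p)"
  shows "norm ((\<Sum>j=1..p. of_nat j powr (- s) * V 0 (of_nat j / of_real n))
      - (\<Sum>m<M. pochhammer s m / fact m / of_real n ^ m * riemann_zeta (s - of_nat m))
      - of_real n powr (1 - s) * integral {0..1} psi) \<le> rem_const * Q ^ 2 * n / n ^ M"
proof -
  have n: "n > 1" "real p < n" "0 < real p" "0 < 1 / n" "1 / n < 1" "real p / n < 1" "n \<ge> 2" using assms by auto
  obtain \<phi> where \<phi>: "\<And>y. 0 < Re y \<Longrightarrow> Re y < 1 \<Longrightarrow> (\<phi> has_field_derivative y powr (- s) * U 0 y) (at y)"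
    using primitive_psi_rem by blast
  define c where "c = real p / n"
  have c: "1 - c = 1 / n" "1 / n \<le> c" "1 / 2 \<le> c" "c < 1" "0 < c" using n assms by (auto simp: c_def field_simps)
  \<comment> \<open>Rescaling the primitive of \<open>y powr (- s) * U 0 y\<close> by
    \<open>n powr (1 - s)\<close> gives an antiderivative of \<open>g n 0\<close>, because
    \<open>n powr (- s)\<close> times \<open>(x / n) powr (- s)\<close> is
    \<open>x powr (- s)\<close>.\<close>
  define F where "F i x = (case i of 0 \<Rightarrow> of_real n powr (1 - s) * \<phi> (x / of_real n) | Suc k \<Rightarrow> g n k x)" for i x
  have FS: "F (Suc i) = g n i" for i by (simp add: F_def fun_eq_iff)
  have F0: "F 0 = (\<lambda>x. of_real n powr (1 - s) * \<phi> (x / of_real n))" by (simp add: F_def fun_eq_iff)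
  have "n \<noteq> 0" using n(1) by linarith
  then have nn: "complex_of_real n \<noteq> 0" by simp
  have F: "(F 0 has_field_derivative g n 0 (of_real x)) (at (of_real x))" if "0 < x" "x < n" for x
  proof -
    let ?y = "complex_of_real x / of_real n"
    have y: "0 < Re ?y" "Re ?y < 1" using that n by auto
    have "((\<lambda>x. \<phi> (x / of_real n)) has_field_derivative ?y powr (- s) * U 0 ?y * (1 / of_real n)) (at (of_real x))"
      by (rule DERIV_chain2[where g = "\<lambda>x. x / of_real n", OF \<phi>[OF y]])
         (use nn in \<open>auto intro!: derivative_eq_intros\<close>)
    then have "(F 0 has_field_derivative of_real n powr (1 - s) * (?y powr (- s) * U 0 ?y * (1 / of_real n))) (at (of_real x))"
      unfolding F0 by (rule DERIV_cmult)
    also have "of_real n powr (1 - s) * (?y powr (- s) * U 0 ?y * (1 / of_real n)) = of_real n powr (- s) * ?y powr (- s) * U 0 ?y"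
      using nn by (simp add: powr_diff powr_minus divide_inverse)
    also have "of_real n powr (- s) * ?y powr (- s) = of_real x powr (- s)"
      using of_real_powr_mult[of n "x / n" "- s"] n that by simp
    finally show ?thesis by (simp add: g_0)
  qed
  define P where "P m = pochhammer s m / fact m" for m
  define P' where "P' m = P m / of_real n ^ m" for m
  define E1 where "E1 = (\<Sum>j=1..p. g n 0 (of_nat j)) - g n 0 1 - (em_prim R F (of_nat p) - em_prim R F 1)"
  define E0 where "E0 = (\<Sum>m<M. P' m *
     ((\<Sum>j=1..p. of_nat j powr (- (s - of_nat m))) - em_prim R (powF (s - of_nat m)) (of_nat p) - riemann_zeta (s - of_nat m)))"
  have V_split: "of_nat j powr (- s) * V 0 (of_nat j / of_real n) = g n 0 (of_nat j) + (\<Sum>m<M. P' m * of_nat j powr (- (s - of_nat m)))"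
    if "j \<ge> 1" for j
  proof -
    have "leib fs (sc n V) 0 (of_nat j) = g n 0 (of_nat j) + (\<Sum>m<M. P' m * powF (s - of_nat m) (Suc 0) (of_nat j))"
      unfolding P'_def P_def by (rule leib_fs_V) (use that n in auto)
    then show ?thesis by (simp add: leib_def fs_def powF_def sc_def)
  qed
  have S1: "(\<Sum>j=1..p. of_nat j powr (- s) * V 0 (of_nat j / of_real n))
      = (\<Sum>j=1..p. g n 0 (of_nat j)) + (\<Sum>m<M. P' m * (\<Sum>j=1..p. of_nat j powr (- (s - of_nat m))))"
    by (simp add: V_split sum.distrib sum_distrib_left sum.swap[of _ "{..<M}"])
  have S2: "(\<Sum>m<M. P' m * (\<Sum>j=1..p. of_nat j powr (- (s - of_nat m))))
      = E0 + (\<Sum>m<M. P' m * riemann_zeta (s - of_nat m)) + (\<Sum>m<M. P' m * em_prim R (powF (s - of_nat m)) (of_nat p))"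
    by (simp add: E0_def algebra_simps sum.distrib sum_subtractf)
  \<comment> \<open>The decisive recombination: the \<open>R\<close> derivative terms at
    \<open>p\<close> from zeta and from Euler--Maclaurin become derivatives of the cut-off summand,
    small by \<open>leib_V_end\<close>.\<close>
  have S3: "(\<Sum>m<M. P' m * em_prim R (powF (s - of_nat m)) (of_nat p)) + (\<Sum>r<R. em_coeff r * g n r (of_nat p))
      = (\<Sum>m<M. P' m * powF (s - of_nat m) 0 (of_nat p)) + (\<Sum>r<R. em_coeff r * leib fs (sc n V) r (of_nat p))"
  proof -
    have "leib fs (sc n V) r (of_nat p) = g n r (of_nat p) + (\<Sum>m<M. P' m * powF (s - of_nat m) (Suc r) (of_nat p))" for r
      unfolding P'_def P_def by (rule leib_fs_V) (use n in auto)
    then show ?thesis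
      by (simp add: em_prim_def ring_distribs sum.distrib sum_distrib_left sum.swap[of _ "{..<M}"] mult_ac)
  qed
  have S4: "(\<Sum>m<M. P' m * powF (s - of_nat m) 0 (of_nat p)) = of_real n powr (1 - s) * (\<Sum>m<M. P m * powF (s - of_nat m) 0 (of_real c))"
    unfolding sum_distrib_left
  proof (intro sum.cong refl)
    fix m
    have "complex_of_nat p = of_real (n * c)" using n by (simp add: c_def)
    then have "complex_of_nat p powr (1 - (s - of_nat m)) = of_real n powr (1 - (s - of_nat m)) * of_real c powr (1 - (s - of_nat m))"
      using of_real_powr_mult[of n c] n c by simp
    also have "of_real n powr (1 - (s - of_nat m)) = of_real n powr (1 - s) * of_real n ^ m"
    proof -
      have "of_real n powr (1 - (s - of_nat m)) = of_real n powr ((1 - s) + of_nat m)" by (simp add: algebra_simps)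
      also have "\<dots> = of_real n powr (1 - s) * of_real n ^ m" using nn by (simp only: powr_add powr_nat if_False)
      finally show ?thesis .
    qed
    finally show "P' m * powF (s - of_nat m) 0 (of_nat p) = of_real n powr (1 - s) * (P m * powF (s - of_nat m) 0 (of_real c))"
      using nn by (simp add: P'_def powF_0)
  qed
  have S5: "F 0 (of_nat p) - F 0 1 = of_real n powr (1 - s) * (integral {0..c} psi_rem - integral {0..1/n} psi_rem)"
  proof -
    have "(psi_rem has_integral \<phi> (of_real c) - \<phi> (of_real (1 / n))) {1/n..c}"
    proof (rule fundamental_theorem_of_calculus)
      fix x assume "x \<in> {1/n..c}"
      then have "1 / n \<le> x" "x \<le> c" by simp_all
      then have "0 < x" "x < 1" using c(4) n(4) by linarith+
      then have "0 < Re (of_real x)" "Re (of_real x) < 1" by simp_all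
      from has_vector_derivative_real_field[OF \<phi>[OF this]]
      show "((\<lambda>x. \<phi> (of_real x)) has_vector_derivative psi_rem x) (at x within {1/n..c})" by (simp add: psi_rem_def)
    qed (use c in auto)
    moreover have "integral {0..1/n} psi_rem + integral {1/n..c} psi_rem = integral {0..c} psi_rem"
    proof (rule Henstock_Kurzweil_Integration.integral_combine)
      have "{0..c} \<subseteq> {0..1}" using c(4) by auto
      then show "psi_rem integrable_on {0..c}" by (rule integrable_on_subinterval[OF integrable_psi_rem])
    qed (use c(2) n(4) in auto)
    ultimately have "\<phi> (of_real c) - \<phi> (of_real (1 / n)) = integral {0..c} psi_rem - integral {0..1/n} psi_rem"
      by (metis integral_unique add_diff_cancel_left')
    then show ?thesis unfolding F0 by (simp add: c_def flip: right_diff_distrib)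
  qed
  have S6: "integral {0..c} psi = integral {0..c} psi_rem + (\<Sum>m<M. P m * powF (s - of_nat m) 0 (of_real c))"
    unfolding P_def using psi_integral[of c] c by (intro integral_unique) auto
  define X where "X = (\<Sum>j=1..p. of_nat j powr (- s) * V 0 (of_nat j / of_real n))
      - (\<Sum>m<M. P' m * riemann_zeta (s - of_nat m)) - of_real n powr (1 - s) * integral {0..1} psi"
  \<comment> \<open>What is left: zeta errors, Euler--Maclaurin errors, the terms at 1 (value and
    derivatives), the derivatives at \<open>p\<close>, and the pieces of the integral beyond
    \<open>c\<close> and below \<open>1 / n\<close>.\<close>
  have X_eq: "X = E0 + E1 + g n 0 1 - (\<Sum>r<R. em_coeff r * g n r 1) + (\<Sum>r<R. em_coeff r * leib fs (sc n V) r (of_nat p))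
      - of_real n powr (1 - s) * (integral {0..1} psi - integral {0..c} psi) - of_real n powr (1 - s) * integral {0..1/n} psi_rem"
  proof -
    have a: "(\<Sum>j=1..p. g n 0 (of_nat j)) = E1 + g n 0 1 + (F 0 (of_nat p) - F 0 1)
        + (\<Sum>r<R. em_coeff r * g n r (of_nat p)) - (\<Sum>r<R. em_coeff r * g n r 1)"
      by (simp add: E1_def em_prim_def FS)
    have e: "(\<Sum>m<M. P' m * em_prim R (powF (s - of_nat m)) (of_nat p)) =
        (\<Sum>m<M. P' m * powF (s - of_nat m) 0 (of_nat p)) + (\<Sum>r<R. em_coeff r * leib fs (sc n V) r (of_nat p))
        - (\<Sum>r<R. em_coeff r * g n r (of_nat p))"
      unfolding eq_diff_eq by (rule S3)
    show ?thesis
      unfolding X_def S1 S2 S6 a e S4 S5 by (simp add: algebra_simps)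
  qed
  have "norm X \<le> norm E0 + norm E1 + norm (g n 0 1) + norm (\<Sum>r<R. em_coeff r * g n r 1)
      + norm (\<Sum>r<R. em_coeff r * leib fs (sc n V) r (of_nat p))
      + norm (of_real n powr (1 - s) * (integral {0..1} psi - integral {0..c} psi)) + norm (of_real n powr (1 - s) * integral {0..1/n} psi_rem)"
    unfolding X_eq
    by (intro order_trans[OF norm_triangle_ineq4] order_trans[OF norm_triangle_ineq] add_mono order_refl)
  also have "\<dots> \<le> real M * (D * 2 ^ M * inverse_squares_sum) * (Q ^ 2 * n / n ^ M) + real (p - 1) * (D * (2 ^ R * A)) * (Q ^ 2 / n ^ M) + A * (Q ^ 2 * n / n ^ M)
      + D * (2 ^ R * A) * (Q ^ 2 / n ^ M) + D * (2 ^ R * A) * (Q ^ 2 * n / n ^ M) + 2 * A * (Q ^ 2 * n / n ^ M) + A * (Q ^ 2 * n / n ^ M)"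
  proof -
    have q: "Q ^ 2 / n ^ M \<le> Q ^ 2 * n / n ^ M" "Q / n ^ M \<le> Q ^ 2 * n / n ^ M"
    proof -
      have 1: "Q ^ 2 \<le> Q ^ 2 * n" using mult_left_mono[of 1 n "Q ^ 2"] n(1) by simp
      moreover have "Q \<le> Q ^ 2" using Q_ge_1 by (intro self_le_power) auto
      ultimately have 2: "Q \<le> Q ^ 2 * n" by linarith
      show "Q ^ 2 / n ^ M \<le> Q ^ 2 * n / n ^ M" using n(1) by (intro divide_right_mono 1) simp
      show "Q / n ^ M \<le> Q ^ 2 * n / n ^ M" using n(1) by (intro divide_right_mono 2) simp
    qed
    have b0: "norm E0 \<le> real M * (D * 2 ^ M * inverse_squares_sum) * (Q ^ 2 * n / n ^ M)"
    proof -
      have "norm E0 \<le> real M * (D * 2 ^ M * inverse_squares_sum) * (Q ^ 2 / n ^ M)"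
        using zeta_error[OF assms] by (simp add: E0_def P'_def P_def)
      also have "\<dots> \<le> real M * (D * 2 ^ M * inverse_squares_sum) * (Q ^ 2 * n / n ^ M)"
        using D_ge inverse_squares_sum_ge by (intro mult_left_mono q) auto
      finally show ?thesis .
    qed
    have b1: "norm E1 \<le> real (p - 1) * (D * (2 ^ R * A)) * (Q ^ 2 / n ^ M)"
      using telescoped_estimate[of n F p, OF F FS assms(1) n(2)] by (simp add: E1_def mult_ac)
    have b2: "norm (g n 0 1) \<le> A * (Q ^ 2 * n / n ^ M)"
    proof -
      have "norm (g n 0 1) \<le> A * (Q ^ 2 / n ^ M)" using g_at_1[of n 0] n by simp
      also have "\<dots> \<le> A * (Q ^ 2 * n / n ^ M)" by (intro mult_left_mono q A_ge_0)
      finally show ?thesis .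
    qed
    have b3: "norm (\<Sum>r<R. em_coeff r * g n r 1) \<le> D * (2 ^ R * A) * (Q ^ 2 / n ^ M)"
      using em_coeff_sum_le[of "\<lambda>r. g n r 1" "A * Q ^ 2 / n ^ M"] g_at_1[of n] n A_ge_0 by simp
    have b4: "norm (\<Sum>r<R. em_coeff r * leib fs (sc n V) r (of_nat p)) \<le> D * (2 ^ R * A) * (Q ^ 2 * n / n ^ M)"
    proof -
      have "norm (\<Sum>r<R. em_coeff r * leib fs (sc n V) r (of_nat p)) \<le> D * (2 ^ R * A) * (Q ^ 2 / n ^ M)"
        using em_coeff_sum_le[of "\<lambda>r. leib fs (sc n V) r (of_nat p)" "A * Q ^ 2 / n ^ M"] leib_V_end[OF assms] n A_ge_0 by simp
      also have "\<dots> \<le> D * (2 ^ R * A) * (Q ^ 2 * n / n ^ M)"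
        using D_ge A_ge_0 by (intro mult_left_mono q) auto
      finally show ?thesis .
    qed
    have np: "norm (of_real n powr (1 - s)) = n powr (1 - Re s)" using norm_of_real_powr[of n "1 - s"] n(1) by simp
    have b5: "norm (of_real n powr (1 - s) * (integral {0..1} psi - integral {0..c} psi)) \<le> 2 * A * (Q ^ 2 * n / n ^ M)"
    proof -
      have "n powr (1 - Re s) \<le> n powr real (L + 1)" using n s by (intro powr_mono) auto
      also have "\<dots> = n ^ (L + 1)" using n by (intro powr_realpow) auto
      finally have "norm (of_real n powr (1 - s) * (integral {0..1} psi - integral {0..c} psi)) \<le> n ^ (L + 1) * (2 * (A * Q) * (1 - c) ^ (L + M + 2))"
        unfolding norm_mult np using n c by (intro mult_mono integral_psi_tail) auto
      also have "\<dots> = 2 * A * (Q / n ^ M) * (1 / n)"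
        using n by (simp add: c power_add power_divide mult_ac)
      also have "\<dots> \<le> 2 * A * (Q / n ^ M) * 1"
        using n A_ge_0 Q_ge_1 by (intro mult_left_mono) auto
      also have "\<dots> \<le> 2 * A * (Q ^ 2 * n / n ^ M)"
        unfolding mult_1_right using A_ge_0 by (intro mult_left_mono q) simp
      finally show ?thesis .
    qed
    have b6: "norm (of_real n powr (1 - s) * integral {0..1/n} psi_rem) \<le> A * (Q ^ 2 * n / n ^ M)"
    proof -
      have "norm (of_real n powr (1 - s) * integral {0..1/n} psi_rem) \<le> n powr (1 - Re s) * (A * Q * (1 / n) powr (real M - Re s) * (1 / n))"
        unfolding norm_mult np using n by (intro mult_left_mono integral_psi_rem_le) auto
      also have "(1 / n) powr (real M - Re s) = n powr (Re s - real M)"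
        using n by (simp add: powr_divide powr_minus_divide[symmetric])
      also have "n powr (1 - Re s) * (A * Q * n powr (Re s - real M) * (1 / n)) = A * Q * (n powr (1 - Re s) * n powr (Re s - real M)) / n"
        by simp
      also have "n powr (1 - Re s) * n powr (Re s - real M) = n powr (1 - real M)" by (simp flip: powr_add)
      also have "\<dots> = n / n ^ M" using n by (simp add: powr_diff powr_realpow)
      also have "A * Q * (n / n ^ M) / n = A * (Q / n ^ M)" using n by simp
      also have "\<dots> \<le> A * (Q ^ 2 * n / n ^ M)" by (intro mult_left_mono q A_ge_0)
      finally show ?thesis .
    qed
    show ?thesis by (intro add_mono b0 b1 b2 b3 b4 b5 b6)
  qed
  also have "\<dots> \<le> rem_const * Q ^ 2 * n / n ^ M"
  proof -
    \<comment> \<open>The \<open>p - 1\<close> Euler--Maclaurin errors and the derivative terms at 1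
      have the same bound, so together they count \<open>p \<le> n\<close> times; this is where the
      factor \<open>n\<close> in the estimate comes from.\<close>
    have "real (p - 1) * (D * (2 ^ R * A)) * (Q ^ 2 / n ^ M) + D * (2 ^ R * A) * (Q ^ 2 / n ^ M)
        = real p * (D * (2 ^ R * A) * (Q ^ 2 / n ^ M))"
      using assms(1) by (simp add: of_nat_diff algebra_simps)
    also have "\<dots> \<le> n * (D * (2 ^ R * A) * (Q ^ 2 / n ^ M))"
      using n D_ge A_ge_0 by (intro mult_right_mono) auto
    finally have "real (p - 1) * (D * (2 ^ R * A)) * (Q ^ 2 / n ^ M) + D * (2 ^ R * A) * (Q ^ 2 / n ^ M)
      \<le> D * (2 ^ R * A) * (Q ^ 2 * n / n ^ M)" by (simp add: mult_ac)
    moreover have "0 \<le> D * (2 ^ R * A) * (Q ^ 2 * n / n ^ M)" using n D_ge A_ge_0 by auto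
    moreover have "rem_const * Q ^ 2 * n / n ^ M = 4 * A * (Q ^ 2 * n / n ^ M) + 3 * (D * (2 ^ R * A) * (Q ^ 2 * n / n ^ M)) + real M * (D * 2 ^ M * inverse_squares_sum) * (Q ^ 2 * n / n ^ M)"
      by (simp add: rem_const_def ring_distribs add_divide_distrib mult_ac)
    ultimately show ?thesis by (simp only: ring_distribs)
  qed
  finally show ?thesis by (simp add: X_def P'_def P_def)
qed

end

section \<open>Asymptotic expansion of the diagonal sums\<close>

definition tsum :: "complex \<Rightarrow> nat \<Rightarrow> complex" where
  "tsum s n = (\<Sum>j=1..<n. of_nat (j * (n - j)) powr (- s))"

definition bint :: "complex \<Rightarrow> complex" where
  "bint s = integral {0..1} (\<lambda>y. of_real (y * (1 - y)) powr (- s))"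

text \<open>The leading terms of the expansion of \<open>n powr (- s) * tsum s n\<close> in powers of \<open>n\<close>; summed over \<open>n\<close> they give
  the terms \<open>\<zeta>(3 * s - 1)\<close> and \<open>\<zeta>(2 * s + m)\<close> of \<open>omega_left\<close>.\<close>

definition tsum_main :: "nat \<Rightarrow> complex \<Rightarrow> nat \<Rightarrow> complex" where
  "tsum_main M s n = of_nat n powr (1 - 3 * s) * bint s
     + 2 * (\<Sum>m<M. pochhammer s m / fact m * of_nat n powr (- 2 * s - of_nat m) * riemann_zeta (s - of_nat m))"

definition tsum_rem :: "nat \<Rightarrow> complex \<Rightarrow> nat \<Rightarrow> complex" where
  "tsum_rem M s n = of_nat n powr (- s) * tsum s n - tsum_main M s n"

context tornheim
begin

lemma psi_sym:
  assumes "0 \<le> y" "y \<le> 1"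
  shows "of_real (y * (1 - y)) powr (- s) = psi y + psi (1 - y)"
proof -
  have *: "psi y = of_real (y * (1 - y)) powr (- s) * (\<Sum>r=K..N. \<kappa> r * (1 - of_real y) ^ r)"
    if "0 \<le> y" "y \<le> 1" for y
  proof -
    have "(1 - complex_of_real y) powr (of_nat r - s) = (1 - of_real y) ^ r * (1 - of_real y) powr (- s)" for r
    proof (cases "y = 1")
      case False
      then have "1 - complex_of_real y \<noteq> 0" by (metis eq_iff_diff_eq_0 of_real_eq_1_iff)
      then show ?thesis by (metis (no_types) powr_add powr_nat diff_conv_add_uminus)
    qed auto
    moreover have "of_real (y * (1 - y)) powr (- s) = of_real y powr (- s) * (1 - of_real y) powr (- s)"
      using of_real_powr_mult[of y "1 - y" "- s"] that by simp
    ultimately show ?thesis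
      by (simp add: psi_def V_def sum_distrib_left mult_ac)
  qed
  have "psi y + psi (1 - y) = of_real (y * (1 - y)) powr (- s) * ((\<Sum>r=K..N. \<kappa> r * (1 - of_real y) ^ r) + (\<Sum>r=K..N. \<kappa> r * of_real y ^ r))"
    using assms by (simp add: * ring_distribs mult.commute[of "1 - y"])
  then show ?thesis using \<kappa>[of "of_real y"] by (simp add: add.commute)
qed

lemma bint_has_integral:
  "((\<lambda>y. of_real (y * (1 - y)) powr (- s)) has_integral 2 * integral {0..1} psi) {0..1}"
proof -
  have psi: "(psi has_integral integral {0..1} psi) {0..1}"
    by (rule integrable_integral[OF has_integral_integrable[OF psi_integral]]) auto
  have "((\<lambda>y. psi (1 - y)) has_integral integral {0..1} psi) {0..1}"
  proof -
    have "((\<lambda>x. psi ((-1) *\<^sub>R x + 1)) has_integral (1 / (\<bar>-1\<bar> ^ DIM(real))) *\<^sub>R integral {0..1} psi)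
       ((\<lambda>x. (1 / -1) *\<^sub>R x + - ((1 / -1) *\<^sub>R 1)) ` cbox 0 1)"
      by (rule has_integral_affinity) (use psi in auto)
    moreover have "(\<lambda>x::real. (1 / -1) *\<^sub>R x + - ((1 / -1) *\<^sub>R 1)) = (\<lambda>x. 1 - x)"
      by auto
    moreover have "(\<lambda>x::real. 1 - x) ` cbox 0 1 = {0..1}"
      unfolding cbox_interval by (subst image_diff_atLeastAtMost) simp
    ultimately show ?thesis by simp
  qed
  with psi have "((\<lambda>y. psi y + psi (1 - y)) has_integral integral {0..1} psi + integral {0..1} psi) {0..1}"
    by (rule has_integral_add)
  then have "((\<lambda>y. of_real (y * (1 - y)) powr (- s)) has_integral integral {0..1} psi + integral {0..1} psi) {0..1}"
    by (rule has_integral_eq[rotated]) (simp add: psi_sym del: of_real_mult of_real_diff)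
  then show ?thesis by simp
qed

lemma bint_eq: "bint s = 2 * integral {0..1} psi"
  unfolding bint_def by (rule integral_unique[OF bint_has_integral])

lemma tsum_eq:
  assumes n: "n = real (Suc p)"
  shows "tsum s (Suc p) = 2 * of_real n powr (- s) * (\<Sum>j=1..p. of_nat j powr (- s) * V 0 (of_nat j / of_real n))"
proof -
  have n0: "n > 0" using n by simp
  have psi: "of_real n powr (- s) * psi (real j / n) = of_nat j powr (- s) * V 0 (of_nat j / of_real n)" for j
    using of_real_powr_mult[of n "real j / n" "- s"] n0 by (simp add: psi_def)
  have "tsum s (Suc p) = (\<Sum>j=1..p. of_real n powr (- s) * (of_real n powr (- s) * psi (real j / n))
       + of_real n powr (- s) * (of_real n powr (- s) * psi (real (Suc p - j) / n)))"
    unfolding tsum_def atLeastLessThanSuc_atLeastAtMost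
  proof (intro sum.cong refl)
    fix j assume j: "j \<in> {1..p}"
    define y where "y = real j / n"
    have y: "0 \<le> y" "y \<le> 1" "1 - y = real (Suc p - j) / n"
      using j n by (auto simp: y_def field_simps of_nat_diff)
    have "real (j * (Suc p - j)) = n * (n * (y * (1 - y)))"
      unfolding y(3) using n0 by (simp add: y_def)
    then have "complex_of_nat (j * (Suc p - j)) = of_real (n * (n * (y * (1 - y))))"
      by (metis of_real_of_nat_eq)
    then have "of_nat (j * (Suc p - j)) powr (- s) = of_real (n * (n * (y * (1 - y)))) powr (- s)" by simp
    also have "\<dots> = of_real n powr (- s) * (of_real n powr (- s) * of_real (y * (1 - y)) powr (- s))"
      using y n0 by (subst of_real_powr_mult, simp, simp, subst of_real_powr_mult) auto
    also have "of_real (y * (1 - y)) powr (- s) = psi y + psi (1 - y)" using y by (intro psi_sym) auto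
    finally show "of_nat (j * (Suc p - j)) powr (- s) = of_real n powr (- s) * (of_real n powr (- s) * psi (real j / n))
       + of_real n powr (- s) * (of_real n powr (- s) * psi (real (Suc p - j) / n))"
      by (simp only: y(3) ring_distribs) (simp add: y_def)
  qed
  also have "\<dots> = of_real n powr (- s) * (\<Sum>j=1..p. of_real n powr (- s) * psi (real j / n))
     + of_real n powr (- s) * (\<Sum>j=1..p. of_real n powr (- s) * psi (real (Suc p - j) / n))"
    by (simp add: sum.distrib sum_distrib_left)
  also have "(\<Sum>j=1..p. of_real n powr (- s) * psi (real (Suc p - j) / n)) = (\<Sum>j=1..p. of_real n powr (- s) * psi (real j / n))"
    by (rule sum.reindex_bij_witness[of _ "\<lambda>j. Suc p - j" "\<lambda>j. Suc p - j"]) auto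
  finally show ?thesis by (simp only: psi) simp
qed

lemma tsum_rem_eq:
  assumes n: "n = real (Suc p)"
  shows "tsum_rem M s (Suc p) = 2 * of_real n powr (- 2 * s) * ((\<Sum>j=1..p. of_nat j powr (- s) * V 0 (of_nat j / of_real n))
      - (\<Sum>m<M. pochhammer s m / fact m / of_real n ^ m * riemann_zeta (s - of_nat m))
      - of_real n powr (1 - s) * integral {0..1} psi)"
proof -
  have n0: "complex_of_real n \<noteq> 0" and nn: "of_nat (Suc p) = complex_of_real n" using n by (simp_all del: of_nat_Suc)
  have 1: "of_real n powr (- 2 * s) = of_real n powr (- s) * of_real n powr (- s)"
    using n0 by (simp flip: powr_add)
  have 2: "of_real n powr (1 - 3 * s) = of_real n powr (- 2 * s) * of_real n powr (1 - s)"
    using n0 by (simp flip: powr_add)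
  have 3: "of_real n powr (- 2 * s - of_nat m) = of_real n powr (- 2 * s) / of_real n ^ m" for m
    using n0 by (simp add: powr_diff powr_nat)
  show ?thesis
    unfolding tsum_rem_def tsum_main_def tsum_eq[OF n] bint_eq nn 2 3 1
    by (simp add: ring_distribs sum_distrib_left mult_ac del: of_nat_Suc)
qed

text \<open>The prefactor \<open>n powr (- 2 * Re s)\<close> costs at most
  \<open>n ^ (2 * L)\<close>. With the \<open>n / n ^ M\<close> of \<open>key_estimate\<close> this
  explains the exponent, and \<open>M \<ge> 2 * L + 3\<close> brings it down to -2.\<close>

lemma tsum_rem_bound:
  assumes "p \<ge> 1"
  shows "norm (tsum_rem M s (Suc p)) \<le> 2 * rem_const * ((real (N + R) + 1) * (1 + norm s)) ^ (2 * R) * real (Suc p) powr (2 * real L + 1 - real M)"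
proof -
  define n where "n = real (Suc p)"
  have n: "n > 1" using assms by (simp add: n_def)
  have rem_const: "rem_const \<ge> 0" using A_ge_0 D_ge inverse_squares_sum_ge by (simp add: rem_const_def)
  have "norm (tsum_rem M s (Suc p)) \<le> 2 * n powr (- 2 * Re s) * (rem_const * Q ^ 2 * n / n ^ M)"
    unfolding tsum_rem_eq[OF n_def] norm_mult
    using n key_estimate[OF assms n_def] norm_of_real_powr[of n "- 2 * s"]
    by (intro mult_mono) auto
  also have "\<dots> = 2 * rem_const * Q ^ 2 * (n powr (- 2 * Re s) * n / n ^ M)" by simp
  also have "\<dots> \<le> 2 * rem_const * ((real (N + R) + 1) * (1 + norm s)) ^ (2 * R) * (n powr (2 * real L + 1 - real M))"
  proof (intro mult_mono)
    have "norm s + real (N + R) \<le> (real (N + R) + 1) * (1 + norm s)"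
      by (simp add: algebra_simps)
    then have "Q \<le> ((real (N + R) + 1) * (1 + norm s)) ^ R" unfolding Q_def by (intro power_mono) auto
    then have "Q ^ 2 \<le> (((real (N + R) + 1) * (1 + norm s)) ^ R) ^ 2" using Q_ge_1 by (intro power_mono) auto
    then show "Q ^ 2 \<le> ((real (N + R) + 1) * (1 + norm s)) ^ (2 * R)" by (simp flip: power_mult add: mult.commute)
    have "n powr (- 2 * Re s) * n / n ^ M = n powr (- 2 * Re s + 1 - real M)"
      using n by (simp only: powr_add powr_diff) (simp add: powr_realpow)
    also have "\<dots> \<le> n powr (2 * real L + 1 - real M)" using n s by (intro powr_mono) auto
    finally show "n powr (- 2 * Re s) * n / n ^ M \<le> n powr (2 * real L + 1 - real M)" .
  qed (use rem_const n in auto)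
  finally show ?thesis by (simp add: n_def)
qed

end

text \<open>The parameters are fixed before \<open>s\<close>, so every constant built from them is
  uniform on the strip.\<close>

lemma tornheim_exists:
  assumes "M \<ge> 1"
  obtains R K N \<kappa> where "\<And>s. - real L \<le> Re s \<Longrightarrow> Re s \<le> 3 / 4 \<Longrightarrow> tornheim L M R K N \<kappa> s"
proof -
  define R where "R = M + L + 2"
  define K where "K = R + L + M + 2"
  have "K > 0" by (simp add: K_def)
  then obtain N \<kappa> where *: "K \<le> N" "\<And>y :: complex. (\<Sum>r=K..N. \<kappa> r * y ^ r) + (\<Sum>r=K..N. \<kappa> r * (1 - y) ^ r) = 1"
    using partition_polynomial by blast
  show ?thesis
    by (rule that[of R K N \<kappa>], unfold_locales) (use * assms R_def K_def in auto)
qed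

lemma tsum_rem_bound_uniform:
  assumes "M \<ge> 1"
  obtains C k where "C \<ge> 0" "\<And>s n. - real L \<le> Re s \<Longrightarrow> Re s \<le> 3 / 4 \<Longrightarrow> n \<ge> 2 \<Longrightarrow>
     norm (tsum_rem M s n) \<le> C * (1 + norm s) ^ k * real n powr (2 * real L + 1 - real M)"
proof -
  obtain R K N \<kappa> where t: "\<And>s. - real L \<le> Re s \<Longrightarrow> Re s \<le> 3 / 4 \<Longrightarrow> tornheim L M R K N \<kappa> s"
    using tornheim_exists[OF assms] by metis
  define C where "C = 2 * tornheim.rem_const M R K N \<kappa> * (real (N + R) + 1) ^ (2 * R)"
  \<comment> \<open>The point 0 lies in the strip; this instance yields \<open>C \<ge> 0\<close>, as
    \<open>rem_const\<close> does not involve \<open>s\<close>.\<close>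
  interpret t0: tornheim L M R K N \<kappa> 0 by (rule t) auto
  have "C \<ge> 0" using t0.A_ge_0 t0.D_ge inverse_squares_sum_ge by (simp add: C_def t0.rem_const_def)
  moreover have "norm (tsum_rem M s n) \<le> C * (1 + norm s) ^ (2 * R) * real n powr (2 * real L + 1 - real M)"
    if s: "- real L \<le> Re s" "Re s \<le> 3 / 4" and n: "n \<ge> 2" for s n
  proof -
    interpret t: tornheim L M R K N \<kappa> s by (rule t[OF s])
    obtain p where "n = Suc p" "p \<ge> 1" using n by (cases n) auto
    then show ?thesis using t.tsum_rem_bound[of p] by (simp add: C_def power_mult_distrib mult.assoc del: of_nat_Suc)
  qed
  ultimately show ?thesis using that by blast
qed

lemma bint_has_integral:
  assumes "Re s \<le> 3 / 4"
  shows "((\<lambda>y. of_real (y * (1 - y)) powr (- s)) has_integral bint s) {0..1}"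
proof -
  define L where "L = nat \<lceil>- Re s\<rceil>"
  obtain R K N \<kappa> where t: "\<And>s. - real L \<le> Re s \<Longrightarrow> Re s \<le> 3 / 4 \<Longrightarrow> tornheim L 1 R K N \<kappa> s"
    using tornheim_exists[of 1] by (metis order_refl)
  interpret tornheim L 1 R K N \<kappa> s by (rule t) (use assms in \<open>auto simp: L_def\<close>, linarith)
  show ?thesis using bint_has_integral bint_eq by simp
qed

text \<open>As \<open>y * (1 - y) \<le> 1\<close>, the modulus of the integrand is at most its value
  for the exponent -3/4, which is an Euler Beta integrand.\<close>

lemma norm_bint_le:
  assumes "Re s \<le> 3 / 4"
  shows "norm (bint s) \<le> Beta (1/4) (1/4)"
proof -
  have b: "((\<lambda>t::real. t powr (1/4 - 1) * (1 - t) powr (1/4 - 1)) has_integral Beta (1/4) (1/4)) {0..1}"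
    by (rule has_integral_Beta_real) auto
  have "norm (integral {0..1} (\<lambda>y. complex_of_real (y * (1 - y)) powr (- s))) \<le> integral {0..1} (\<lambda>t::real. t powr (1/4 - 1) * (1 - t) powr (1/4 - 1))"
  proof (rule Henstock_Kurzweil_Integration.integral_norm_bound_integral)
    fix y :: real assume "y \<in> {0..1}"
    then have y: "0 \<le> y" "y \<le> 1" "0 \<le> y * (1 - y)" "y * (1 - y) \<le> 1" by (auto intro: mult_le_one)
    have "norm (complex_of_real (y * (1 - y)) powr (- s)) = (y * (1 - y)) powr (- Re s)"
      using norm_of_real_powr[OF y(3), of "- s"] by simp
    also have "\<dots> \<le> (y * (1 - y)) powr (- (3 / 4))"
      using y assms by (intro powr_mono') auto
    finally show "norm (complex_of_real (y * (1 - y)) powr (- s)) \<le> y powr (1/4 - 1) * (1 - y) powr (1/4 - 1)"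
      using y by (simp add: powr_mult)
  qed (use b bint_has_integral[OF assms] in auto)
  then show ?thesis using b by (simp add: bint_def integral_unique)
qed

lemma bint_two_thirds: "bint (2 / 3) = of_real (Beta (1/3) (1/3))"
proof -
  have "((\<lambda>t::real. t powr (1/3 - 1) * (1 - t) powr (1/3 - 1)) has_integral Beta (1/3) (1/3)) {0..1}"
    by (rule has_integral_Beta_real) auto
  then have "((\<lambda>t. complex_of_real (t powr (1/3 - 1) * (1 - t) powr (1/3 - 1))) has_integral of_real (Beta (1/3) (1/3))) {0..1}"
    by (rule has_integral_of_real)
  then have "((\<lambda>y. complex_of_real (y * (1 - y)) powr (- (2 / 3))) has_integral of_real (Beta (1/3) (1/3))) {0..1}"
  proof (rule has_integral_eq[rotated])
    fix y :: real assume "y \<in> {0..1}"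
    then have y: "0 \<le> y" "y \<le> 1" "0 \<le> y * (1 - y)" by auto
    have "complex_of_real (y * (1 - y)) powr (of_real (- (2 / 3))) = of_real ((y * (1 - y)) powr (- (2 / 3)))"
      using y by (subst powr_of_real) auto
    then show "complex_of_real (y powr (1/3 - 1) * (1 - y) powr (1/3 - 1)) = complex_of_real (y * (1 - y)) powr (- (2 / 3))"
      using y by (simp add: powr_mult)
  qed
  then show ?thesis unfolding bint_def by (intro integral_unique)
qed

subsection \<open>The double series\<close>

lemma has_sum_pairs_diagonal:
  fixes f :: "nat \<times> nat \<Rightarrow> 'a :: {topological_comm_monoid_add, t3_space}"
  assumes "(f has_sum S) ({1..} \<times> {1..})"
  shows "((\<lambda>n. \<Sum>j=1..<n. f (j, n - j)) has_sum S) UNIV"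
proof (rule has_sum_SigmaD[where f = "\<lambda>(n, j). f (j, n - j)" and B = "\<lambda>n. {1..<n}"])
  show "((\<lambda>(n, j). f (j, n - j)) has_sum S) (Sigma UNIV (\<lambda>n. {1..<n}))"
    by (subst has_sum_reindex_bij_witness[of _ "\<lambda>(j, k). (j + k, j)" "\<lambda>(n, j). (j, n - j)" "{1..} \<times> {1..}" f _ S S])
      (use assms in auto)
  show "((\<lambda>y. case (x, y) of (n, j) \<Rightarrow> f (j, n - j)) has_sum (\<Sum>j=1..<x. f (j, x - j))) {1..<x}" for x
    by simp
qed

lemma of_nat_powr_mult: "complex_of_nat (a * b) powr z = of_nat a powr z * of_nat b powr z"
  using of_real_powr_mult[of "real a" "real b" z] by simp

lemma norm_of_nat_powr: "norm (complex_of_nat n powr z) = real n powr Re z"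
  using norm_of_real_powr[of "real n" z] by simp

lemma norm_omega_term: "norm (omega_term s (j, k)) = real (j * k * (j + k)) powr (- Re s)"
  unfolding omega_term_def by (simp only: prod.case norm_of_nat_powr) simp

text \<open>From \<open>j + k \<ge> sqrt (j * k)\<close> the term is at most
  \<open>(j * k) powr (- a)\<close> with \<open>a = 3 * \<sigma> / 2 > 1\<close>, and the double
  series factors.\<close>

lemma omega_term_abs_summable:
  assumes "\<sigma> > 2 / 3"
  shows "(\<lambda>(j, k). real (j * k * (j + k)) powr (- \<sigma>)) summable_on ({1..} \<times> {1..})"
proof -
  define a where "a = 3 * \<sigma> / 2"
  have a: "a > 1" using assms by (simp add: a_def)
  have "summable (\<lambda>n. real n powr (- a))" using a by (simp add: summable_real_powr_iff)
  then have "(\<lambda>n. real n powr (- a)) summable_on UNIV" by (intro norm_summable_imp_summable_on) simp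
  then have s: "(\<lambda>n. real n powr (- a)) summable_on {1..}" by (rule summable_on_subset) auto
  define Z where "Z = infsum (\<lambda>n. real n powr (- a)) {1..}"
  have Z: "((\<lambda>n. real n powr (- a)) has_sum Z) {1..}" unfolding Z_def by (rule has_sum_infsum[OF s])
  have "(\<lambda>(j, k). real j powr (- a) * real k powr (- a)) summable_on ({1..} \<times> {1..})"
  proof (rule summable_on_SigmaI)
    show "((\<lambda>k. case (j, k) of (j, k) \<Rightarrow> real j powr (- a) * real k powr (- a)) has_sum real j powr (- a) * Z) {1..}" for j
      using has_sum_cmult_right[OF Z, of "real j powr (- a)"] by simp
    show "(\<lambda>j. real j powr (- a) * Z) summable_on {1..}"
      using s by (rule summable_on_cmult_left)
  qed auto
  then show ?thesis
  proof (rule summable_on_comparison_test)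
    fix x :: "nat \<times> nat" assume "x \<in> {1..} \<times> {1..}"
    then obtain j k where x: "x = (j, k)" "j \<ge> 1" "k \<ge> 1" by auto
    have "sqrt (real j * real k) \<le> real j + real k"
      using arith_geo_mean_sqrt[of "real j" "real k"] by simp
    then have "real j * real k * sqrt (real j * real k) \<le> real j * real k * (real j + real k)"
      by (intro mult_left_mono) auto
    then have "(real j * real k * (real j + real k)) powr (- \<sigma>) \<le> (real j * real k * sqrt (real j * real k)) powr (- \<sigma>)"
      using x assms by (intro powr_mono2') auto
    also have "real j * real k * sqrt (real j * real k) = (real j * real k) powr (3 / 2)"
      using x powr_add[of "real j * real k" 1 "1/2"] by (simp add: powr_half_sqrt)
    also have "((real j * real k) powr (3 / 2)) powr (- \<sigma>) = real j powr (- a) * real k powr (- a)"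
      by (simp add: powr_powr powr_mult a_def)
    finally show "(case x of (j, k) \<Rightarrow> real (j * k * (j + k)) powr (- \<sigma>)) \<le> (case x of (j, k) \<Rightarrow> real j powr (- a) * real k powr (- a))"
      by (simp add: x)
  qed auto
qed

text \<open>On the diagonal \<open>j + k = n\<close> the product is at most \<open>n ^ 3\<close>, so
  for \<open>\<sigma> \<le> 2 / 3\<close> each of the \<open>n - 1\<close> terms is at least
  \<open>n powr (- 2)\<close>. The diagonal sum thus dominates half the harmonic series.\<close>

lemma omega_term_not_summable:
  assumes "\<sigma> \<le> 2 / 3"
  shows "\<not> (\<lambda>(j, k). real (j * k * (j + k)) powr (- \<sigma>)) summable_on ({1..} \<times> {1..})"
proof
  let ?f = "\<lambda>(j, k). real (j * k * (j + k)) powr (- \<sigma>)"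
  assume "?f summable_on ({1..} \<times> {1..})"
  then have "(?f has_sum infsum ?f ({1..} \<times> {1..})) ({1..} \<times> {1..})" by simp
  from has_sum_pairs_diagonal[OF this]
  have "summable (\<lambda>n. \<Sum>j=1..<n. ?f (j, n - j))"
    using summable_on_imp_summable summable_on_def by blast
  then have "summable (\<lambda>n. inverse (real n) / 2)"
  proof (rule summable_comparison_test[rotated], intro exI allI impI)
    fix n :: nat assume n: "n \<ge> 2"
    have "real n powr (- 2) \<le> ?f (j, n - j)" if j: "j \<in> {1..<n}" for j
    proof -
      have le: "j * (n - j) * n \<le> n ^ 3"
        using j by (auto simp: power3_eq_cube intro!: mult_le_mono)
      have ge: "1 \<le> j * (n - j) * n" using j n by (auto simp: Suc_le_eq)
      have le': "real (j * (n - j) * n) \<le> real n ^ 3"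
        using of_nat_mono[OF le, where 'a = real] by (simp only: of_nat_power)
      have ge': "1 \<le> real (j * (n - j) * n)"
        using of_nat_mono[OF ge, where 'a = real] by (simp only: of_nat_1)
      have "real n powr (- 2) = (real n ^ 3) powr (- (2 / 3))"
        using n by (simp add: powr_powr flip: powr_numeral)
      also have "\<dots> \<le> real (j * (n - j) * n) powr (- (2 / 3))"
        using le' ge' by (intro powr_mono2') linarith+
      also have "\<dots> \<le> real (j * (n - j) * n) powr (- \<sigma>)"
        using ge' assms by (intro powr_mono) linarith+
      also have "\<dots> = ?f (j, n - j)" using j by simp
      finally show ?thesis .
    qed
    then have "(\<Sum>j=1..<n. real n powr (- 2)) \<le> (\<Sum>j=1..<n. ?f (j, n - j))"
      by (intro sum_mono)
    moreover have "inverse (real n) / 2 \<le> (\<Sum>j=1..<n. real n powr (- 2))"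
      using n by (simp add: powr_minus powr_numeral of_nat_diff field_simps power2_eq_square)
    ultimately show "norm (inverse (real n) / 2) \<le> (\<Sum>j=1..<n. ?f (j, n - j))"
      using n by simp
  qed
  then have "summable (\<lambda>n. inverse (real n))" by (simp add: summable_divide_iff)
  then show False using not_summable_harmonic by blast
qed

text \<open>Unordered summability of complex families is absolute, so only \<open>Re s\<close>
  matters.\<close>

lemma omega_term_summable_iff: "omega_term s summable_on ({1..} \<times> {1..}) \<longleftrightarrow> Re s > 2 / 3"
proof -
  have "omega_term s summable_on ({1..} \<times> {1..}) \<longleftrightarrow> (\<lambda>x. norm (omega_term s x)) summable_on ({1..} \<times> {1..})"
    by (rule summable_on_iff_abs_summable_on_complex)
  also have "(\<lambda>x. norm (omega_term s x)) = (\<lambda>(j, k). real (j * k * (j + k)) powr (- Re s))"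
    by (simp add: fun_eq_iff norm_omega_term del: of_nat_mult of_nat_add)
  finally show ?thesis
    using omega_term_abs_summable[of "Re s"] omega_term_not_summable[of "Re s"] by (meson not_le)
qed

lemma omega_term_diagonal:
  assumes "j \<in> {1..<n}"
  shows "omega_term s (j, n - j) = of_nat n powr (- s) * of_nat (j * (n - j)) powr (- s)"
  unfolding omega_term_def prod.case using of_nat_powr_mult[of "j * (n - j)" n "- s"] assms by simp

definition omegaR :: "real \<Rightarrow> nat \<Rightarrow> real" where
  "omegaR \<sigma> n = (\<Sum>j=1..<n. real (j * (n - j) * n) powr (- \<sigma>))"

lemma omegaR_eq: "omegaR \<sigma> n = (\<Sum>j=1..<n. (\<lambda>(j, k). real (j * k * (j + k)) powr (- \<sigma>)) (j, n - j))"
  unfolding omegaR_def by (intro sum.cong) auto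

lemma summable_omegaR:
  assumes "\<sigma> > 2 / 3"
  shows "summable (omegaR \<sigma>)"
  unfolding omegaR_eq[abs_def]
  using has_sum_pairs_diagonal[OF has_sum_infsum[OF omega_term_abs_summable[OF assms]]] summable_on_imp_summable summable_on_def by blast

lemma norm_diagonal_le:
  assumes "\<sigma> \<le> Re s"
  shows "norm (of_nat n powr (- s) * tsum s n) \<le> omegaR \<sigma> n"
  unfolding tsum_def omegaR_def sum_distrib_left
proof (intro sum_norm_le)
  fix j assume j: "j \<in> {1..<n}"
  have "norm (of_nat n powr (- s) * of_nat (j * (n - j)) powr (- s)) = norm (of_nat (n * (j * (n - j))) powr (- s))"
    by (simp only: of_nat_powr_mult)
  also have "\<dots> = real (n * (j * (n - j))) powr (- Re s)"
    by (simp only: norm_of_nat_powr) simp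
  also have "\<dots> \<le> real (n * (j * (n - j))) powr (- \<sigma>)"
  proof -
    have "1 \<le> n * (j * (n - j))" using j by (auto simp: Suc_le_eq)
    from of_nat_mono[OF this, where 'a = real] have "1 \<le> real (n * (j * (n - j)))" by (simp only: of_nat_1)
    then show ?thesis using assms by (intro powr_mono) linarith+
  qed
  finally show "norm (of_nat n powr (- s) * of_nat (j * (n - j)) powr (- s)) \<le> real (j * (n - j) * n) powr (- \<sigma>)"
    by (simp add: mult_ac)
qed

lemma omega_sums:
  assumes "Re s > 2 / 3"
  shows "(\<lambda>n. of_nat n powr (- s) * tsum s n) sums omega s"
proof -
  have "(omega_term s has_sum omega s) ({1..} \<times> {1..})"
    unfolding omega_def using omega_term_summable_iff assms by (intro has_sum_infsum) auto
  then have "(\<lambda>n. \<Sum>j=1..<n. omega_term s (j, n - j)) sums omega s"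
    by (intro has_sum_imp_sums has_sum_pairs_diagonal)
  also have "(\<lambda>n. \<Sum>j=1..<n. omega_term s (j, n - j)) = (\<lambda>n. of_nat n powr (- s) * tsum s n)"
    unfolding tsum_def sum_distrib_left by (intro ext sum.cong refl omega_term_diagonal)
  finally show ?thesis .
qed

lemma norm_omega_le:
  assumes "2 / 3 < \<sigma>" "\<sigma> \<le> Re s"
  shows "norm (omega s) \<le> suminf (omegaR \<sigma>)"
proof -
  have "omega s = (\<Sum>n. of_nat n powr (- s) * tsum s n)"
    using omega_sums[of s] assms by (simp add: sums_iff)
  also have "norm \<dots> \<le> suminf (omegaR \<sigma>)"
    by (intro norm_suminf_le summable_omegaR norm_diagonal_le assms)
  finally show ?thesis .
qed

lemma holomorphic_of_nat_powr [holomorphic_intros]: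
  assumes "f holomorphic_on S"
  shows "(\<lambda>s. of_nat n powr f s) holomorphic_on S"
  by (cases "n = 0") (use assms in \<open>auto intro!: holomorphic_intros\<close>)

lemma holomorphic_tsum [holomorphic_intros]: "(\<lambda>s. tsum s n) holomorphic_on S"
  unfolding tsum_def by (intro holomorphic_intros)

lemma holomorphic_omega: "omega holomorphic_on {s. Re s > 2 / 3}"
proof -
  have S: "open {s. Re s > 2 / 3}" by (rule open_halfspace_Re_gt)
  have "(\<lambda>s. \<Sum>n. of_nat n powr (- s) * tsum s n) holomorphic_on {s. Re s > 2 / 3}"
  proof (rule holomorphic_series[OF S])
    show "(\<lambda>s. of_nat n powr (- s) * tsum s n) holomorphic_on {s. Re s > 2 / 3}" for n
      by (intro holomorphic_intros)
  next
    fix x assume "x \<in> {s. Re s > 2 / 3}"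
    define \<sigma> where "\<sigma> = (Re x + 2 / 3) / 2"
    have \<sigma>: "2 / 3 < \<sigma>" "\<sigma> < Re x" using \<open>x \<in> _\<close> by (auto simp: \<sigma>_def)
    have *: "\<sigma> \<le> Re z" if "z \<in> cball x (Re x - \<sigma>)" for z
      using that abs_Re_le_cmod[of "x - z"] by (simp add: dist_norm)
    show "\<exists>d>0. \<exists>M. cball x d \<subseteq> {s. Re s > 2 / 3} \<and> summable M \<and> (\<forall>n. \<forall>z\<in>cball x d. norm (of_nat n powr (- z) * tsum z n) \<le> M n)"
    proof (intro exI conjI allI ballI)
      show "Re x - \<sigma> > 0" using \<sigma> by simp
      show "cball x (Re x - \<sigma>) \<subseteq> {s. Re s > 2 / 3}" using * \<sigma> by force
      show "summable (omegaR \<sigma>)" by (rule summable_omegaR[OF \<sigma>(1)])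
      show "norm (of_nat n powr (- z) * tsum z n) \<le> omegaR \<sigma> n" if "z \<in> cball x (Re x - \<sigma>)" for n z
        by (rule norm_diagonal_le[OF *[OF that]])
    qed
  qed
  then show ?thesis
    by (rule holomorphic_transform) (use omega_sums in \<open>auto simp: sums_iff\<close>)
qed

subsection \<open>Continuation to the left\<close>

lemma norm_le_cball: "z \<in> cball x d \<Longrightarrow> norm (z :: complex) \<le> norm x + d"
  using norm_triangle_ineq2[of z x] by (simp add: dist_norm norm_minus_commute)

lemma strip_open: "open {s. - real L < Re s \<and> Re s < 3 / 4}"
  by (intro open_Collect_conj open_halfspace_Re_gt open_halfspace_Re_lt)

text \<open>Instead of differentiating under the integral, the asymptotic expansion is solved for
  \<open>bint\<close>: it is a locally uniform limit of the visibly holomorphic functions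
  \<open>f n\<close>.\<close>

lemma holomorphic_bint: "bint holomorphic_on {s. Re s < 3 / 4}"
proof -
  have "bint holomorphic_on {s. - real L < Re s \<and> Re s < 3 / 4}" (is "_ holomorphic_on ?S") for L
  proof -
    \<comment> \<open>The remainder is then \<open>O(n powr (- 3))\<close>. The factor
      \<open>n powr (3 * s - 1)\<close> is bounded by \<open>n powr 2\<close> for
      \<open>Re s \<le> 3 / 4\<close>, so the error is \<open>O(1 / n)\<close>.\<close>
    define M where "M = 2 * L + 4"
    have M1: "M \<ge> 1" by (simp add: M_def)
    obtain C k where C: "C \<ge> 0" "\<And>s n. - real L \<le> Re s \<Longrightarrow> Re s \<le> 3 / 4 \<Longrightarrow> n \<ge> 2 \<Longrightarrow>
       norm (tsum_rem M s n) \<le> C * (1 + norm s) ^ k * real n powr (2 * real L + 1 - real M)"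
      using tsum_rem_bound_uniform[of M L] M1 by blast
    define f where "f n s = of_nat (n + 2) powr (3 * s - 1) * (of_nat (n + 2) powr (- s) * tsum s (n + 2)
      - 2 * (\<Sum>m<M. pochhammer s m / fact m * of_nat (n + 2) powr (- 2 * s - of_nat m) * riemann_zeta (s - of_nat m)))" for n s
    have f_eq: "f n s - bint s = of_nat (n + 2) powr (3 * s - 1) * tsum_rem M s (n + 2)" for n s
    proof -
      have "complex_of_nat (n + 2) \<noteq> 0" by (simp only: of_nat_eq_0_iff)
      then have "of_nat (n + 2) powr (3 * s - 1) * of_nat (n + 2) powr (1 - 3 * s) = (1 :: complex)"
        by (simp flip: powr_add del: of_nat_add)
      then have "bint s = of_nat (n + 2) powr (3 * s - 1) * (of_nat (n + 2) powr (1 - 3 * s) * bint s)"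
        by (metis mult.assoc mult_1_left)
      then show ?thesis unfolding f_def tsum_rem_def tsum_main_def
        by (simp only: ring_distribs diff_diff_eq add.commute)
    qed
    show ?thesis
    proof (rule holomorphic_uniform_sequence[OF strip_open])
      show "f n holomorphic_on ?S" for n
      proof -
        have "s - of_nat m \<noteq> 1" if "s \<in> ?S" for s m
        proof
          assume "s - of_nat m = 1"
          then have "Re (s - of_nat m) = 1" by simp
          then show False using that by simp
        qed
        then show ?thesis unfolding f_def pochhammer_prod
          by (intro holomorphic_intros) auto
      qed
    next
      fix x assume "x \<in> ?S"
      then obtain d where d: "d > 0" "cball x d \<subseteq> ?S" using strip_open open_contains_cball by blast
      define B where "B = C * (1 + (norm x + d)) ^ k"
      have bound: "norm (f n s - bint s) \<le> B * real (n + 2) powr (- 1)" if s: "s \<in> cball x d" for n s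
      proof -
        have sS: "- real L \<le> Re s" "Re s \<le> 3 / 4" using d s by auto
        have "norm (f n s - bint s) = real (n + 2) powr (3 * Re s - 1) * norm (tsum_rem M s (n + 2))"
          unfolding f_eq norm_mult norm_of_nat_powr by simp
        also have "\<dots> \<le> real (n + 2) powr 2 * (C * (1 + norm s) ^ k * real (n + 2) powr (2 * real L + 1 - real M))"
          using sS by (intro mult_mono powr_mono C) auto
        also have "\<dots> = C * (1 + norm s) ^ k * (real (n + 2) powr 2 * real (n + 2) powr (2 * real L + 1 - real M))"
          by (simp only: mult_ac)
        also have "real (n + 2) powr 2 * real (n + 2) powr (2 * real L + 1 - real M) = real (n + 2) powr (- 1)"
          by (subst powr_add[symmetric]) (simp add: M_def)
        also have "C * (1 + norm s) ^ k * real (n + 2) powr (- 1) \<le> B * real (n + 2) powr (- 1)"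
          unfolding B_def using C(1) norm_le_cball[OF s] by (intro mult_right_mono mult_left_mono power_mono) auto
        finally show ?thesis .
      qed
      have "uniform_limit (cball x d) f bint sequentially"
      proof (rule uniform_limitI)
        fix e :: real assume "e > 0"
        have "(\<lambda>n. B * real (n + 2) powr (- 1)) \<longlonglongrightarrow> B * 0"
          using LIMSEQ_ignore_initial_segment[OF tendsto_neg_powr[OF _ filterlim_real_sequentially, of "-1"], of 2]
          by (intro tendsto_mult tendsto_const) simp
        then have "\<forall>\<^sub>F n in sequentially. B * real (n + 2) powr (- 1) < e"
          using \<open>e > 0\<close> by (intro order_tendstoD(2)) auto
        then show "\<forall>\<^sub>F n in sequentially. \<forall>s\<in>cball x d. dist (f n s) (bint s) < e"
        proof eventually_elim
          case (elim n)
          show ?case unfolding dist_norm using le_less_trans[OF bound elim] by blast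
        qed
      qed
      then show "\<exists>d>0. cball x d \<subseteq> ?S \<and> uniform_limit (cball x d) f bint sequentially"
        using d by blast
    qed
  qed
  then have "bint field_differentiable at s" if "Re s < 3 / 4" for s
  proof -
    define L where "L = Suc (nat \<lceil>- Re s\<rceil>)"
    have "- real L < Re s" unfolding L_def by linarith
    then show ?thesis
      using that holomorphic_on_imp_differentiable_at[OF \<open>\<And>L. bint holomorphic_on {s. - real L < Re s \<and> Re s < 3 / 4}\<close>[of L] strip_open]
      by simp
  qed
  then show ?thesis by (simp add: holomorphic_on_def field_differentiable_at_within)
qed

abbreviation strip :: "nat \<Rightarrow> complex set" where
  "strip L \<equiv> {s. - real L < Re s \<and> Re s < 3 / 4}"

text \<open>The series includes \<open>n = 1\<close>, where \<open>tsum\<close> is an empty sum and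
  the remainder is minus the main terms. The uniform remainder bounds begin only at
  \<open>n = 2\<close>, hence the repeated splitting off of the first term below.\<close>

definition omega_left :: "nat \<Rightarrow> complex \<Rightarrow> complex" where
  "omega_left M s = bint s * riemann_zeta (3 * s - 1)
     + 2 * (\<Sum>m<M. pochhammer s m / fact m * (riemann_zeta (2 * s + of_nat m) * riemann_zeta (s - of_nat m)))
     + (\<Sum>n. tsum_rem M s (Suc n))"

lemma tsum_rem_bound_summable:
  assumes "M \<ge> 2 * L + 3"
  obtains C k where "C \<ge> 0" "\<And>s n. - real L \<le> Re s \<Longrightarrow> Re s \<le> 3 / 4 \<Longrightarrow>
     norm (tsum_rem M s (n + 2)) \<le> C * (1 + norm s) ^ k * (1 / real (Suc n) ^ 2)"
proof -
  have "M \<ge> 1" using assms by simp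
  then obtain C k where C: "C \<ge> 0" "\<And>s n. - real L \<le> Re s \<Longrightarrow> Re s \<le> 3 / 4 \<Longrightarrow> n \<ge> 2 \<Longrightarrow>
       norm (tsum_rem M s n) \<le> C * (1 + norm s) ^ k * real n powr (2 * real L + 1 - real M)"
    using tsum_rem_bound_uniform[of M L] by blast
  have "norm (tsum_rem M s (n + 2)) \<le> C * (1 + norm s) ^ k * (1 / real (Suc n) ^ 2)"
    if s: "- real L \<le> Re s" "Re s \<le> 3 / 4" for s n
  proof -
    have "norm (tsum_rem M s (n + 2)) \<le> C * (1 + norm s) ^ k * real (n + 2) powr (2 * real L + 1 - real M)"
      using s by (intro C) auto
    also have "\<dots> \<le> C * (1 + norm s) ^ k * (1 / real (Suc n) ^ 2)"
    proof (intro mult_left_mono)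
      have "real M \<ge> 2 * real L + 3" using of_nat_mono[OF assms, where 'a = real] by simp
      then have "real (n + 2) powr (2 * real L + 1 - real M) \<le> real (n + 2) powr (- 2)"
        by (intro powr_mono) auto
      also have "\<dots> \<le> real (Suc n) powr (- 2)" by (intro powr_mono2') auto
      also have "\<dots> = 1 / real (Suc n) ^ 2" by (simp add: powr_minus powr_numeral divide_inverse)
      finally show "real (n + 2) powr (2 * real L + 1 - real M) \<le> 1 / real (Suc n) ^ 2" .
    qed (use C(1) in auto)
    finally show ?thesis .
  qed
  with C(1) show ?thesis using that by blast
qed

lemma summable_tsum_rem:
  assumes "M \<ge> 2 * L + 3" "- real L \<le> Re s" "Re s \<le> 3 / 4"
  shows "summable (\<lambda>n. tsum_rem M s (Suc n))"
proof -
  obtain C k where C: "C \<ge> 0" "\<And>s n. - real L \<le> Re s \<Longrightarrow> Re s \<le> 3 / 4 \<Longrightarrow>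
     norm (tsum_rem M s (n + 2)) \<le> C * (1 + norm s) ^ k * (1 / real (Suc n) ^ 2)"
    using tsum_rem_bound_summable[OF assms(1)] by blast
  have "summable (\<lambda>n. tsum_rem M s (n + 2))"
    by (rule summable_comparison_test'[where N = 0, OF summable_mult[OF summable_inverse_squares_sum]]) (rule C(2)[OF assms(2,3)])
  then show ?thesis
    using summable_Suc_iff[of "\<lambda>n. tsum_rem M s (Suc n)"] by simp
qed

text \<open>The new term is subtracted from each remainder and added back as a zeta value; the
  Dirichlet series converges since \<open>Re (2 * s + M) \<ge> 3\<close>.\<close>

lemma omega_left_Suc:
  assumes "M \<ge> 2 * L + 3" "- real L \<le> Re s" "Re s \<le> 3 / 4"
  shows "omega_left (Suc M) s = omega_left M s"
proof -
  define c where "c = 2 * (pochhammer s M / fact M) * riemann_zeta (s - of_nat M)"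
  have eq: "tsum_rem (Suc M) s (Suc n) = tsum_rem M s (Suc n) - c * of_nat (Suc n) powr (- (2 * s + of_nat M))" for n
  proof -
    have e: "- (2 * s + of_nat M) = - 2 * s - of_nat M" by simp
    show ?thesis unfolding e tsum_rem_def tsum_main_def c_def
      by (simp add: algebra_simps del: of_nat_Suc)
  qed
  have M: "real M \<ge> 2 * real L + 3" using of_nat_mono[OF assms(1), where 'a = real] by simp
  have "(\<lambda>n. of_nat (Suc n) powr (- (2 * s + of_nat M))) sums riemann_zeta (2 * s + of_nat M)"
    using assms M by (intro riemann_zeta_sums) auto
  then have "(\<lambda>n. tsum_rem (Suc M) s (Suc n)) sums ((\<Sum>n. tsum_rem M s (Suc n)) - c * riemann_zeta (2 * s + of_nat M))"
    unfolding eq by (intro sums_diff sums_mult summable_sums summable_tsum_rem[OF assms])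
  then have "(\<Sum>n. tsum_rem (Suc M) s (Suc n)) = (\<Sum>n. tsum_rem M s (Suc n)) - c * riemann_zeta (2 * s + of_nat M)"
    by (rule sums_unique[symmetric])
  then show ?thesis by (simp add: omega_left_def c_def ring_distribs mult_ac)
qed

lemma omega_left_mono:
  assumes "M \<ge> 2 * L + 3" "- real L \<le> Re s" "Re s \<le> 3 / 4" "M \<le> M'"
  shows "omega_left M' s = omega_left M s"
  using assms(4)
proof (induction rule: dec_induct)
  case (step n)
  then show ?case using omega_left_Suc[of L n s] assms by simp
qed simp

text \<open>On this overlap \<open>Re (3 * s - 1)\<close> and \<open>Re (2 * s + m)\<close> exceed
  1, so all zeta factors are convergent series and the expansion is summed term by term.\<close>

lemma omega_left_eq_omega:
  assumes "M \<ge> 2 * L + 3" "2 / 3 < Re s" "Re s \<le> 3 / 4"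
  shows "omega_left M s = omega s"
proof -
  have "(\<lambda>n. of_nat (Suc n) powr (- s) * tsum s (Suc n)) sums omega s"
    using omega_sums[OF assms(2)] by (subst sums_Suc_iff) simp
  moreover have "(\<lambda>n. of_nat (Suc n) powr (- s) * tsum s (Suc n)) sums omega_left M s"
  proof -
    have 1: "(\<lambda>n. of_nat (Suc n) powr (- (3 * s - 1)) * bint s) sums (riemann_zeta (3 * s - 1) * bint s)"
      using assms by (intro sums_mult2 riemann_zeta_sums) auto
    have 2: "(\<lambda>n. of_nat (Suc n) powr (- (2 * s + of_nat m)) * (pochhammer s m / fact m * riemann_zeta (s - of_nat m)))
        sums (riemann_zeta (2 * s + of_nat m) * (pochhammer s m / fact m * riemann_zeta (s - of_nat m)))" for m
      using assms by (intro sums_mult2 riemann_zeta_sums) auto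
    have "(\<lambda>n. of_nat (Suc n) powr (- (3 * s - 1)) * bint s
        + 2 * (\<Sum>m<M. of_nat (Suc n) powr (- (2 * s + of_nat m)) * (pochhammer s m / fact m * riemann_zeta (s - of_nat m)))
        + tsum_rem M s (Suc n)) sums
       (riemann_zeta (3 * s - 1) * bint s
        + 2 * (\<Sum>m<M. riemann_zeta (2 * s + of_nat m) * (pochhammer s m / fact m * riemann_zeta (s - of_nat m)))
        + (\<Sum>n. tsum_rem M s (Suc n)))"
      using assms by (intro sums_add 1 2 sums_mult sums_sum summable_sums summable_tsum_rem[of L]) auto
    also have "(\<lambda>n. of_nat (Suc n) powr (- (3 * s - 1)) * bint s
        + 2 * (\<Sum>m<M. of_nat (Suc n) powr (- (2 * s + of_nat m)) * (pochhammer s m / fact m * riemann_zeta (s - of_nat m)))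
        + tsum_rem M s (Suc n)) = (\<lambda>n. of_nat (Suc n) powr (- s) * tsum s (Suc n))"
    proof
      fix n
      have e: "- (3 * s - 1) = 1 - 3 * s" "- (2 * s + of_nat m) = - 2 * s - of_nat m" for m by simp_all
      show "of_nat (Suc n) powr (- (3 * s - 1)) * bint s
        + 2 * (\<Sum>m<M. of_nat (Suc n) powr (- (2 * s + of_nat m)) * (pochhammer s m / fact m * riemann_zeta (s - of_nat m)))
        + tsum_rem M s (Suc n) = of_nat (Suc n) powr (- s) * tsum s (Suc n)"
        unfolding e tsum_rem_def tsum_main_def by (simp add: mult_ac del: of_nat_Suc)
    qed
    finally show ?thesis by (simp add: omega_left_def mult_ac)
  qed
  ultimately show ?thesis using sums_unique2 by blast
qed

text \<open>At the points \<open>zpole m\<close> with odd \<open>m\<close> the value of \<open>omega_ext\<close> is junk, because \<open>riemann_zeta 1 = 0\<close>; these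
  singularities are removable.\<close>

definition omega_ext :: "complex \<Rightarrow> complex" where
  "omega_ext s = (if Re s > 2 / 3 then omega s else omega_left (2 * nat \<lceil>- Re s\<rceil> + 3) s)"

text \<open>Although the truncation in \<open>omega_ext\<close> jumps with \<open>Re s\<close>, a
  single \<open>omega_left\<close> represents it on a whole strip, across the line
  \<open>Re s = 2 / 3\<close> included.\<close>

lemma omega_ext_eq:
  assumes "M \<ge> 2 * L + 3" "- real L \<le> Re s" "Re s \<le> 3 / 4"
  shows "omega_ext s = omega_left M s"
proof (cases "Re s > 2 / 3")
  case True
  then show ?thesis using omega_left_eq_omega assms by (simp add: omega_ext_def)
next
  case False
  define L' where "L' = nat \<lceil>- Re s\<rceil>"
  have "- real L' \<le> Re s" unfolding L'_def by linarith
  moreover have "L' \<le> L" unfolding L'_def using assms by linarith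
  ultimately have "omega_left M s = omega_left (2 * L' + 3) s"
    using assms by (intro omega_left_mono[of L']) auto
  then show ?thesis using False by (simp add: omega_ext_def L'_def)
qed

lemma strip_diff_nat_neq_1: "s \<in> strip L \<Longrightarrow> s - of_nat m \<noteq> 1"
proof
  assume "s \<in> strip L" "s - of_nat m = 1"
  then have "Re (s - of_nat m) = 1" by simp
  then show False using \<open>s \<in> strip L\<close> by simp
qed

lemma holomorphic_tsum_rem: "(\<lambda>s. tsum_rem M s n) holomorphic_on strip L"
proof -
  have "bint holomorphic_on strip L"
    by (rule holomorphic_on_subset[OF holomorphic_bint]) auto
  then show ?thesis
    unfolding tsum_rem_def tsum_main_def pochhammer_prod
    by (intro holomorphic_intros strip_diff_nat_neq_1[of _ L]) auto
qed

lemma holomorphic_tsum_rem_suminf: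
  assumes "M \<ge> 2 * L + 3"
  shows "(\<lambda>s. \<Sum>n. tsum_rem M s (Suc n)) holomorphic_on strip L"
proof -
  obtain C k where C: "C \<ge> 0" "\<And>s n. - real L \<le> Re s \<Longrightarrow> Re s \<le> 3 / 4 \<Longrightarrow>
     norm (tsum_rem M s (n + 2)) \<le> C * (1 + norm s) ^ k * (1 / real (Suc n) ^ 2)"
    using tsum_rem_bound_summable[OF assms(1)] by blast
  have "(\<lambda>s. \<Sum>n. tsum_rem M s (n + 2)) holomorphic_on strip L"
  proof (rule holomorphic_series[OF strip_open holomorphic_tsum_rem])
    fix x assume "x \<in> strip L"
    then obtain d where d: "d > 0" "cball x d \<subseteq> strip L" using strip_open open_contains_cball by blast
    show "\<exists>d>0. \<exists>B. cball x d \<subseteq> strip L \<and> summable B \<and> (\<forall>n. \<forall>z\<in>cball x d. norm (tsum_rem M z (n + 2)) \<le> B n)"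
    proof (intro exI conjI allI ballI)
      show "summable (\<lambda>n. C * (1 + (norm x + d)) ^ k * (1 / real (Suc n) ^ 2))"
        by (intro summable_mult summable_inverse_squares_sum)
      fix n z assume z: "z \<in> cball x d"
      have "norm (tsum_rem M z (n + 2)) \<le> C * (1 + norm z) ^ k * (1 / real (Suc n) ^ 2)"
        using z d by (intro C) auto
      also have "\<dots> \<le> C * (1 + (norm x + d)) ^ k * (1 / real (Suc n) ^ 2)"
        using C(1) norm_le_cball[OF z] by (intro mult_right_mono mult_left_mono power_mono) auto
      finally show "norm (tsum_rem M z (n + 2)) \<le> C * (1 + (norm x + d)) ^ k * (1 / real (Suc n) ^ 2)" .
    qed (use d in auto)
  qed
  then have "(\<lambda>s. tsum_rem M s 1 + (\<Sum>n. tsum_rem M s (n + 2))) holomorphic_on strip L"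
    by (intro holomorphic_intros holomorphic_tsum_rem)
  then show ?thesis
  proof (rule holomorphic_transform)
    fix s assume "s \<in> strip L"
    then have "summable (\<lambda>n. tsum_rem M s (Suc n))" using assms by (intro summable_tsum_rem[of L]) auto
    from suminf_split_head[OF this]
    show "tsum_rem M s 1 + (\<Sum>n. tsum_rem M s (n + 2)) = (\<Sum>n. tsum_rem M s (Suc n))" by simp
  qed
qed

section \<open>Principal parts at the candidate poles\<close>

definition zpole :: "nat \<Rightarrow> complex" where
  "zpole m = (1 - of_nat m) / 2"

text \<open>Numerator over \<open>s - zpole m\<close> of the \<open>m\<close>-th term of
  \<open>omega_left\<close>: the pole of \<open>riemann_zeta (2 * s + m)\<close> is cleared by
  \<open>zeta_ent\<close>, and the leading factor 2 cancels against
  \<open>2 * s + m - 1 = 2 * (s - zpole m)\<close>. The division by 3 in \<open>bcoeff\<close> comes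
  likewise from \<open>3 * s - 2\<close>.\<close>

definition zcoeff :: "nat \<Rightarrow> complex \<Rightarrow> complex" where
  "zcoeff m s = pochhammer s m / fact m * (zeta_ent (2 * s + of_nat m) * riemann_zeta (s - of_nat m))"

definition bcoeff :: "complex \<Rightarrow> complex" where
  "bcoeff s = bint s * zeta_ent (3 * s - 1) / 3"

lemma holomorphic_zcoeff: "zcoeff m holomorphic_on strip L"
  unfolding zcoeff_def[abs_def] pochhammer_prod
  by (intro holomorphic_intros strip_diff_nat_neq_1[of _ L]) auto

lemma holomorphic_bcoeff: "bcoeff holomorphic_on strip L"
proof -
  have "bint holomorphic_on strip L"
    by (rule holomorphic_on_subset[OF holomorphic_bint]) auto
  then show ?thesis unfolding bcoeff_def[abs_def] by (intro holomorphic_intros) auto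
qed

lemma omega_ext_decomp:
  assumes "M \<ge> 2 * L + 3" "s \<in> strip L" "s \<noteq> 2 / 3" "\<And>m. m < M \<Longrightarrow> s \<noteq> zpole m"
  shows "omega_ext s = bcoeff s / (s - 2 / 3) + (\<Sum>m<M. zcoeff m s / (s - zpole m)) + (\<Sum>n. tsum_rem M s (Suc n))"
proof -
  have "omega_ext s = omega_left M s" using assms by (intro omega_ext_eq[of L]) auto
  moreover have "bint s * riemann_zeta (3 * s - 1) = bcoeff s / (s - 2 / 3)"
  proof -
    have ne: "3 * s - 1 \<noteq> 1" "s - 2 / 3 \<noteq> 0" using assms(3) by (auto simp: field_simps)
    have "3 * s - 1 - 1 = 3 * (s - 2 / 3)" by (simp add: algebra_simps)
    then show ?thesis by (simp only: riemann_zeta_conv_zeta_ent[OF ne(1)] bcoeff_def) simp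
  qed
  moreover have "2 * (pochhammer s m / fact m * (riemann_zeta (2 * s + of_nat m) * riemann_zeta (s - of_nat m)))
     = zcoeff m s / (s - zpole m)" if "m < M" for m
  proof -
    have eq: "2 * s + of_nat m - 1 = 2 * (s - zpole m)" by (simp add: zpole_def field_simps)
    have "s - zpole m \<noteq> 0" using assms(4)[OF that] by simp
    then have ne: "2 * s + of_nat m \<noteq> 1" using eq by (metis eq_iff_diff_eq_0 mult_eq_0_iff zero_neq_numeral)
    have "2 * (a * (e / (2 * d) * r)) = a * (e * r) / d" for a e d r :: complex by simp
    then show ?thesis by (simp only: riemann_zeta_conv_zeta_ent[OF ne] zcoeff_def eq)
  qed
  ultimately show ?thesis by (simp add: omega_left_def sum_distrib_left)
qed

text \<open>With \<open>g w = A w + B w * (w - z)\<close> the function is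
  \<open>g w / (w - z)\<close> and \<open>g z = A z\<close>. If this is 0 the quotient tends to the
  derivative of \<open>g\<close>; keeping both alternatives treats even and odd \<open>zpole\<close>
  alike.\<close>

lemma simple_pole_decomp:
  assumes U: "open U" "z \<in> U" and A: "A holomorphic_on U" and B: "B holomorphic_on U"
    and f: "\<And>w. w \<in> U \<Longrightarrow> w \<noteq> z \<Longrightarrow> f w = A w / (w - z) + B w"
  shows "isolated_singularity_at f z" "not_essential f z"
    and "A z \<noteq> 0 \<Longrightarrow> is_pole f z \<and> zorder f z = - 1 \<and> residue f z = A z"
    and "A z = 0 \<Longrightarrow> \<exists>c. f \<midarrow>z\<rightarrow> c"
proof -
  define g where "g w = A w + B w * (w - z)" for w
  have g: "g holomorphic_on U" unfolding g_def by (intro holomorphic_intros A B)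
  have gz: "g z = A z" by (simp add: g_def)
  have fg: "f w = g w / (w - z)" if "w \<in> U" "w \<noteq> z" for w
    using f[OF that] that by (simp add: g_def add_divide_distrib)
  have ev: "\<forall>\<^sub>F w in at z. f w = g w / (w - z)"
    using eventually_at_in_open[OF U(1,2)] by eventually_elim (use fg in auto)
  show iso: "isolated_singularity_at f z"
  proof (rule isolated_singularity_at_holomorphic[OF _ U])
    show "f holomorphic_on U - {z}"
      by (rule holomorphic_transform[of "\<lambda>w. g w / (w - z)"])
         (use fg in \<open>auto intro!: holomorphic_intros holomorphic_on_subset[OF g]\<close>)
  qed
  have cont: "isCont g z"
    using g U holomorphic_on_imp_differentiable_at field_differentiable_imp_continuous_at by blast
  have pole: "is_pole f z \<and> zorder f z = - 1 \<and> residue f z = A z" if "A z \<noteq> 0"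
  proof (intro conjI)
    have "filterlim (\<lambda>w. w - z) (at 0) (at z)" by (rule filterlim_atI) (auto intro!: tendsto_eq_intros simp: eventually_at_filter)
    then have "is_pole (\<lambda>w. g w / (w - z)) z" using that cont gz by (intro is_pole_divide) auto
    then show "is_pole f z" using is_pole_cong[OF ev refl] by simp
    show "zorder f z = - 1"
      by (rule zorder_eqI[OF U g]) (use that gz fg in \<open>auto simp: field_simps\<close>)
    show "residue f z = A z"
      using residue_simple[OF U g] residue_cong[OF ev refl] gz by simp
  qed
  then show "A z \<noteq> 0 \<Longrightarrow> is_pole f z \<and> zorder f z = - 1 \<and> residue f z = A z" .
  have rem: "\<exists>c. f \<midarrow>z\<rightarrow> c" if "A z = 0"
  proof -
    have "(g has_field_derivative deriv g z) (at z)" using g U by (intro holomorphic_derivI)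
    then have "(\<lambda>w. (g w - g z) / (w - z)) \<midarrow>z\<rightarrow> deriv g z" by (simp add: has_field_derivative_iff)
    then have "(\<lambda>w. g w / (w - z)) \<midarrow>z\<rightarrow> deriv g z" using that gz by simp
    then show ?thesis using tendsto_cong[OF ev] by blast
  qed
  then show "A z = 0 \<Longrightarrow> \<exists>c. f \<midarrow>z\<rightarrow> c" .
  show "not_essential f z" using pole rem by (cases "A z = 0") (auto simp: not_essential_def)
qed

lemma Re_zpole: "Re (zpole m) = (1 - real m) / 2"
  by (simp add: zpole_def)

lemma inj_zpole: "zpole m = zpole n \<longleftrightarrow> m = n"
  by (simp add: zpole_def)

lemma zpole_neq_two_thirds: "zpole m \<noteq> 2 / 3"
proof
  assume "zpole m = 2 / 3"
  then have "Re (zpole m) = Re (2 / 3)" by (rule arg_cong)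
  then have "real (3 * m) = - 1" by (simp add: Re_zpole)
  then show False by simp
qed

text \<open>Hence the finite sum with \<open>M = 2 * L + 3\<close> terms already accounts for every
  candidate pole in the strip.\<close>

lemma zpole_less:
  assumes "zpole m \<in> strip L"
  shows "m < 2 * L + 3"
proof -
  have "- real L < (1 - real m) / 2" using assms by (simp add: Re_zpole)
  then have "real m < real (2 * L + 3)" by simp
  then show ?thesis by (simp only: of_nat_less_iff)
qed

lemma in_strip_exists: "Re z < 3 / 4 \<Longrightarrow> \<exists>L. z \<in> strip L"
  by (rule exI[of _ "Suc (nat \<lceil>- Re z\<rceil>)"]) (simp, linarith)

lemma Re_zpole_less: "Re (zpole m) < 3 / 4"
  by (simp add: Re_zpole)

lemma omega_ext_at_zpole:
  shows "isolated_singularity_at omega_ext (zpole m)" "not_essential omega_ext (zpole m)"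
    and "zcoeff m (zpole m) \<noteq> 0 \<Longrightarrow> is_pole omega_ext (zpole m) \<and> zorder omega_ext (zpole m) = - 1
       \<and> residue omega_ext (zpole m) = zcoeff m (zpole m)"
    and "zcoeff m (zpole m) = 0 \<Longrightarrow> \<exists>c. omega_ext \<midarrow>zpole m\<rightarrow> c"
proof -
  obtain L where L: "zpole m \<in> strip L" using in_strip_exists[OF Re_zpole_less] by blast
  define M where "M = 2 * L + 3"
  have m: "m < M" using zpole_less[OF L] by (simp add: M_def)
  define U where "U = strip L - insert (2 / 3) (zpole ` ({..<M} - {m}))"
  have U: "open U" unfolding U_def
    by (intro open_Diff strip_open finite_imp_closed) auto
  have z: "zpole m \<in> U" unfolding U_def
    using L zpole_neq_two_thirds[of m] by (auto simp: inj_zpole)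
  have sub: "U \<subseteq> strip L" by (auto simp: U_def)
  define B where "B s = bcoeff s / (s - 2 / 3) + (\<Sum>n\<in>{..<M} - {m}. zcoeff n s / (s - zpole n)) + (\<Sum>n. tsum_rem M s (Suc n))" for s
  have hB: "B holomorphic_on U" unfolding B_def
    by (intro holomorphic_intros holomorphic_on_subset[OF holomorphic_bcoeff sub] holomorphic_on_subset[OF holomorphic_zcoeff sub]
        holomorphic_on_subset[OF holomorphic_tsum_rem_suminf sub]) (auto simp: M_def U_def)
  have dec: "omega_ext w = zcoeff m w / (w - zpole m) + B w" if "w \<in> U" "w \<noteq> zpole m" for w
  proof -
    have "omega_ext w = bcoeff w / (w - 2 / 3) + (\<Sum>n<M. zcoeff n w / (w - zpole n)) + (\<Sum>n. tsum_rem M w (Suc n))"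
      by (rule omega_ext_decomp[of L]) (use that in \<open>auto simp: U_def M_def\<close>)
    then show ?thesis using m by (simp add: B_def sum.remove[of "{..<M}" m])
  qed
  note * = simple_pole_decomp[OF U z holomorphic_on_subset[OF holomorphic_zcoeff sub] hB dec]
  show "isolated_singularity_at omega_ext (zpole m)" "not_essential omega_ext (zpole m)"
    "zcoeff m (zpole m) \<noteq> 0 \<Longrightarrow> is_pole omega_ext (zpole m) \<and> zorder omega_ext (zpole m) = - 1
       \<and> residue omega_ext (zpole m) = zcoeff m (zpole m)"
    "zcoeff m (zpole m) = 0 \<Longrightarrow> \<exists>c. omega_ext \<midarrow>zpole m\<rightarrow> c"
    using * by blast+
qed

lemma omega_ext_at_two_thirds:
  shows "isolated_singularity_at omega_ext (2 / 3)" "not_essential omega_ext (2 / 3)"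
    and "bcoeff (2 / 3) \<noteq> 0 \<Longrightarrow> is_pole omega_ext (2 / 3) \<and> zorder omega_ext (2 / 3) = - 1
       \<and> residue omega_ext (2 / 3) = bcoeff (2 / 3)"
proof -
  define M where "M = 2 * 1 + (3 :: nat)"
  define U where "U = strip 1 - zpole ` {..<M}"
  have U: "open U" unfolding U_def
    by (intro open_Diff strip_open finite_imp_closed) auto
  have "(2 / 3 :: complex) \<in> strip 1" by simp
  moreover have "(2 / 3 :: complex) \<notin> zpole ` {..<M}" using zpole_neq_two_thirds by (metis imageE)
  ultimately have z: "2 / 3 \<in> U" unfolding U_def by blast
  have sub: "U \<subseteq> strip 1" by (auto simp: U_def)
  define B where "B s = (\<Sum>n<M. zcoeff n s / (s - zpole n)) + (\<Sum>n. tsum_rem M s (Suc n))" for s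
  have hB: "B holomorphic_on U" unfolding B_def
    by (intro holomorphic_intros holomorphic_on_subset[OF holomorphic_zcoeff sub]
        holomorphic_on_subset[OF holomorphic_tsum_rem_suminf sub]) (auto simp: M_def U_def)
  have dec: "omega_ext w = bcoeff w / (w - 2 / 3) + B w" if "w \<in> U" "w \<noteq> 2 / 3" for w
    unfolding B_def add.assoc[symmetric]
    by (rule omega_ext_decomp[of 1]) (use that in \<open>auto simp: U_def M_def\<close>)
  note * = simple_pole_decomp[OF U z holomorphic_on_subset[OF holomorphic_bcoeff sub] hB dec]
  show "isolated_singularity_at omega_ext (2 / 3)" "not_essential omega_ext (2 / 3)"
    "bcoeff (2 / 3) \<noteq> 0 \<Longrightarrow> is_pole omega_ext (2 / 3) \<and> zorder omega_ext (2 / 3) = - 1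
       \<and> residue omega_ext (2 / 3) = bcoeff (2 / 3)"
    using * by blast+
qed

lemma omega_ext_analytic:
  assumes "z \<noteq> 2 / 3" "z \<notin> range zpole"
  shows "omega_ext analytic_on {z}"
proof (cases "Re z > 2 / 3")
  case True
  have "omega_ext holomorphic_on {s. Re s > 2 / 3}"
    using holomorphic_omega by (rule holomorphic_transform) (simp add: omega_ext_def)
  then show ?thesis
    using open_halfspace_Re_gt by (rule holomorphic_on_imp_analytic_at) (use True in simp)
next
  case False
  then obtain L where L: "z \<in> strip L" using in_strip_exists[of z] by force
  define M where "M = 2 * L + 3"
  define U where "U = strip L - insert (2 / 3) (zpole ` {..<M})"
  have U: "open U" unfolding U_def
    by (intro open_Diff strip_open finite_imp_closed) auto
  have z: "z \<in> U" using L assms by (auto simp: U_def)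
  have sub: "U \<subseteq> strip L" by (auto simp: U_def)
  have "(\<lambda>s. bcoeff s / (s - 2 / 3) + (\<Sum>n<M. zcoeff n s / (s - zpole n)) + (\<Sum>n. tsum_rem M s (Suc n))) holomorphic_on U"
    by (intro holomorphic_intros holomorphic_on_subset[OF holomorphic_bcoeff sub] holomorphic_on_subset[OF holomorphic_zcoeff sub]
        holomorphic_on_subset[OF holomorphic_tsum_rem_suminf sub]) (auto simp: M_def U_def)
  then have "omega_ext holomorphic_on U"
    by (rule holomorphic_transform, intro omega_ext_decomp[of L, symmetric]) (auto simp: U_def M_def)
  then show ?thesis using U z by (rule holomorphic_on_imp_analytic_at)
qed

subsection \<open>Residues\<close>

lemma zcoeff_zpole: "zcoeff m (zpole m) = pochhammer (zpole m) m / fact m * riemann_zeta (zpole m - of_nat m)"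
proof -
  have "2 * zpole m + of_nat m = 1" by (simp add: zpole_def diff_divide_distrib)
  then show ?thesis by (simp add: zcoeff_def)
qed

text \<open>The point is the integer \<open>- l\<close>, and the Pochhammer product of length
  \<open>2 * l + 1\<close> starting there passes through 0.\<close>

lemma zcoeff_zpole_odd: "zcoeff (2 * l + 1) (zpole (2 * l + 1)) = 0"
proof -
  have "zpole (2 * l + 1) = - of_nat l" by (simp add: zpole_def field_simps)
  moreover have "pochhammer (- of_nat l :: complex) (2 * l + 1) = 0"
    by (subst pochhammer_of_nat_eq_0_iff) simp
  ultimately have "pochhammer (zpole (2 * l + 1)) (2 * l + 1) = 0" by (simp only:)
  then show ?thesis unfolding zcoeff_zpole by (simp only: div_0 mult_zero_left)
qed

lemma zpole_even: "zpole (2 * k) = 1 / 2 - of_nat k"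
  by (simp add: zpole_def field_simps)

text \<open>The Pochhammer product from \<open>1 / 2 - k\<close> of length \<open>2 * k\<close> is
  symmetric about 0 up to sign, giving \<open>(- 1) ^ k\<close> times the square of that of
  \<open>1 / 2\<close>. The duplication formula for \<open>fact (2 * k)\<close> turns one of these
  factors into the central binomial coefficient.\<close>

lemma zcoeff_zpole_even:
  "zcoeff (2 * k) (zpole (2 * k)) = (- 1) ^ k / 2 ^ (4 * k) * of_nat ((2 * k) choose k) * riemann_zeta ((1 - 6 * of_nat k) / 2)"
proof -
  let ?P = "pochhammer (1 / 2 :: complex) k"
  have "pochhammer (1 / 2 - of_nat k :: complex) (2 * k) = pochhammer (1 / 2 - of_nat k) k * ?P"
    using pochhammer_product'[of "1 / 2 - of_nat k :: complex" k k] by (simp add: mult_2)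
  also have "pochhammer (1 / 2 - of_nat k :: complex) k = (- 1) ^ k * ?P"
    using pochhammer_minus[of "of_nat k - 1 / 2 :: complex" k] by simp
  finally have 1: "pochhammer (1 / 2 - of_nat k :: complex) (2 * k) = (- 1) ^ k * ?P ^ 2"
    by (simp add: power2_eq_square)
  have 2: "fact (2 * k) = (2 ^ (2 * k) * ?P * fact k :: complex)" by (rule fact_double)
  have P0: "?P \<noteq> 0"
  proof
    assume "?P = 0"
    then have "fact (2 * k) = (0 :: complex)" using 2 by simp
    then show False by simp
  qed
  have 3: "of_nat ((2 * k) choose k) = (fact (2 * k) / (fact k * fact k) :: complex)"
    by (subst binomial_fact) (auto simp: mult_2)
  have "pochhammer (1 / 2 - of_nat k :: complex) (2 * k) / fact (2 * k) = (- 1) ^ k / 2 ^ (4 * k) * of_nat ((2 * k) choose k)"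
    unfolding 1 3 unfolding 2 using P0 by (simp add: field_simps power2_eq_square flip: power_add)
  moreover have "1 / 2 - of_nat k - of_nat (2 * k) = (1 - 6 * of_nat k :: complex) / 2" by (simp add: field_simps)
  ultimately show ?thesis unfolding zcoeff_zpole unfolding zpole_even by (simp only:)
qed

text \<open>At \<open>2 / 3\<close> the zeta factor contributes its residue, so the value is
  \<open>Beta (1 / 3) (1 / 3) / 3\<close>; the reflection formula eliminates
  \<open>Gamma (2 / 3)\<close>.\<close>

lemma bcoeff_two_thirds: "bcoeff (2 / 3) = of_real (1 / (2 * pi * sqrt 3) * Gamma (1 / 3) ^ 3)"
proof -
  have "complex_of_real (Gamma (1 / 3) * Gamma (2 / 3)) = of_real (pi / sin (pi / 3))"
    using Gamma_reflection_complex[of "of_real (1 / 3)"]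
      Gamma_complex_of_real[of "1 / 3"] Gamma_complex_of_real[of "2 / 3"] sin_of_real[of "pi / 3", where 'a = complex]
    by simp
  then have "Gamma (1 / 3 :: real) * Gamma (2 / 3) = pi / sin (pi / 3)"
    by (simp only: of_real_eq_iff)
  then have "Gamma (1 / 3 :: real) * Gamma (2 / 3) = 2 * pi / sqrt 3"
    by (simp add: sin_60)
  then have "sqrt 3 * Gamma (1 / 3) * Gamma (2 / 3) = 2 * pi" by (simp add: field_simps)
  moreover have G: "Gamma (1 / 3 :: real) \<noteq> 0" using Gamma_real_pos[of "1 / 3"] by linarith
  ultimately have G2: "Gamma (2 / 3 :: real) = 2 * pi / (sqrt 3 * Gamma (1 / 3))"
    by (metis nonzero_mult_div_cancel_left mult_eq_0_iff real_sqrt_eq_zero_cancel_iff zero_neq_numeral)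
  have "Beta (1 / 3) (1 / 3) / 3 = Gamma (1 / 3) * Gamma (1 / 3) / (3 * Gamma (2 / 3 :: real))"
    by (simp add: Beta_def)
  also have "\<dots> = 1 / (2 * pi * sqrt 3) * Gamma (1 / 3) ^ 3"
  proof -
    have "Gamma (1 / 3) * Gamma (1 / 3) / (3 * Gamma (2 / 3 :: real)) = sqrt 3 / (6 * pi) * Gamma (1 / 3) ^ 3"
      unfolding G2 using G by (simp add: power3_eq_cube)
    moreover have "sqrt 3 / (6 * pi) = 1 / (2 * pi * sqrt 3)"
    proof (rule frac_eq_eq[THEN iffD2])
      have "sqrt 3 * (2 * pi * sqrt 3) = (sqrt 3 * sqrt 3) * (2 * pi)" by (simp only: mult_ac)
      also have "sqrt 3 * sqrt 3 = (3 :: real)" by (rule real_sqrt_mult_self[THEN trans]) simp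
      finally show "sqrt 3 * (2 * pi * sqrt 3) = 1 * (6 * pi)" by simp
    qed auto
    ultimately show ?thesis by (simp only:)
  qed
  finally have "Beta (1 / 3) (1 / 3) / 3 = 1 / (2 * pi * sqrt 3) * Gamma (1 / 3 :: real) ^ 3" .
  moreover have "bcoeff (2 / 3) = of_real (Beta (1 / 3) (1 / 3) / 3)"
    by (simp add: bcoeff_def bint_two_thirds)
  ultimately show ?thesis by (simp only:)
qed

lemma bcoeff_two_thirds_nonzero: "bcoeff (2 / 3) \<noteq> 0"
proof -
  have "Gamma (1 / 3 :: real) \<noteq> 0" using Gamma_real_pos[of "1 / 3"] by linarith
  then show ?thesis unfolding bcoeff_two_thirds of_real_eq_0_iff by simp
qed

subsection \<open>Polynomial growth\<close>

definition poly_bounded :: "complex set \<Rightarrow> (complex \<Rightarrow> complex) \<Rightarrow> bool" where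
  "poly_bounded S f \<longleftrightarrow> (\<exists>C k. C \<ge> 0 \<and> (\<forall>s\<in>S. norm (f s) \<le> C * (1 + norm s) ^ k))"

lemma poly_boundedI: "C \<ge> 0 \<Longrightarrow> (\<And>s. s \<in> S \<Longrightarrow> norm (f s) \<le> C * (1 + norm s) ^ k) \<Longrightarrow> poly_bounded S f"
  unfolding poly_bounded_def by blast

lemma poly_bounded_const: "poly_bounded S (\<lambda>_. c)"
  by (rule poly_boundedI[of "norm c" _ _ 0]) auto

lemma poly_bounded_add:
  assumes "poly_bounded S f" "poly_bounded S g"
  shows "poly_bounded S (\<lambda>s. f s + g s)"
proof -
  obtain C k D l where *: "C \<ge> 0" "D \<ge> 0" "\<And>s. s \<in> S \<Longrightarrow> norm (f s) \<le> C * (1 + norm s) ^ k"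
    "\<And>s. s \<in> S \<Longrightarrow> norm (g s) \<le> D * (1 + norm s) ^ l"
    using assms unfolding poly_bounded_def by metis
  show ?thesis
  proof (rule poly_boundedI[of "C + D" _ _ "k + l"])
    fix s assume s: "s \<in> S"
    have "norm (f s + g s) \<le> C * (1 + norm s) ^ k + D * (1 + norm s) ^ l"
      by (intro norm_triangle_le add_mono * s)
    also have "\<dots> \<le> C * (1 + norm s) ^ (k + l) + D * (1 + norm s) ^ (k + l)"
      using * by (intro add_mono mult_left_mono power_increasing) auto
    finally show "norm (f s + g s) \<le> (C + D) * (1 + norm s) ^ (k + l)" by (simp add: ring_distribs)
  qed (use * in auto)
qed

lemma poly_bounded_mult:
  assumes "poly_bounded S f" "poly_bounded S g"
  shows "poly_bounded S (\<lambda>s. f s * g s)"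
proof -
  obtain C k D l where *: "C \<ge> 0" "D \<ge> 0" "\<And>s. s \<in> S \<Longrightarrow> norm (f s) \<le> C * (1 + norm s) ^ k"
    "\<And>s. s \<in> S \<Longrightarrow> norm (g s) \<le> D * (1 + norm s) ^ l"
    using assms unfolding poly_bounded_def by metis
  show ?thesis
  proof (rule poly_boundedI[of "C * D" _ _ "k + l"])
    fix s assume s: "s \<in> S"
    have "norm (f s * g s) \<le> (C * (1 + norm s) ^ k) * (D * (1 + norm s) ^ l)"
      unfolding norm_mult using * by (intro mult_mono * s) auto
    then show "norm (f s * g s) \<le> C * D * (1 + norm s) ^ (k + l)" by (simp add: power_add mult_ac)
  qed (use * in auto)
qed

lemma poly_bounded_sum:
  "(\<And>i. i \<in> I \<Longrightarrow> poly_bounded S (f i)) \<Longrightarrow> poly_bounded S (\<lambda>s. \<Sum>i\<in>I. f i s)"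
  by (induction I rule: infinite_finite_induct) (auto intro: poly_bounded_const poly_bounded_add)

lemma poly_bounded_pochhammer: "poly_bounded S (\<lambda>s. pochhammer s m)"
proof (rule poly_boundedI[of "(1 + real m) ^ m" _ _ m])
  fix s assume "s \<in> S"
  have "norm (pochhammer s m) \<le> (norm s + real m) ^ m" by (rule norm_pochhammer_le)
  also have "\<dots> \<le> ((1 + real m) * (1 + norm s)) ^ m" by (intro power_mono) (auto simp: algebra_simps)
  finally show "norm (pochhammer s m) \<le> (1 + real m) ^ m * (1 + norm s) ^ m" by (simp add: power_mult_distrib)
qed auto

text \<open>The condition on the imaginary part keeps the argument at distance at least 1 from the
  pole, so the polar term in \<open>norm_riemann_zeta_le\<close> is at most 1.\<close>

lemma poly_bounded_zeta:
  assumes "\<And>s. s \<in> S \<Longrightarrow> norm (f s) \<le> c * (1 + norm s)" "\<And>s. s \<in> S \<Longrightarrow> - real d \<le> Re (f s)"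
    and "\<And>s. s \<in> S \<Longrightarrow> \<bar>Im (f s)\<bar> \<ge> 1" "c \<ge> 0"
  shows "poly_bounded S (\<lambda>s. riemann_zeta (f s))"
proof -
  define R where "R = d + 2"
  define C where "C = 2 + em_const R * (1 + inverse_squares_sum) * (c + real R) ^ R"
  have C0: "em_const R * (1 + inverse_squares_sum) \<ge> 0" using em_const_ge[of R] inverse_squares_sum_ge by simp
  then have C: "C \<ge> 0" using assms(4) by (simp add: C_def)
  show ?thesis
  proof (rule poly_boundedI[OF C, where k = R])
    fix s assume s: "s \<in> S"
    have one: "1 \<le> norm (1 - f s)" using assms(3)[OF s] abs_Im_le_cmod[of "1 - f s"] by simp
    then have ne: "f s \<noteq> 1" by auto
    have one': "1 / norm (1 - f s) \<le> 1" using one by (subst divide_le_eq_1_pos) linarith+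
    have p: "1 \<le> (1 + norm s) ^ R" by (intro one_le_power) auto
    have "norm (riemann_zeta (f s)) \<le> 1 + 1 / norm (1 - f s) + em_const R * (1 + inverse_squares_sum) * (norm (f s) + real R) ^ R"
      by (rule norm_riemann_zeta_le) (use ne assms(2)[OF s] in \<open>auto simp: R_def\<close>)
    also have "\<dots> \<le> 1 + 1 + em_const R * (1 + inverse_squares_sum) * ((c + real R) * (1 + norm s)) ^ R"
    proof (intro add_mono mult_left_mono power_mono C0)
      have "norm (f s) + real R \<le> c * (1 + norm s) + real R * (1 + norm s)"
        by (intro add_mono assms s) (simp add: algebra_simps)
      then show "norm (f s) + real R \<le> (c + real R) * (1 + norm s)" by (simp add: algebra_simps)
    qed (use one' in auto)
    also have "\<dots> \<le> 2 * (1 + norm s) ^ R + em_const R * (1 + inverse_squares_sum) * ((c + real R) * (1 + norm s)) ^ R"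
      using p by simp
    also have "\<dots> = C * (1 + norm s) ^ R" unfolding power_mult_distrib C_def by (simp only: distrib_right mult.assoc)
    finally show "norm (riemann_zeta (f s)) \<le> C * (1 + norm s) ^ R" .
  qed
qed

lemma omega_ext_poly_bounded: "poly_bounded {s. - real L \<le> Re s \<and> Re s \<le> 3 / 4 \<and> \<bar>Im s\<bar> \<ge> 1} omega_ext"
proof -
  let ?S = "{s. - real L \<le> Re s \<and> Re s \<le> 3 / 4 \<and> \<bar>Im s\<bar> \<ge> 1}"
  define M where "M = 2 * L + 3"
  have zeta1: "poly_bounded ?S (\<lambda>s. riemann_zeta (3 * s - 1))"
  proof (rule poly_bounded_zeta[of _ _ 3 "3 * L + 1"])
    fix s assume "s \<in> ?S"
    show "norm (3 * s - 1) \<le> 3 * (1 + norm s)"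
      using norm_triangle_ineq4[of "3 * s" 1] by (simp add: norm_mult)
  qed auto
  have zeta2: "poly_bounded ?S (\<lambda>s. riemann_zeta (2 * s + of_nat m))" for m
  proof (rule poly_bounded_zeta[of _ _ "2 + real m" "2 * L"])
    fix s assume "s \<in> ?S"
    have "norm (2 * s + of_nat m) \<le> 2 * norm s + real m"
      using norm_triangle_ineq[of "2 * s" "of_nat m"] by (simp add: norm_mult)
    also have "\<dots> \<le> (2 + real m) * (1 + norm s)" by (simp add: algebra_simps)
    finally show "norm (2 * s + of_nat m) \<le> (2 + real m) * (1 + norm s)" .
  qed auto
  have zeta3: "poly_bounded ?S (\<lambda>s. riemann_zeta (s - of_nat m))" for m
  proof (rule poly_bounded_zeta[of _ _ "1 + real m" "L + m"])
    fix s assume "s \<in> ?S"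
    have "norm (s - of_nat m) \<le> norm s + real m"
      using norm_triangle_ineq4[of "s" "of_nat m"] by simp
    also have "\<dots> \<le> (1 + real m) * (1 + norm s)" by (simp add: algebra_simps)
    finally show "norm (s - of_nat m) \<le> (1 + real m) * (1 + norm s)" .
  qed auto
  have b: "poly_bounded ?S bint"
  proof (rule poly_boundedI[of "max 0 (Beta (1/4) (1/4))" _ _ 0])
    fix s assume "s \<in> ?S"
    then show "norm (bint s) \<le> max 0 (Beta (1/4) (1/4)) * (1 + norm s) ^ 0"
      using norm_bint_le[of s] by auto
  qed auto
  have P: "poly_bounded ?S (\<lambda>s. pochhammer s m / fact m)" for m
    unfolding divide_inverse by (intro poly_bounded_mult poly_bounded_pochhammer poly_bounded_const)
  have rem1: "poly_bounded ?S (\<lambda>s. tsum_rem M s 1)"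
  proof -
    have "poly_bounded ?S (\<lambda>s. (- 1) * (bint s + 2 * (\<Sum>m<M. pochhammer s m / fact m * riemann_zeta (s - of_nat m))))"
      by (intro poly_bounded_mult poly_bounded_const poly_bounded_add poly_bounded_sum b P zeta3)
    then show ?thesis by (simp add: tsum_rem_def tsum_main_def tsum_def)
  qed
  have rem2: "poly_bounded ?S (\<lambda>s. \<Sum>n. tsum_rem M s (n + 2))"
  proof -
    have M3: "M \<ge> 2 * L + 3" by (simp add: M_def)
    obtain C k where C: "C \<ge> 0" "\<And>s n. - real L \<le> Re s \<Longrightarrow> Re s \<le> 3 / 4 \<Longrightarrow>
       norm (tsum_rem M s (n + 2)) \<le> C * (1 + norm s) ^ k * (1 / real (Suc n) ^ 2)"
      using tsum_rem_bound_summable[OF M3] by blast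
    show ?thesis
    proof (rule poly_boundedI[of "C * inverse_squares_sum" _ _ k])
      fix s assume "s \<in> ?S"
      then have s: "- real L \<le> Re s" "Re s \<le> 3 / 4" by auto
      have "norm (\<Sum>n. tsum_rem M s (n + 2)) \<le> (\<Sum>n. C * (1 + norm s) ^ k * (1 / real (Suc n) ^ 2))"
        by (intro norm_suminf_le C s summable_mult summable_inverse_squares_sum)
      also have "\<dots> = C * (1 + norm s) ^ k * inverse_squares_sum" unfolding inverse_squares_sum_def by (rule suminf_mult[OF summable_inverse_squares_sum])
      finally show "norm (\<Sum>n. tsum_rem M s (n + 2)) \<le> C * inverse_squares_sum * (1 + norm s) ^ k" by (simp add: mult_ac)
    qed (use C(1) inverse_squares_sum_ge in auto)
  qed
  have "poly_bounded ?S (\<lambda>s. bint s * riemann_zeta (3 * s - 1)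
     + 2 * (\<Sum>m<M. pochhammer s m / fact m * (riemann_zeta (2 * s + of_nat m) * riemann_zeta (s - of_nat m)))
     + (tsum_rem M s 1 + (\<Sum>n. tsum_rem M s (n + 2))))"
    by (intro poly_bounded_add poly_bounded_mult poly_bounded_sum poly_bounded_const b zeta1 zeta2 zeta3 P rem1 rem2)
  moreover have "omega_ext s = bint s * riemann_zeta (3 * s - 1)
     + 2 * (\<Sum>m<M. pochhammer s m / fact m * (riemann_zeta (2 * s + of_nat m) * riemann_zeta (s - of_nat m)))
     + (tsum_rem M s 1 + (\<Sum>n. tsum_rem M s (n + 2)))" if "s \<in> ?S" for s
  proof -
    have "summable (\<lambda>n. tsum_rem M s (Suc n))" using that by (intro summable_tsum_rem[of L]) (auto simp: M_def)
    from suminf_split_head[OF this]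
    have "tsum_rem M s 1 + (\<Sum>n. tsum_rem M s (n + 2)) = (\<Sum>n. tsum_rem M s (Suc n))" by simp
    moreover have "omega_ext s = omega_left M s" using that by (intro omega_ext_eq[of L]) (auto simp: M_def)
    ultimately show ?thesis by (simp add: omega_left_def)
  qed
  ultimately show ?thesis unfolding poly_bounded_def by (metis (no_types, lifting))
qed

subsection \<open>The meromorphic continuation\<close>

lemma zcoeff_zpole_even_nonzero: "zcoeff (2 * k) (zpole (2 * k)) \<noteq> 0"
  unfolding zcoeff_zpole_even by (simp add: riemann_zeta_nonzero)

lemma zpole_cases:
  obtains k where "zpole m = 1 / 2 - of_nat k" "m = 2 * k" | l where "m = 2 * l + 1"
  using zpole_even by (cases "even m") (auto elim!: evenE oddE)

lemma omega_ext_meromorphic: "omega_ext meromorphic_on UNIV"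
  unfolding meromorphic_on_altdef
proof
  fix z
  show "isolated_singularity_at omega_ext z \<and> not_essential omega_ext z"
  proof (cases "z = 2 / 3 \<or> z \<in> range zpole")
    case True
    then show ?thesis using omega_ext_at_two_thirds(1,2) omega_ext_at_zpole(1,2) by blast
  next
    case False
    then have "omega_ext analytic_on {z}" using omega_ext_analytic by blast
    then show ?thesis using isolated_singularity_at_analytic not_essential_analytic by blast
  qed
qed

lemma omega_ext_isolated: "isolated_singularity_at omega_ext z"
  using omega_ext_meromorphic unfolding meromorphic_on_altdef by blast

text \<open>To the right of 3/4 the absolute series at 3/4 bounds the function. To the left it is
  polynomially bounded in \<open>1 + norm s\<close>, which \<open>\<bar>t\<bar> \<ge> 1\<close>
  converts into a multiple \<open>c\<close> of \<open>\<bar>t\<bar>\<close>.\<close>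

lemma omega_ext_growth:
  assumes "a \<le> b"
  shows "\<exists>C M :: real. C > 0 \<and> M > 0 \<and> (\<forall>\<sigma>\<in>{a..b}. \<forall>t::real. \<bar>t\<bar> \<ge> 1 \<longrightarrow>
           norm (omega_ext (Complex \<sigma> t)) \<le> C * \<bar>t\<bar> powr M)"
proof -
  define L where "L = nat \<lceil>- a\<rceil>"
  have L: "- real L \<le> a" unfolding L_def by linarith
  obtain C k where C: "C \<ge> 0" "\<And>s. - real L \<le> Re s \<Longrightarrow> Re s \<le> 3 / 4 \<Longrightarrow> \<bar>Im s\<bar> \<ge> 1 \<Longrightarrow> norm (omega_ext s) \<le> C * (1 + norm s) ^ k"
    using omega_ext_poly_bounded[of L] unfolding poly_bounded_def by blast
  define B where "B = suminf (omegaR (3 / 4))"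
  have B: "norm (omega_ext s) \<le> B" if "Re s \<ge> 3 / 4" for s
    using norm_omega_le[of "3 / 4" s] that by (simp add: omega_ext_def B_def)
  have B0: "B \<ge> 0" using order_trans[OF norm_ge_zero B[of 1]] by simp
  define c where "c = 2 + \<bar>a\<bar> + \<bar>b\<bar>"
  define D where "D = C * c ^ k + B + 1"
  have c: "c \<ge> 1" by (simp add: c_def)
  show ?thesis
  \<comment> \<open>The exponent \<open>k + 1\<close> rather than \<open>k\<close> ensures
    \<open>M > 0\<close> when \<open>k = 0\<close>.\<close>
  proof (rule exI[of _ D], rule exI[of _ "real (k + 1)"], intro conjI ballI allI impI)
    show "D > 0" using C(1) B0 c by (simp add: D_def add_nonneg_pos)
    fix \<sigma> t :: real assume \<sigma>: "\<sigma> \<in> {a..b}" and t: "\<bar>t\<bar> \<ge> 1"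
    have tp: "\<bar>t\<bar> powr real (k + 1) = \<bar>t\<bar> ^ (k + 1)" using t by (intro powr_realpow) auto
    have t1: "1 \<le> \<bar>t\<bar> ^ (k + 1)" using t by (rule one_le_power)
    have "norm (omega_ext (Complex \<sigma> t)) \<le> D * \<bar>t\<bar> ^ (k + 1)"
    proof (cases "\<sigma> \<ge> 3 / 4")
      case True
      then have "norm (omega_ext (Complex \<sigma> t)) \<le> B" using B[of "Complex \<sigma> t"] by simp
      moreover have "C * c ^ k \<ge> 0" using C(1) c by simp
      ultimately have "norm (omega_ext (Complex \<sigma> t)) \<le> D * 1" by (simp add: D_def)
      also have "\<dots> \<le> D * \<bar>t\<bar> ^ (k + 1)" using t1 C(1) B0 c by (intro mult_left_mono) (auto simp: D_def)
      finally show ?thesis .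
    next
      case False
      have "norm (Complex \<sigma> t) \<le> \<bar>\<sigma>\<bar> + \<bar>t\<bar>" using cmod_le[of "Complex \<sigma> t"] by simp
      then have "1 + norm (Complex \<sigma> t) \<le> (1 + \<bar>a\<bar> + \<bar>b\<bar>) * 1 + \<bar>t\<bar>" using \<sigma> by auto
      also have "\<dots> \<le> (1 + \<bar>a\<bar> + \<bar>b\<bar>) * \<bar>t\<bar> + \<bar>t\<bar>" using t by (intro add_mono mult_left_mono) auto
      also have "\<dots> = c * \<bar>t\<bar>" by (simp add: c_def algebra_simps)
      finally have n: "1 + norm (Complex \<sigma> t) \<le> c * \<bar>t\<bar>" .
      have "norm (omega_ext (Complex \<sigma> t)) \<le> C * (1 + norm (Complex \<sigma> t)) ^ k"
        using False \<sigma> L t by (intro C) auto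
      also have "\<dots> \<le> C * (c * \<bar>t\<bar>) ^ k" using C(1) n by (intro mult_left_mono power_mono) auto
      also have "\<dots> = C * c ^ k * \<bar>t\<bar> ^ k" by (simp add: power_mult_distrib)
      also have "\<dots> \<le> D * \<bar>t\<bar> ^ (k + 1)"
        using C(1) B0 c t by (intro mult_mono power_increasing) (auto simp: D_def)
      finally show ?thesis .
    qed
    then show "norm (omega_ext (Complex \<sigma> t)) \<le> D * \<bar>t\<bar> powr real (k + 1)" unfolding tp .
  qed simp
qed

theorem theorem1p2:
  shows "(\<forall>s. omega_term s summable_on ({1..} \<times> {1..}) \<longleftrightarrow> Re s > 2 / 3)
    \<and> omega holomorphic_on {s. Re s > 2 / 3}
    \<and> (\<exists>W. W meromorphic_on UNIV
         \<and> (\<forall>s. Re s > 2 / 3 \<longrightarrow> W s = omega s)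
         \<and> is_pole W (2 / 3) \<and> zorder W (2 / 3) = - 1
         \<and> residue W (2 / 3) = of_real (1 / (2 * pi * sqrt 3) * Gamma (1 / 3) ^ 3)
         \<and> (\<forall>k::nat. is_pole W (1 / 2 - of_nat k) \<and> zorder W (1 / 2 - of_nat k) = - 1
              \<and> residue W (1 / 2 - of_nat k) =
                  (- 1) ^ k / 2 ^ (4 * k) * of_nat ((2 * k) choose k)
                    * riemann_zeta ((1 - 6 * of_nat k) / 2))
         \<and> W analytic_on - ({2 / 3} \<union> range (\<lambda>k::nat. 1 / 2 - of_nat k))
         \<and> (\<forall>a b :: real. a \<le> b \<longrightarrow>
              (\<exists>C M :: real. C > 0 \<and> M > 0 \<and>
                (\<forall>\<sigma>\<in>{a..b}. \<forall>t::real. \<bar>t\<bar> \<ge> 1 \<longrightarrow>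
                   norm (W (Complex \<sigma> t)) \<le> C * \<bar>t\<bar> powr M))))"
\<comment> \<open>\<open>omega_ext\<close> has arbitrary values at its removable singularities, the
  odd \<open>zpole\<close> points. \<open>remove_sings\<close> replaces them by limits, without
  affecting poles, orders, residues or values at analytic points.\<close>
proof (intro conjI exI[of _ "remove_sings omega_ext"] allI impI)
  show "omega_term s summable_on ({1..} \<times> {1..}) \<longleftrightarrow> Re s > 2 / 3" for s
    by (rule omega_term_summable_iff)
  show "omega holomorphic_on {s. Re s > 2 / 3}" by (rule holomorphic_omega)
  show "remove_sings omega_ext meromorphic_on UNIV"
    by (intro remove_sings_meromorphic omega_ext_meromorphic)
  show "remove_sings omega_ext s = omega s" if s: "Re s > 2 / 3" for s
  proof -
    have "s \<noteq> 2 / 3"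
    proof
      assume "s = 2 / 3"
      then have "Re s = Re (2 / 3)" by (rule arg_cong)
      then show False using s by simp
    qed
    moreover have "s \<noteq> zpole m" for m using s Re_zpole[of m] by auto
    ultimately have "omega_ext analytic_on {s}" using omega_ext_analytic by blast
    then show ?thesis using s by (simp add: omega_ext_def)
  qed
  note at23 = omega_ext_at_two_thirds(3)[OF bcoeff_two_thirds_nonzero]
  show "is_pole (remove_sings omega_ext) (2 / 3)" "zorder (remove_sings omega_ext) (2 / 3) = - 1"
    "residue (remove_sings omega_ext) (2 / 3) = of_real (1 / (2 * pi * sqrt 3) * Gamma (1 / 3) ^ 3)"
    using at23 bcoeff_two_thirds
    by (simp_all only: is_pole_remove_sings_iff zorder_remove_sings residue_remove_sings omega_ext_isolated)
  fix k :: nat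
  note atk = omega_ext_at_zpole(3)[OF zcoeff_zpole_even_nonzero[of k], unfolded zcoeff_zpole_even, unfolded zpole_even]
  show "is_pole (remove_sings omega_ext) (1 / 2 - of_nat k)" "zorder (remove_sings omega_ext) (1 / 2 - of_nat k) = - 1"
    "residue (remove_sings omega_ext) (1 / 2 - of_nat k) = (- 1) ^ k / 2 ^ (4 * k) * of_nat ((2 * k) choose k)
                    * riemann_zeta ((1 - 6 * of_nat k) / 2)"
    using atk
    by (simp_all only: is_pole_remove_sings_iff zorder_remove_sings residue_remove_sings omega_ext_isolated)
next
  show "remove_sings omega_ext analytic_on - ({2 / 3} \<union> range (\<lambda>k::nat. 1 / 2 - of_nat k))"
    unfolding analytic_on_analytic_at[of _ "- _"]
  proof
    fix z assume z: "z \<in> - ({2 / 3} \<union> range (\<lambda>k::nat. 1 / 2 - of_nat k :: complex))"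
    show "remove_sings omega_ext analytic_on {z}"
    proof (cases "z \<in> range zpole")
      case True
      then obtain m where m: "z = zpole m" by auto
      then obtain l where "m = 2 * l + 1" using z by (cases m rule: zpole_cases) auto
      then have "zcoeff m (zpole m) = 0" using zcoeff_zpole_odd by simp
      then obtain c where "omega_ext \<midarrow>z\<rightarrow> c" using omega_ext_at_zpole(4) m by blast
      then show ?thesis by (rule remove_sings_analytic_at[OF omega_ext_isolated])
    next
      case False
      then have "omega_ext analytic_on {z}" using omega_ext_analytic z by blast
      then show ?thesis by (rule remove_sings_analytic_on)
    qed
  qed
next
  fix a b :: real assume ab: "a \<le> b"
  have eq: "remove_sings omega_ext (Complex \<sigma> t) = omega_ext (Complex \<sigma> t)" if "\<bar>t\<bar> \<ge> 1" for \<sigma> t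
  proof -
    have ne: "Complex \<sigma> t \<noteq> z" if "Im z = 0" for z using \<open>\<bar>t\<bar> \<ge> 1\<close> that by auto
    have "Im (zpole m) = 0" for m by (simp add: zpole_def)
    then have "Complex \<sigma> t \<notin> range zpole" using ne by blast
    moreover have "Complex \<sigma> t \<noteq> 2 / 3" by (rule ne) simp
    ultimately show ?thesis by (intro remove_sings_at_analytic omega_ext_analytic)
  qed
  show "\<exists>C M :: real. C > 0 \<and> M > 0 \<and> (\<forall>\<sigma>\<in>{a..b}. \<forall>t::real. \<bar>t\<bar> \<ge> 1 \<longrightarrow>
           norm (remove_sings omega_ext (Complex \<sigma> t)) \<le> C * \<bar>t\<bar> powr M)"
    using omega_ext_growth[OF ab] eq by simp
qed

end
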